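(* Checking whether a sequence of $n$ elements is a sorted version of another sequence of $n$ elements, with probability at least $1-\delta$ of detecting an incorrect result, is possible in time $$O\!\left(\left(\frac{n}{pw} + \beta\right) \log\frac1\delta + \alpha \log p\right).$$
   Context: Distributed model: $p$ processing elements (PEs), numbered $1..p$, connected by a network with full-duplex, single-ported communication; sending a message of $m$ bits takes time $\alpha+\beta m$; $\alpha,\beta$ are treated as variables in asymptotic analysis. Machine word size is $w$ bits; elements consist of a constant number of machine words and are totally ordered. Each sequence is distributed so that every PE holds $O(n/p)$ elements; the asserted sorted sequence is stored in PE order (PE $i$ holds a contiguous part preceding that of PE $i+1$). Random hash functions are available. $\log=\log_2$. A checker always accepts a correct result and accepts an incorrect one with probability at most $\delta$.
   Formalization: The stated bound fails when w is not O(log 1/δ), since all elements must be read. It is proved for w = O(log 1/δ), and for every δ in (0,1) with log(1/δ) replaced by max(log(1/δ), w). Also assumed: n ≥ 1, log n = O(w), and α ≥ 1 (time unit: one instruction). *)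

theory Defs
  imports
    "HOL-Probability.Probability"
    "HOL-Library.Discrete_Functions"
    "HOL-Library.Multiset"
begin

section \<open>Local computation on one PE\<close>

text \<open>
  Variables hold natural numbers of arbitrary size, read as multi-word bit strings, and every
  instruction is charged the number of \<^term>\<open>w\<close>-bit machine words it has to touch (schoolbook cost
  for multiplication and division).  Up to constant factors this is the cost on a word RAM with
  words of \<^term>\<open>w\<close> bits; instructions on numbers of O(w) bits take constant time.

  An element consists of \<^term>\<open>k\<close> machine words and is identified with the number below
  \<^term>\<open>2 ^ (k * w)\<close> these words spell.  The total order on the elements is arbitrary; it has nothing
  to do with the order of the encoding numbers.
\<close>

type_synonym vname = string
type_synonym store = "vname \<Rightarrow> nat"

definition elems :: "nat \<Rightarrow> nat \<Rightarrow> nat set" where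
  "elems w k = {..<2 ^ (k * w)}"

record pe_env =
  wsize :: nat                  \<comment> \<open>bits per machine word\<close>
  esize :: nat                  \<comment> \<open>machine words per element\<close>
  hbits :: nat                  \<comment> \<open>bits per hash value\<close>
  ord :: "(nat \<times> nat) set"      \<comment> \<open>total order on the elements\<close>
  hash :: "nat \<Rightarrow> nat"           \<comment> \<open>hash function, the same on all PEs\<close>
  input :: "nat list"           \<comment> \<open>local part of the input sequence\<close>
  asserted :: "nat list"        \<comment> \<open>local part of the asserted sorted sequence\<close>

datatype instr =
    Const vname nat
  | Copy vname vname
  | Add vname vname vname
  | Sub vname vname vname
  | Mul vname vname vname
  | Div vname vname vname
  | Less vname vname vname
  | Extract vname vname vname vname   \<comment> \<open>target, source, offset, length\<close>
  | Deposit vname vname vname vname   \<comment> \<open>target, source, offset, length\<close>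
  | ReadInput vname vname             \<comment> \<open>target, index\<close>
  | ReadAsserted vname vname          \<comment> \<open>target, index\<close>
  | LeqElem vname vname vname
  | Hash vname vname

fun exec_instr :: "pe_env \<Rightarrow> instr \<Rightarrow> store \<Rightarrow> store" where
  "exec_instr E (Const x c) s = s(x := c)"
| "exec_instr E (Copy x y) s = s(x := s y)"
| "exec_instr E (Add x y z) s = s(x := s y + s z)"
| "exec_instr E (Sub x y z) s = s(x := s y - s z)"
| "exec_instr E (Mul x y z) s = s(x := s y * s z)"
| "exec_instr E (Div x y z) s = s(x := s y div s z)"
| "exec_instr E (Less x y z) s = s(x := of_bool (s y < s z))"
| "exec_instr E (Extract x y off len) s = s(x := take_bit (s len) (drop_bit (s off) (s y)))"
| "exec_instr E (Deposit x y off len) s =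
     s(x := take_bit (s off) (s x) + push_bit (s off) (take_bit (s len) (s y))
            + push_bit (s off + s len) (drop_bit (s off + s len) (s x)))"
| "exec_instr E (ReadInput x y) s =
     s(x := if s y < length (input E) then input E ! s y else 0)"
| "exec_instr E (ReadAsserted x y) s =
     s(x := if s y < length (asserted E) then asserted E ! s y else 0)"
| "exec_instr E (LeqElem x y z) s = s(x := of_bool ((s y, s z) \<in> ord E))"
| "exec_instr E (Hash x y) s =
     s(x := if s y \<in> elems (wsize E) (esize E) then hash E (s y) else 0)"

definition words :: "nat \<Rightarrow> nat \<Rightarrow> nat" where
  "words w v = 1 + floor_log v div w"

fun cost_instr :: "pe_env \<Rightarrow> instr \<Rightarrow> store \<Rightarrow> nat" where
  "cost_instr E (Const x c) s = words (wsize E) c"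
| "cost_instr E (Copy x y) s = words (wsize E) (s y)"
| "cost_instr E (Add x y z) s = words (wsize E) (s y) + words (wsize E) (s z)"
| "cost_instr E (Sub x y z) s = words (wsize E) (s y) + words (wsize E) (s z)"
| "cost_instr E (Mul x y z) s = words (wsize E) (s y) * words (wsize E) (s z)"
| "cost_instr E (Div x y z) s = words (wsize E) (s y) * words (wsize E) (s z)"
| "cost_instr E (Less x y z) s = words (wsize E) (s y) + words (wsize E) (s z)"
| "cost_instr E (Extract x y off len) s =
     words (wsize E) (s off) + words (wsize E) (s len) + 1 + s len div wsize E"
| "cost_instr E (Deposit x y off len) s =
     words (wsize E) (s off) + words (wsize E) (s len) + 1 + s len div wsize E"
| "cost_instr E (ReadInput x y) s = words (wsize E) (s y) + esize E"
| "cost_instr E (ReadAsserted x y) s = words (wsize E) (s y) + esize E"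
| "cost_instr E (LeqElem x y z) s =
     words (wsize E) (s y) + words (wsize E) (s z) + 2 * esize E"
| "cost_instr E (Hash x y) s = words (wsize E) (s y) + esize E + 1 + hbits E div wsize E"

datatype lcmd =
    Instr instr
  | LSeq lcmd lcmd
  | LIf vname lcmd lcmd
  | LWhile vname lcmd

text \<open>\<^term>\<open>lexec E c s t s'\<close>: from store \<open>s\<close>, command \<open>c\<close> terminates in store \<open>s'\<close> after time \<open>t\<close>.\<close>

inductive lexec :: "pe_env \<Rightarrow> lcmd \<Rightarrow> store \<Rightarrow> nat \<Rightarrow> store \<Rightarrow> bool" for E where
  LInstr: "lexec E (Instr i) s (cost_instr E i s) (exec_instr E i s)"
| LSeq: "lexec E c1 s t1 s1 \<Longrightarrow> lexec E c2 s1 t2 s2 \<Longrightarrow> lexec E (LSeq c1 c2) s (t1 + t2) s2"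
| LIfTrue: "s x \<noteq> 0 \<Longrightarrow> lexec E c1 s t s1 \<Longrightarrow>
    lexec E (LIf x c1 c2) s (words (wsize E) (s x) + t) s1"
| LIfFalse: "s x = 0 \<Longrightarrow> lexec E c2 s t s1 \<Longrightarrow>
    lexec E (LIf x c1 c2) s (words (wsize E) (s x) + t) s1"
| LWhileFalse: "s x = 0 \<Longrightarrow> lexec E (LWhile x c) s (words (wsize E) (s x)) s"
| LWhileTrue: "s x \<noteq> 0 \<Longrightarrow> lexec E c s t1 s1 \<Longrightarrow> lexec E (LWhile x c) s1 t2 s2 \<Longrightarrow>
    lexec E (LWhile x c) s (words (wsize E) (s x) + t1 + t2) s2"

section \<open>Distributed computation\<close>

text \<open>
  All PEs run the same program, synchronized after every phase; a phase lasts as long as its slowest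
  PE.  This is a restriction of asynchronous message passing, so that upper bounds carry over.

  In \<open>Exchange dst len msg src rcv\<close> every PE sends at most one message (its value of \<open>msg\<close>, in
  \<open>len\<close> bits, to PE number \<open>dst\<close>) and simultaneously receives at most one message (from PE number
  \<open>src\<close>, into \<open>rcv\<close>): the network is single-ported and full-duplex.  The value 0 of \<open>dst\<close> or \<open>src\<close>
  means that nothing is sent or received; senders and receivers have to match, so the absence of a
  message carries no information.  A loop needs the PEs to agree on its condition without
  communicating.
\<close>

datatype prog =
    Local lcmd
  | Exchange vname vname vname vname vname
  | Seq prog prog
  | While vname prog

definition matched ::
    "nat \<Rightarrow> vname \<Rightarrow> vname \<Rightarrow> vname \<Rightarrow> vname \<Rightarrow> (nat \<Rightarrow> store) \<Rightarrow> bool" where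
  "matched p dst len msg src S \<longleftrightarrow>
     (\<forall>i\<in>{1..p}. S i dst \<noteq> 0 \<longrightarrow>
        S i dst \<in> {1..p} \<and> S (S i dst) src = i \<and> S i msg < 2 ^ S i len) \<and>
     (\<forall>i\<in>{1..p}. S i src \<noteq> 0 \<longrightarrow> S i src \<in> {1..p} \<and> S (S i src) dst = i)"

definition deliver ::
    "nat \<Rightarrow> vname \<Rightarrow> vname \<Rightarrow> vname \<Rightarrow> (nat \<Rightarrow> store) \<Rightarrow> (nat \<Rightarrow> store)" where
  "deliver p msg src rcv S =
     (\<lambda>i. if i \<in> {1..p} \<and> S i src \<noteq> 0 then (S i)(rcv := S (S i src) msg) else S i)"

definition message_bits :: "nat \<Rightarrow> vname \<Rightarrow> vname \<Rightarrow> (nat \<Rightarrow> store) \<Rightarrow> nat" where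
  "message_bits p dst len S = Max ((\<lambda>i. if S i dst = 0 then 0 else S i len) ` {1..p})"

text \<open>The unit of time is one machine instruction.\<close>

inductive exec ::
    "nat \<Rightarrow> real \<Rightarrow> real \<Rightarrow> (nat \<Rightarrow> pe_env) \<Rightarrow> prog \<Rightarrow> (nat \<Rightarrow> store) \<Rightarrow> real \<Rightarrow> (nat \<Rightarrow> store) \<Rightarrow> bool"
  for p \<alpha> \<beta> E where
  Local: "(\<And>i. i \<in> {1..p} \<Longrightarrow> lexec (E i) c (S i) (t i) (S' i)) \<Longrightarrow>
    (\<And>i. i \<notin> {1..p} \<Longrightarrow> S' i = S i) \<Longrightarrow>
    exec p \<alpha> \<beta> E (Local c) S (real (Max (t ` {1..p}))) S'"
| Exchange: "matched p dst len msg src S \<Longrightarrow>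
    exec p \<alpha> \<beta> E (Exchange dst len msg src rcv) S
      (\<alpha> + \<beta> * real (message_bits p dst len S)) (deliver p msg src rcv S)"
| Seq: "exec p \<alpha> \<beta> E c1 S T1 S1 \<Longrightarrow> exec p \<alpha> \<beta> E c2 S1 T2 S2 \<Longrightarrow>
    exec p \<alpha> \<beta> E (Seq c1 c2) S (T1 + T2) S2"
| WhileFalse: "(\<And>i. i \<in> {1..p} \<Longrightarrow> S i x = 0) \<Longrightarrow> exec p \<alpha> \<beta> E (While x c) S 1 S"
| WhileTrue: "(\<And>i. i \<in> {1..p} \<Longrightarrow> S i x \<noteq> 0) \<Longrightarrow> exec p \<alpha> \<beta> E c S T1 S1 \<Longrightarrow>
    exec p \<alpha> \<beta> E (While x c) S1 T2 S2 \<Longrightarrow>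
    exec p \<alpha> \<beta> E (While x c) S (1 + T1 + T2) S2"

section \<open>Sort checkers\<close>

definition whole :: "nat \<Rightarrow> (nat \<Rightarrow> nat list) \<Rightarrow> nat list" where
  "whole p A = concat (map A [1..<Suc p])"

definition is_sorted_version :: "(nat \<times> nat) set \<Rightarrow> nat list \<Rightarrow> nat list \<Rightarrow> bool" where
  "is_sorted_version r xs ys \<longleftrightarrow> mset ys = mset xs \<and> sorted_wrt (\<lambda>x y. (x, y) \<in> r) ys"

definition sort_instance ::
    "nat \<Rightarrow> nat \<Rightarrow> nat \<Rightarrow> nat \<Rightarrow> (nat \<times> nat) set \<Rightarrow> (nat \<Rightarrow> nat list) \<Rightarrow> (nat \<Rightarrow> nat list) \<Rightarrow> bool" where
  "sort_instance p n w k r A B \<longleftrightarrow>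
     p \<ge> 1 \<and> w \<ge> 1 \<and> k \<ge> 1 \<and> linear_order_on (elems w k) r \<and>
     length (whole p A) = n \<and> length (whole p B) = n \<and>
     set (whole p A) \<subseteq> elems w k \<and> set (whole p B) \<subseteq> elems w k"

definition balanced :: "real \<Rightarrow> nat \<Rightarrow> nat \<Rightarrow> (nat \<Rightarrow> nat list) \<Rightarrow> bool" where
  "balanced c p n A \<longleftrightarrow> (\<forall>i\<in>{1..p}. real (length (A i)) \<le> c * (real n / real p))"

text \<open>The failure probability is made known to the PEs as the number of bits of the hash values.\<close>

definition accuracy :: "real \<Rightarrow> nat" where
  "accuracy \<delta> = nat \<lceil>log 2 (1 / \<delta>)\<rceil>"

definition hash_funs :: "nat \<Rightarrow> nat \<Rightarrow> nat \<Rightarrow> (nat \<Rightarrow> nat) set" where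
  "hash_funs w k b = elems w k \<rightarrow>\<^sub>E {..<2 ^ b}"

definition sort_env ::
    "nat \<Rightarrow> nat \<Rightarrow> nat \<Rightarrow> (nat \<times> nat) set \<Rightarrow> (nat \<Rightarrow> nat) \<Rightarrow> (nat \<Rightarrow> nat list) \<Rightarrow> (nat \<Rightarrow> nat list)
      \<Rightarrow> nat \<Rightarrow> pe_env" where
  "sort_env w k b r h A B i =
     \<lparr>wsize = w, esize = k, hbits = b, ord = r, hash = h, input = A i, asserted = B i\<rparr>"

definition init_store ::
    "nat \<Rightarrow> nat \<Rightarrow> nat \<Rightarrow> nat \<Rightarrow> nat \<Rightarrow> (nat \<Rightarrow> nat list) \<Rightarrow> (nat \<Rightarrow> nat list) \<Rightarrow> nat \<Rightarrow> store" where
  "init_store p n w k b A B i = (\<lambda>_. 0)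
     (''rank'' := i, ''p'' := p, ''n'' := n, ''w'' := w, ''k'' := k, ''accuracy'' := b,
      ''input_length'' := length (A i), ''asserted_length'' := length (B i))"

definition run ::
    "prog \<Rightarrow> nat \<Rightarrow> nat \<Rightarrow> nat \<Rightarrow> nat \<Rightarrow> (nat \<times> nat) set \<Rightarrow> (nat \<Rightarrow> nat list) \<Rightarrow> (nat \<Rightarrow> nat list) \<Rightarrow> real
      \<Rightarrow> real \<Rightarrow> real \<Rightarrow> (nat \<Rightarrow> nat) \<Rightarrow> real \<Rightarrow> (nat \<Rightarrow> store) \<Rightarrow> bool" where
  "run c p n w k r A B \<delta> \<alpha> \<beta> h T S \<longleftrightarrow>
     exec p \<alpha> \<beta> (sort_env w k (accuracy \<delta>) r h A B) c (init_store p n w k (accuracy \<delta>) A B) T S"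

text \<open>At the end every PE has to know the verdict.\<close>

definition accepting :: "nat \<Rightarrow> (nat \<Rightarrow> store) \<Rightarrow> bool" where
  "accepting p S \<longleftrightarrow> (\<forall>i\<in>{1..p}. S i ''verdict'' = 1)"

definition rejecting :: "nat \<Rightarrow> (nat \<Rightarrow> store) \<Rightarrow> bool" where
  "rejecting p S \<longleftrightarrow> (\<forall>i\<in>{1..p}. S i ''verdict'' = 0)"

definition sort_checker_on ::
    "prog \<Rightarrow> nat \<Rightarrow> nat \<Rightarrow> nat \<Rightarrow> nat \<Rightarrow> (nat \<times> nat) set \<Rightarrow> (nat \<Rightarrow> nat list) \<Rightarrow> (nat \<Rightarrow> nat list) \<Rightarrow> real
      \<Rightarrow> real \<Rightarrow> real \<Rightarrow> bool" where
  "sort_checker_on c p n w k r A B \<delta> \<alpha> \<beta> \<longleftrightarrow>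
     (\<forall>h\<in>hash_funs w k (accuracy \<delta>). \<exists>T S. run c p n w k r A B \<delta> \<alpha> \<beta> h T S \<and>
        (accepting p S \<or> rejecting p S)) \<and>
     (is_sorted_version r (whole p A) (whole p B) \<longrightarrow>
        (\<forall>h\<in>hash_funs w k (accuracy \<delta>). \<exists>T S. run c p n w k r A B \<delta> \<alpha> \<beta> h T S \<and> accepting p S)) \<and>
     (\<not> is_sorted_version r (whole p A) (whole p B) \<longrightarrow>
        measure_pmf.prob (pmf_of_set (hash_funs w k (accuracy \<delta>)))
          {h. \<exists>T S. run c p n w k r A B \<delta> \<alpha> \<beta> h T S \<and> rejecting p S} \<ge> 1 - \<delta>)"

text \<open>
  Runs are unique, so quantifying existentially over them above does not select among several
  outcomes.
\<close>

lemma lexec_deterministic: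
  "lexec E c s t s' \<Longrightarrow> lexec E c s u s'' \<Longrightarrow> t = u \<and> s' = s''"
proof (induction arbitrary: u s'' rule: lexec.induct)
  case (LInstr i s)
  then show ?case by cases simp
next
  case (LSeq c1 s t1 s1 c2 t2 s2)
  from LSeq.prems show ?case by cases (metis LSeq.IH)
next
  case (LIfTrue s x c1 t s1 c2)
  from LIfTrue.prems show ?case by cases (metis LIfTrue.hyps(1) LIfTrue.IH)+
next
  case (LIfFalse s x c2 t s1 c1)
  from LIfFalse.prems show ?case by cases (metis LIfFalse.hyps(1) LIfFalse.IH)+
next
  case (LWhileFalse s x c)
  from LWhileFalse.prems show ?case by cases (simp_all add: LWhileFalse.hyps)
next
  case (LWhileTrue s x c t1 s1 t2 s2)
  from LWhileTrue.prems show ?case by cases (metis LWhileTrue.hyps(1) LWhileTrue.IH)+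
qed

lemma exec_deterministic:
  assumes "p \<ge> 1"
  shows "exec p \<alpha> \<beta> E c S T S' \<Longrightarrow> exec p \<alpha> \<beta> E c S U S'' \<Longrightarrow> T = U \<and> S' = S''"
proof (induction arbitrary: U S'' rule: exec.induct)
  case hyp: (Local c S t S')
  from hyp.prems show ?case
  proof cases
    case (Local u)
    have eq: "t i = u i \<and> S' i = S'' i" if "i \<in> {1..p}" for i
      using lexec_deterministic[OF hyp.hyps(1)[OF that] Local(2)[OF that]] .
    then have "t ` {1..p} = u ` {1..p}" by (intro image_cong) auto
    moreover have "S' i = S'' i" for i
      using eq hyp.hyps(2) Local(3) by (cases "i \<in> {1..p}") simp_all
    ultimately show ?thesis using Local(1) by (simp add: fun_eq_iff)
  qed
next
  case (Exchange dst len msg src S rcv)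
  from Exchange.prems show ?case by cases simp
next
  case (Seq c1 S T1 S1 c2 T2 S2)
  from Seq.prems show ?case by cases (metis Seq.IH)
next
  case (WhileFalse S x c)
  have "S 1 x = 0" using assms WhileFalse.hyps by simp
  from WhileFalse.prems show ?case
  proof cases
    case WhileTrue
    then show ?thesis using \<open>S 1 x = 0\<close> assms by (metis atLeastAtMost_iff order_refl)
  qed simp
next
  case hyp: (WhileTrue S x c T1 S1 T2 S2)
  have "S 1 x \<noteq> 0" using assms hyp.hyps(1) by simp
  from hyp.prems show ?case
  proof cases
    case WhileFalse
    then show ?thesis using \<open>S 1 x \<noteq> 0\<close> assms by (metis atLeastAtMost_iff order_refl)
  next
    case (WhileTrue U1 S1' U2)
    then show ?thesis by (metis hyp.IH)
  qed
qed

end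

theory Submission
  imports Defs
begin

text \<open>
  The multisets are compared through the integers \<open>\<Sum> h x\<close>: if the multiplicities of some \<open>x\<close> differ,
  then for fixed values of \<open>h\<close> elsewhere at most one of the \<open>2 ^ b\<close> values of \<open>h x\<close> makes the two sums
  equal.  (Sums modulo \<open>2 ^ b\<close> would not do, because the difference of the multiplicities may be even.)

  The PEs form a binary tree in which in-order is rank order.  A message of \<open>B\<close> bits per tree level
  would cost \<open>\<beta> B log p\<close>, so numbers travel up the tree least significant bits first, in
  chunks of about \<open>B / log p\<close> bits, and every PE adds its own chunk, the chunks of its children and a
  carry before passing the result on.  After \<open>O(log p)\<close> rounds all subtree sums are known.
  With summands masked by 0/1 factors the same procedure finds the first and the last element stored in a
  subtree, since parts may be empty; then every PE can compare the neighbouring elements that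
  meet at its position.  A last sum collects the hash differences and the number of violations, and
  the root broadcasts the verdict.
\<close>

section \<open>Reasoning about local commands\<close>

text \<open>Even the comparisons across PE boundaries move elements of \<open>k * w\<close> bits,
  for which an unpipelined tree would pay \<beta> w log p. With D = floor_log p bounding the depth,
  a number of \<open>B\<close> bits fits in D + 1 chunks of \<open>c\<close> bits, and 2 * D + 1
  chunks leave room for a delay of up to D chunks; so a stream moves only O(B) bits per link.
  \<open>B\<close> has room for a hash sum (b + floor_log n + 1 bits), for the number of violations
  on top of it, and for one element. If log n = O(w), then B = O(max (log (1 / \<delta>)) w); this
  is the origin of the two time bounds, which agree up to constants once w = O(log (1 / \<delta>)).
  The local cost relies on \<open>Extract\<close> and \<open>Deposit\<close> being charged for the
  field they move and not for the register they address: a chunk is appended to a long register at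
  the price of a chunk. Balanced parts of a nonempty sequence give p \<le> a * n, hence log p =
  O(w), so ranks and counters take O(1) words.\<close>

definition lwp :: "pe_env \<Rightarrow> lcmd \<Rightarrow> (nat \<Rightarrow> store \<Rightarrow> bool) \<Rightarrow> store \<Rightarrow> bool" where
  "lwp E c Q s \<longleftrightarrow> (\<exists>t s'. lexec E c s t s' \<and> Q t s')"

lemma lwp_mono: "lwp E c Q s \<Longrightarrow> (\<And>t s'. Q t s' \<Longrightarrow> Q' t s') \<Longrightarrow> lwp E c Q' s"
  unfolding lwp_def by blast

lemma lwp_Instr: "Q (cost_instr E i s) (exec_instr E i s) \<Longrightarrow> lwp E (Instr i) Q s"
  unfolding lwp_def using lexec.LInstr by blast

text \<open>The time of \<open>c1\<close> is handed on to the postcondition of \<open>c2\<close>, so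
  applying this rule along a \<open>block\<close> ends in one goal with the final store and the
  total cost written out.\<close>

lemma lwp_LSeq:
  "lwp E c1 (\<lambda>t1 s1. lwp E c2 (\<lambda>t2 s2. Q (t1 + t2) s2) s1) s \<Longrightarrow> lwp E (LSeq c1 c2) Q s"
  unfolding lwp_def using lexec.LSeq by blast

lemma lwp_LIf:
  assumes "s x \<noteq> 0 \<Longrightarrow> lwp E c1 (\<lambda>t s'. Q (words (wsize E) (s x) + t) s') s"
    and "s x = 0 \<Longrightarrow> lwp E c2 (\<lambda>t s'. Q (words (wsize E) (s x) + t) s') s"
  shows "lwp E (LIf x c1 c2) Q s"
  using assms lexec.LIfTrue lexec.LIfFalse unfolding lwp_def by (cases "s x = 0") blast+

text \<open>\<open>V\<close> bounds the number of remaining iterations: each pays for a body and a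
  test, and the last failing test is paid once more.\<close>

lemma lwp_LWhile:
  assumes step: "\<And>s. I s \<Longrightarrow> s x \<noteq> 0 \<Longrightarrow> lwp E c (\<lambda>t s'. t \<le> C \<and> I s' \<and> V s' < V s) s"
    and guard: "\<And>s. I s \<Longrightarrow> words (wsize E) (s x) \<le> u"
    and "I s"
  shows "lwp E (LWhile x c) (\<lambda>t s'. t \<le> V s * (C + u) + u \<and> I s' \<and> s' x = 0) s"
  using \<open>I s\<close>
proof (induction "V s" arbitrary: s rule: less_induct)
  case less
  show ?case
  proof (cases "s x = 0")
    case True
    then show ?thesis
      unfolding lwp_def using lexec.LWhileFalse[of s x E c] guard[OF less.prems] less.prems
      by (metis trans_le_add2)
  next
    case False
    from step[OF less.prems False] obtain t1 s1
      where 1: "lexec E c s t1 s1" "t1 \<le> C" "I s1" "V s1 < V s"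
      unfolding lwp_def by blast
    from less.hyps[OF 1(4,3)] obtain t2 s2
      where 2: "lexec E (LWhile x c) s1 t2 s2" "t2 \<le> V s1 * (C + u) + u" "I s2" "s2 x = 0"
      unfolding lwp_def by blast
    have "Suc (V s1) * (C + u) \<le> V s * (C + u)"
      using 1(4) by (intro mult_right_mono) auto
    then have "words (wsize E) (s x) + t1 + t2 \<le> V s * (C + u) + u"
      using 1(2) 2(2) guard[OF less.prems] by simp
    then show ?thesis
      unfolding lwp_def using lexec.LWhileTrue[OF False 1(1) 2(1)] 2(3,4) by blast
  qed
qed

fun instr_target :: "instr \<Rightarrow> vname" where
  "instr_target (Const x c) = x"
| "instr_target (Copy x y) = x"
| "instr_target (Add x y z) = x"
| "instr_target (Sub x y z) = x"
| "instr_target (Mul x y z) = x"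
| "instr_target (Div x y z) = x"
| "instr_target (Less x y z) = x"
| "instr_target (Extract x y off len) = x"
| "instr_target (Deposit x y off len) = x"
| "instr_target (ReadInput x y) = x"
| "instr_target (ReadAsserted x y) = x"
| "instr_target (LeqElem x y z) = x"
| "instr_target (Hash x y) = x"

fun lwrites :: "lcmd \<Rightarrow> vname set" where
  "lwrites (Instr i) = {instr_target i}"
| "lwrites (LSeq c1 c2) = lwrites c1 \<union> lwrites c2"
| "lwrites (LIf x c1 c2) = lwrites c1 \<union> lwrites c2"
| "lwrites (LWhile x c) = lwrites c"

lemma lexec_unchanged: "lexec E c s t s' \<Longrightarrow> v \<notin> lwrites c \<Longrightarrow> s' v = s v"
proof (induction rule: lexec.induct)
  case (LInstr i s)
  then show ?case by (cases i) auto
qed auto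

text \<open>Lets specifications list only the variables that change; the rest is recovered from the
  syntactic write set.\<close>

lemma lwp_frame:
  "lwp E c Q s \<Longrightarrow> lwp E c (\<lambda>t s'. Q t s' \<and> (\<forall>v. v \<notin> lwrites c \<longrightarrow> s' v = s v)) s"
  unfolding lwp_def using lexec_unchanged by blast

text \<open>The language has no empty command, so the empty block overwrites \<open>t\<close>, the
  scratch variable used throughout.\<close>

fun block :: "instr list \<Rightarrow> lcmd" where
  "block [] = Instr (Const ''t'' 0)"
| "block [i] = Instr i"
| "block (i # j # is) = LSeq (Instr i) (block (j # is))"

lemma words_mono: "v \<le> v' \<Longrightarrow> words w v \<le> words w v'"
  unfolding words_def by (simp add: div_le_mono floor_log_le_iff)

lemma words_le: "v < 2 ^ m \<Longrightarrow> words w v \<le> 1 + m div w"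
proof -
  assume v: "v < 2 ^ m"
  then have "floor_log v \<le> floor_log (2 ^ m)" by (intro floor_log_le_iff) simp
  then show ?thesis unfolding words_def by (simp add: div_le_mono)
qed

lemma words_le_mono:
  assumes "v < 2 ^ j" "j \<le> m"
  shows "words w v \<le> 1 + m div w"
  using assms by (intro words_le) (meson order_less_le_trans power_increasing one_le_numeral)

lemma words_small [simp]: "words w 0 = 1" "words w 1 = 1" "words w (Suc 0) = 1"
  "words w (of_bool P) = 1"
  by (simp_all add: words_def of_bool_def)

lemma words_2: "w \<ge> 1 \<Longrightarrow> words w 2 \<le> 2"
  by (simp add: words_def floor_log_rec)

section \<open>Reasoning about distributed programs\<close>

text \<open>Assertions speak of one PE at a time. Relations between PEs enter through functions of
  the rank that are fixed outside the triple, such as the messages \<open>m\<close> in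
  \<open>xtriple_Exchange\<close>.\<close>

definition xtriple :: "nat \<Rightarrow> real \<Rightarrow> real \<Rightarrow> (nat \<Rightarrow> pe_env) \<Rightarrow> (nat \<Rightarrow> store \<Rightarrow> bool) \<Rightarrow> prog \<Rightarrow> real \<Rightarrow>
    (nat \<Rightarrow> store \<Rightarrow> bool) \<Rightarrow> bool" where
  "xtriple p \<alpha> \<beta> E P c T Q \<longleftrightarrow>
     (\<forall>S. (\<forall>i\<in>{1..p}. P i (S i)) \<longrightarrow>
        (\<exists>T' S'. exec p \<alpha> \<beta> E c S T' S' \<and> T' \<le> T \<and> (\<forall>i\<in>{1..p}. Q i (S' i))))"

lemma xtriple_mono:
  assumes "xtriple p \<alpha> \<beta> E P c T Q"
    and "\<And>i s. i \<in> {1..p} \<Longrightarrow> P' i s \<Longrightarrow> P i s" and "T \<le> T'"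
    and "\<And>i s. i \<in> {1..p} \<Longrightarrow> Q i s \<Longrightarrow> Q' i s"
  shows "xtriple p \<alpha> \<beta> E P' c T' Q'"
  unfolding xtriple_def
proof (intro allI impI)
  fix S assume "\<forall>i\<in>{1..p}. P' i (S i)"
  then have "\<forall>i\<in>{1..p}. P i (S i)" using assms(2) by blast
  then obtain U S' where "exec p \<alpha> \<beta> E c S U S'" "U \<le> T" "\<forall>i\<in>{1..p}. Q i (S' i)"
    using assms(1) unfolding xtriple_def by blast
  then show "\<exists>U S'. exec p \<alpha> \<beta> E c S U S' \<and> U \<le> T' \<and> (\<forall>i\<in>{1..p}. Q' i (S' i))"
    using assms(3,4) by (intro exI[of _ U] exI[of _ S']) force
qed

lemma xtriple_Local:
  assumes "p \<ge> 1"
    and "\<And>i s. i \<in> {1..p} \<Longrightarrow> P i s \<Longrightarrow> lwp (E i) c (\<lambda>t s'. t \<le> T \<and> Q i s') s"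
  shows "xtriple p \<alpha> \<beta> E P (Local c) (real T) Q"
  unfolding xtriple_def
proof (intro allI impI)
  fix S assume S: "\<forall>i\<in>{1..p}. P i (S i)"
  \<comment> \<open>Stores outside 1..p have to stay as they are, so this case is put under the
    quantifier before the stores are chosen.\<close>
  have "\<forall>i. \<exists>t s'. if i \<in> {1..p} then lexec (E i) c (S i) t s' \<and> t \<le> T \<and> Q i s' else s' = S i"
  proof
    fix i show "\<exists>t s'. if i \<in> {1..p} then lexec (E i) c (S i) t s' \<and> t \<le> T \<and> Q i s' else s' = S i"
    proof (cases "i \<in> {1..p}")
      case True
      then show ?thesis using assms(2)[OF True] S unfolding lwp_def by simp
    qed auto
  qed
  then obtain t where "\<forall>i. \<exists>s'. if i \<in> {1..p} then lexec (E i) c (S i) (t i) s' \<and> t i \<le> T \<and> Q i s' else s' = S i"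
    by metis
  then obtain S' where *: "\<forall>i. if i \<in> {1..p} then lexec (E i) c (S i) (t i) (S' i) \<and> t i \<le> T \<and> Q i (S' i) else S' i = S i"
    by metis
  then have **: "\<And>i. i \<in> {1..p} \<Longrightarrow> lexec (E i) c (S i) (t i) (S' i) \<and> t i \<le> T \<and> Q i (S' i)"
    "\<And>i. i \<notin> {1..p} \<Longrightarrow> S' i = S i" by presburger+
  have "exec p \<alpha> \<beta> E (Local c) S (real (Max (t ` {1..p}))) S'"
    using ** by (intro exec.Local) auto
  moreover have "Max (t ` {1..p}) \<le> T" using assms(1) ** by (subst Max_le_iff) auto
  ultimately show "\<exists>T' S'. exec p \<alpha> \<beta> E (Local c) S T' S' \<and> T' \<le> real T \<and> (\<forall>i\<in>{1..p}. Q i (S' i))"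
    using ** by (intro exI[of _ "real (Max (t ` {1..p}))"] exI[of _ S']) auto
qed

lemma xtriple_Seq:
  assumes "xtriple p \<alpha> \<beta> E P c1 T1 Q" "xtriple p \<alpha> \<beta> E Q c2 T2 R"
  shows "xtriple p \<alpha> \<beta> E P (Seq c1 c2) (T1 + T2) R"
  unfolding xtriple_def
proof (intro allI impI)
  fix S assume "\<forall>i\<in>{1..p}. P i (S i)"
  with assms(1) obtain U1 S1 where 1: "exec p \<alpha> \<beta> E c1 S U1 S1" "U1 \<le> T1" "\<forall>i\<in>{1..p}. Q i (S1 i)"
    unfolding xtriple_def by blast
  with assms(2) obtain U2 S2 where 2: "exec p \<alpha> \<beta> E c2 S1 U2 S2" "U2 \<le> T2" "\<forall>i\<in>{1..p}. R i (S2 i)"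
    unfolding xtriple_def by blast
  show "\<exists>T' S'. exec p \<alpha> \<beta> E (Seq c1 c2) S T' S' \<and> T' \<le> T1 + T2 \<and> (\<forall>i\<in>{1..p}. R i (S' i))"
    using exec.Seq[OF 1(1) 2(1)] 1(2) 2(2,3) by (intro exI[of _ "U1 + U2"] exI[of _ S2]) auto
qed

text \<open>Indexing the invariant by the round makes the guard a function of the round alone, so
  all PEs agree on it without communicating.\<close>

lemma xtriple_While:
  assumes step: "\<And>r. r < N \<Longrightarrow> xtriple p \<alpha> \<beta> E (I r) c T (I (Suc r))"
    and guard: "\<And>r i s. r \<le> N \<Longrightarrow> i \<in> {1..p} \<Longrightarrow> I r i s \<Longrightarrow> s x = 0 \<longleftrightarrow> r = N"
  shows "xtriple p \<alpha> \<beta> E (I 0) (While x c) (real N * (T + 1) + 1) (I N)"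
proof -
  have "xtriple p \<alpha> \<beta> E (I r) (While x c) (real (N - r) * (T + 1) + 1) (I N)" if "r \<le> N" for r
    using that
  proof (induction r rule: inc_induct)
    case base
    have "exec p \<alpha> \<beta> E (While x c) S 1 S" if "\<forall>i\<in>{1..p}. I N i (S i)" for S
      using that guard[of N] by (intro exec.WhileFalse) auto
    then show ?case unfolding xtriple_def by (auto intro!: exI[of _ "1::real"])
  next
    case (step r)
    show ?case unfolding xtriple_def
    proof (intro allI impI)
      fix S assume S: "\<forall>i\<in>{1..p}. I r i (S i)"
      with assms(1)[OF step.hyps(2)] obtain U1 S1
        where 1: "exec p \<alpha> \<beta> E c S U1 S1" "U1 \<le> T" "\<forall>i\<in>{1..p}. I (Suc r) i (S1 i)"
        unfolding xtriple_def by blast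
      with step.IH obtain U2 S2 where 2: "exec p \<alpha> \<beta> E (While x c) S1 U2 S2"
          "U2 \<le> real (N - Suc r) * (T + 1) + 1" "\<forall>i\<in>{1..p}. I N i (S2 i)"
        unfolding xtriple_def by blast
      have nz: "\<And>i. i \<in> {1..p} \<Longrightarrow> S i x \<noteq> 0" using guard[of r] S step.hyps by auto
      have "N - r = Suc (N - Suc r)" using step.hyps by simp
      then have "1 + U1 + U2 \<le> real (N - r) * (T + 1) + 1"
        using 1(2) 2(2) by (simp add: algebra_simps)
      then show "\<exists>T' S'. exec p \<alpha> \<beta> E (While x c) S T' S' \<and> T' \<le> real (N - r) * (T + 1) + 1 \<and> (\<forall>i\<in>{1..p}. I N i (S' i))"
        using exec.WhileTrue[OF nz 1(1) 2(1)] 2(3) by blast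
    qed
  qed
  from this[of 0] show ?thesis by simp
qed

text \<open>Partners and messages depend on the rank only, which reduces \<open>matched\<close> to
  \<open>d\<close> and \<open>e\<close> being inverse to each other where they are nonzero.\<close>

lemma xtriple_Exchange:
  assumes "p \<ge> 1" "\<beta> \<ge> 0"
    and pre: "\<And>i s. i \<in> {1..p} \<Longrightarrow> P i s \<Longrightarrow>
        s dst = d i \<and> s src = e i \<and> s msg = m i \<and> s len = l \<and> (d i \<noteq> 0 \<longrightarrow> m i < 2 ^ l)"
    and out: "\<And>i. i \<in> {1..p} \<Longrightarrow> d i \<noteq> 0 \<Longrightarrow> d i \<in> {1..p} \<and> e (d i) = i"
    and inc: "\<And>i. i \<in> {1..p} \<Longrightarrow> e i \<noteq> 0 \<Longrightarrow> e i \<in> {1..p} \<and> d (e i) = i"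
  shows "xtriple p \<alpha> \<beta> E P (Exchange dst len msg src rcv) (\<alpha> + \<beta> * real l)
    (\<lambda>i s'. \<exists>s. P i s \<and> s' = (if e i \<noteq> 0 then s(rcv := m (e i)) else s))"
  unfolding xtriple_def
proof (intro allI impI)
  fix S assume S: "\<forall>i\<in>{1..p}. P i (S i)"
  have v: "S i dst = d i \<and> S i src = e i \<and> S i msg = m i \<and> S i len = l \<and> (d i \<noteq> 0 \<longrightarrow> m i < 2 ^ l)"
    if "i \<in> {1..p}" for i using pre[OF that] S that by blast
  have "matched p dst len msg src S" unfolding matched_def using v out inc by auto
  then have ex: "exec p \<alpha> \<beta> E (Exchange dst len msg src rcv) S
      (\<alpha> + \<beta> * real (message_bits p dst len S)) (deliver p msg src rcv S)" by (rule exec.Exchange)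
  have "message_bits p dst len S \<le> l"
    unfolding message_bits_def
  proof (rule Max.boundedI)
    show "(\<lambda>i. if S i dst = 0 then 0 else S i len) ` {1..p} \<noteq> {}"
      using \<open>p \<ge> 1\<close> by (subst image_is_empty) simp
  qed (use v in auto)
  then have "\<alpha> + \<beta> * real (message_bits p dst len S) \<le> \<alpha> + \<beta> * real l"
    using \<open>\<beta> \<ge> 0\<close> by (simp add: mult_left_mono)
  moreover have "\<exists>s. P i s \<and> deliver p msg src rcv S i = (if e i \<noteq> 0 then s(rcv := m (e i)) else s)"
    if i: "i \<in> {1..p}" for i
    using i v[OF i] inc[OF i] v[of "e i"] S by (intro exI[of _ "S i"]) (auto simp: deliver_def)
  ultimately show "\<exists>T' S'. exec p \<alpha> \<beta> E (Exchange dst len msg src rcv) S T' S' \<and> T' \<le> \<alpha> + \<beta> * real l \<and>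
      (\<forall>i\<in>{1..p}. \<exists>s. P i s \<and> S' i = (if e i \<noteq> 0 then s(rcv := m (e i)) else s))"
    using ex by blast
qed

fun writes :: "prog \<Rightarrow> vname set" where
  "writes (Local c) = lwrites c"
| "writes (Exchange dst len msg src rcv) = {rcv}"
| "writes (Seq c1 c2) = writes c1 \<union> writes c2"
| "writes (While x c) = writes c"

lemma exec_unchanged: "exec p \<alpha> \<beta> E c S T S' \<Longrightarrow> v \<notin> writes c \<Longrightarrow> S' i v = S i v"
proof (induction rule: exec.induct)
  case (Local c S t S')
  then show ?case using lexec_unchanged by (cases "i \<in> {1..p}") fastforce+
qed (auto simp: deliver_def)

lemma xtriple_frame:
  assumes "xtriple p \<alpha> \<beta> E P c T Q"
    and "\<And>i s s'. R i s \<Longrightarrow> (\<And>v. v \<notin> writes c \<Longrightarrow> s' v = s v) \<Longrightarrow> R i s'"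
  shows "xtriple p \<alpha> \<beta> E (\<lambda>i s. P i s \<and> R i s) c T (\<lambda>i s. Q i s \<and> R i s)"
  unfolding xtriple_def
proof (intro allI impI)
  fix S assume S: "\<forall>i\<in>{1..p}. P i (S i) \<and> R i (S i)"
  with assms(1) obtain U S' where 1: "exec p \<alpha> \<beta> E c S U S'" "U \<le> T" "\<forall>i\<in>{1..p}. Q i (S' i)"
    unfolding xtriple_def by blast
  have "R i (S' i)" if "i \<in> {1..p}" for i
    using assms(2)[of i "S i" "S' i"] S that exec_unchanged[OF 1(1)] by blast
  with 1 show "\<exists>T' S'. exec p \<alpha> \<beta> E c S T' S' \<and> T' \<le> T \<and> (\<forall>i\<in>{1..p}. Q i (S' i) \<and> R i (S' i))"
    by blast
qed

text \<open>The network parameters influence times but not stores. This transfers correctness from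
  one convenient network to all \<alpha> and \<beta>, including negative ones, for which the time
  bounds make no sense.\<close>

lemma exec_change_network: "exec p \<alpha> \<beta> E c S T S' \<Longrightarrow> \<exists>T'. exec p \<alpha>' \<beta>' E c S T' S'"
proof (induction rule: exec.induct)
  case (Local c S t S')
  then show ?case by (blast intro: exec.Local)
next
  case (Exchange dst len msg src S rcv)
  then show ?case by (blast intro: exec.Exchange)
next
  case (Seq c1 S T1 S1 c2 T2 S2)
  then show ?case by (blast intro: exec.Seq)
next
  case (WhileFalse S x c)
  then show ?case by (blast intro: exec.WhileFalse)
next
  case (WhileTrue S x c T1 S1 T2 S2)
  then show ?case by (blast intro: exec.WhileTrue)
qed

section \<open>The in-order tree on the PEs\<close>

text \<open>
  The node responsible for the ranks in \<open>{lo..<hi}\<close> is the PE in the middle of this interval.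
  \<open>side\<close> is 0 for the root, 1 for a left and 2 for a right child; the root has parent 0.
\<close>

inductive tree_node :: "nat \<Rightarrow> nat \<Rightarrow> nat \<Rightarrow> nat \<Rightarrow> nat \<Rightarrow> nat \<Rightarrow> bool" for p where
  root: "p \<ge> 1 \<Longrightarrow> tree_node p 1 (Suc p) 0 0 0"
| left: "tree_node p lo hi par side dep \<Longrightarrow> lo < (lo + hi) div 2 \<Longrightarrow>
    tree_node p lo ((lo + hi) div 2) ((lo + hi) div 2) 1 (Suc dep)"
| right: "tree_node p lo hi par side dep \<Longrightarrow> Suc ((lo + hi) div 2) < hi \<Longrightarrow>
    tree_node p (Suc ((lo + hi) div 2)) hi ((lo + hi) div 2) 2 (Suc dep)"

text \<open>Follows the path of \<open>tree_node\<close> towards rank \<open>r\<close>, in order to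
  turn that relation into functions of the rank. Stopping outside of \<open>{lo..<hi}\<close> makes
  the recursion terminate on all arguments.\<close>

function search :: "nat \<Rightarrow> nat \<Rightarrow> nat \<Rightarrow> nat \<Rightarrow> nat \<Rightarrow> nat \<Rightarrow> nat \<times> nat \<times> nat \<times> nat \<times> nat" where
  "search r lo hi par side dep =
     (if r = (lo + hi) div 2 \<or> r < lo \<or> hi \<le> r then (lo, hi, par, side, dep)
      else if r < (lo + hi) div 2 then search r lo ((lo + hi) div 2) ((lo + hi) div 2) 1 (Suc dep)
      else search r (Suc ((lo + hi) div 2)) hi ((lo + hi) div 2) 2 (Suc dep))"
  by pat_completeness auto
termination by (relation "Wellfounded.measure (\<lambda>(r, lo, hi, _). hi - lo)") auto

declare search.simps [simp del]

lemma floor_log_half_interval: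
  assumes "0 < m" "2 * m \<le> n"
  shows "floor_log m < floor_log n"
  using assms floor_log_le_iff[of "2 * m" n] by simp

text \<open>A child interval has at most half the size, so \<open>floor_log\<close> of the size
  drops by at least one while the depth grows by one: their sum never increases from its value at
  the root.\<close>

lemma tree_node_bounds:
  "tree_node p lo hi par side dep \<Longrightarrow>
     1 \<le> lo \<and> lo < hi \<and> hi \<le> Suc p \<and> dep + floor_log (hi - lo) \<le> floor_log p"
proof (induction rule: tree_node.induct)
  case (left lo hi par side dep)
  have "floor_log ((lo + hi) div 2 - lo) < floor_log (hi - lo)"
    using left by (intro floor_log_half_interval) auto
  then show ?case using left by auto
next
  case (right lo hi par side dep)
  have "floor_log (hi - Suc ((lo + hi) div 2)) < floor_log (hi - lo)"
    using right by (intro floor_log_half_interval) auto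
  then show ?case using right by auto
qed auto

lemma search_tree_node:
  "tree_node p lo hi par side dep \<Longrightarrow> lo \<le> r \<Longrightarrow> r < hi \<Longrightarrow>
   search r lo hi par side dep = (lo', hi', par', side', dep') \<Longrightarrow>
   tree_node p lo' hi' par' side' dep' \<and> r = (lo' + hi') div 2"
proof (induction r lo hi par side dep rule: search.induct)
  case (1 r lo hi par side dep)
  let ?m = "(lo + hi) div 2"
  consider "r = ?m" | "r < ?m" | "?m < r" by linarith
  then show ?case
  proof cases
    case 1
    then show ?thesis using "1.prems" by (subst (asm) search.simps) auto
  next
    case 2
    then have "search r lo hi par side dep = search r lo ?m ?m 1 (Suc dep)"
      using "1.prems" search.simps[of r lo hi par side dep] by auto
    then show ?thesis using 2 "1.IH"(1) "1.prems" tree_node.left[OF "1.prems"(1)] by auto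
  next
    case 3
    then have "search r lo hi par side dep = search r (Suc ?m) hi ?m 2 (Suc dep)"
      using "1.prems" search.simps[of r lo hi par side dep] by auto
    then show ?thesis using 3 "1.IH"(2) "1.prems" tree_node.right[OF "1.prems"(1)] by auto
  qed
qed

text \<open>Every node lies on the search path of each rank in its interval. Hence a rank determines
  its node, as \<open>tree_node_eq\<close> states.\<close>

lemma tree_node_search:
  "tree_node p lo hi par side dep \<Longrightarrow> lo \<le> r \<Longrightarrow> r < hi \<Longrightarrow>
     search r 1 (Suc p) 0 0 0 = search r lo hi par side dep"
proof (induction rule: tree_node.induct)
  case (left lo hi par side dep)
  then show ?case using search.simps[of r lo hi par side dep] by auto
next
  case (right lo hi par side dep)
  then show ?case using search.simps[of r lo hi par side dep] by auto
qed simp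

definition tree_lo :: "nat \<Rightarrow> nat \<Rightarrow> nat" where
  "tree_lo p r = fst (search r 1 (Suc p) 0 0 0)"
definition tree_hi :: "nat \<Rightarrow> nat \<Rightarrow> nat" where
  "tree_hi p r = fst (snd (search r 1 (Suc p) 0 0 0))"
definition tree_par :: "nat \<Rightarrow> nat \<Rightarrow> nat" where
  "tree_par p r = fst (snd (snd (search r 1 (Suc p) 0 0 0)))"
definition tree_side :: "nat \<Rightarrow> nat \<Rightarrow> nat" where
  "tree_side p r = fst (snd (snd (snd (search r 1 (Suc p) 0 0 0))))"
definition tree_depth :: "nat \<Rightarrow> nat \<Rightarrow> nat" where
  "tree_depth p r = snd (snd (snd (snd (search r 1 (Suc p) 0 0 0))))"

text \<open>As in \<open>Exchange\<close>, 0 stands for no partner. Edges to left and to right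
  children are kept apart because a PE can hear only one child per exchange.\<close>

definition lchild :: "nat \<Rightarrow> nat \<Rightarrow> nat" where
  "lchild p r = (if tree_lo p r < r then (tree_lo p r + r) div 2 else 0)"
definition rchild :: "nat \<Rightarrow> nat \<Rightarrow> nat" where
  "rchild p r = (if Suc r < tree_hi p r then (Suc r + tree_hi p r) div 2 else 0)"
definition lparent :: "nat \<Rightarrow> nat \<Rightarrow> nat" where
  "lparent p r = (if tree_side p r = 1 then tree_par p r else 0)"
definition rparent :: "nat \<Rightarrow> nat \<Rightarrow> nat" where
  "rparent p r = (if tree_side p r = 2 then tree_par p r else 0)"

lemma tree_node_eq:
  assumes "tree_node p lo hi par side dep" "r = (lo + hi) div 2"
  shows "tree_lo p r = lo" "tree_hi p r = hi" "tree_par p r = par" "tree_side p r = side"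
    "tree_depth p r = dep"
proof -
  have "search r 1 (Suc p) 0 0 0 = (lo, hi, par, side, dep)"
    using tree_node_search[OF assms(1), of r] tree_node_bounds[OF assms(1)] assms(2)
      search.simps[of r lo hi par side dep] by auto
  then show "tree_lo p r = lo" "tree_hi p r = hi" "tree_par p r = par" "tree_side p r = side"
    "tree_depth p r = dep"
    by (simp_all add: tree_lo_def tree_hi_def tree_par_def tree_side_def tree_depth_def)
qed

lemma tree_node_of:
  assumes "r \<in> {1..p}"
  shows "tree_node p (tree_lo p r) (tree_hi p r) (tree_par p r) (tree_side p r) (tree_depth p r)"
    and "(tree_lo p r + tree_hi p r) div 2 = r"
proof -
  obtain lo hi par side dep where s: "search r 1 (Suc p) 0 0 0 = (lo, hi, par, side, dep)"
    by (cases "search r 1 (Suc p) 0 0 0") auto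
  have "tree_node p lo hi par side dep \<and> r = (lo + hi) div 2"
    using search_tree_node[OF tree_node.root _ _ s] assms by auto
  with tree_node_eq[of p lo hi par side dep r]
  show "tree_node p (tree_lo p r) (tree_hi p r) (tree_par p r) (tree_side p r) (tree_depth p r)"
    "(tree_lo p r + tree_hi p r) div 2 = r" by auto
qed

lemma tree_bounds:
  assumes "r \<in> {1..p}"
  shows "1 \<le> tree_lo p r" "tree_lo p r \<le> r" "r < tree_hi p r" "tree_hi p r \<le> Suc p"
    "tree_depth p r \<le> floor_log p"
  using tree_node_bounds[OF tree_node_of(1)[OF assms]] tree_node_of(2)[OF assms] by auto

text \<open>Together with \<open>lparent\<close> below: the two link functions are mutually inverse,
  which is what \<open>xtriple_Exchange\<close> asks for. The same holds for the right
  links.\<close>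

lemma lchild:
  assumes "r \<in> {1..p}" "lchild p r \<noteq> 0"
  shows "lchild p r \<in> {1..p}" "tree_lo p (lchild p r) = tree_lo p r" "tree_hi p (lchild p r) = r"
    "lparent p (lchild p r) = r" "tree_depth p (lchild p r) = Suc (tree_depth p r)"
proof -
  have lt: "tree_lo p r < r" and l: "lchild p r = (tree_lo p r + r) div 2"
    using assms(2) by (auto simp: lchild_def split: if_splits)
  have n: "tree_node p (tree_lo p r) r r 1 (Suc (tree_depth p r))"
    using tree_node.left[OF tree_node_of(1)[OF assms(1)]] tree_node_of(2)[OF assms(1)] lt by simp
  show "lchild p r \<in> {1..p}" using l lt tree_bounds[OF assms(1)] by auto
  from tree_node_eq[OF n l] show "tree_lo p (lchild p r) = tree_lo p r" "tree_hi p (lchild p r) = r"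
    "lparent p (lchild p r) = r" "tree_depth p (lchild p r) = Suc (tree_depth p r)"
    by (auto simp: lparent_def)
qed

lemma rchild:
  assumes "r \<in> {1..p}" "rchild p r \<noteq> 0"
  shows "rchild p r \<in> {1..p}" "tree_lo p (rchild p r) = Suc r" "tree_hi p (rchild p r) = tree_hi p r"
    "rparent p (rchild p r) = r" "tree_depth p (rchild p r) = Suc (tree_depth p r)"
proof -
  have lt: "Suc r < tree_hi p r" and l: "rchild p r = (Suc r + tree_hi p r) div 2"
    using assms(2) by (auto simp: rchild_def split: if_splits)
  have n: "tree_node p (Suc r) (tree_hi p r) r 2 (Suc (tree_depth p r))"
    using tree_node.right[OF tree_node_of(1)[OF assms(1)]] tree_node_of(2)[OF assms(1)] lt by simp
  show "rchild p r \<in> {1..p}" using l lt tree_bounds[OF assms(1)] by auto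
  from tree_node_eq[OF n l] show "tree_lo p (rchild p r) = Suc r"
    "tree_hi p (rchild p r) = tree_hi p r"
    "rparent p (rchild p r) = r" "tree_depth p (rchild p r) = Suc (tree_depth p r)"
    by (auto simp: rparent_def)
qed

lemma lparent:
  assumes "r \<in> {1..p}" "lparent p r \<noteq> 0"
  shows "lparent p r \<in> {1..p}" "lchild p (lparent p r) = r"
    "tree_depth p r = Suc (tree_depth p (lparent p r))"
proof -
  have s: "tree_side p r = 1" and l: "lparent p r = tree_par p r"
    using assms(2) by (auto simp: lparent_def split: if_splits)
  from tree_node_of(1)[OF assms(1)] s obtain lo hi par side dep
    where n: "tree_node p lo hi par side dep" "lo < (lo + hi) div 2" "tree_lo p r = lo"
      "tree_hi p r = (lo + hi) div 2" "tree_par p r = (lo + hi) div 2" "tree_depth p r = Suc dep"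
    by cases auto
  note eq = tree_node_eq[OF n(1) refl]
  show "lparent p r \<in> {1..p}" using l n tree_node_bounds[OF n(1)] by auto
  show "lchild p (lparent p r) = r"
    using l n eq tree_node_of(2)[OF assms(1)] by (simp add: lchild_def)
  show "tree_depth p r = Suc (tree_depth p (lparent p r))" using l n eq by simp
qed

lemma rparent:
  assumes "r \<in> {1..p}" "rparent p r \<noteq> 0"
  shows "rparent p r \<in> {1..p}" "rchild p (rparent p r) = r"
    "tree_depth p r = Suc (tree_depth p (rparent p r))"
proof -
  have s: "tree_side p r = 2" and l: "rparent p r = tree_par p r"
    using assms(2) by (auto simp: rparent_def split: if_splits)
  from tree_node_of(1)[OF assms(1)] s obtain lo hi par side dep
    where n: "tree_node p lo hi par side dep" "Suc ((lo + hi) div 2) < hi"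
      "tree_lo p r = Suc ((lo + hi) div 2)"
      "tree_hi p r = hi" "tree_par p r = (lo + hi) div 2" "tree_depth p r = Suc dep"
    by cases auto
  note eq = tree_node_eq[OF n(1) refl]
  show "rparent p r \<in> {1..p}" using l n tree_node_bounds[OF n(1)] by auto
  show "rchild p (rparent p r) = r"
    using l n eq tree_node_of(2)[OF assms(1)] by (simp add: rchild_def)
  show "tree_depth p r = Suc (tree_depth p (rparent p r))" using l n eq by simp
qed

lemma tree_depth_0:
  assumes "r \<in> {1..p}" "tree_depth p r = 0"
  shows "tree_lo p r = 1" "tree_hi p r = Suc p" "lparent p r = 0" "rparent p r = 0"
  using tree_node_of(1)[OF assms(1)] assms(2) by (cases; simp add: lparent_def rparent_def)+

lemma tree_depth_pos:
  assumes "r \<in> {1..p}" "tree_depth p r \<noteq> 0"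
  shows "lparent p r \<noteq> 0 \<or> rparent p r \<noteq> 0"
proof -
  have "tree_par p r \<noteq> 0 \<and> (tree_side p r = 1 \<or> tree_side p r = 2)"
    using tree_node_of(1)[OF assms(1)] assms(2)
    by cases (auto dest!: tree_node_bounds simp: div_eq_0_iff)
  then show ?thesis by (auto simp: lparent_def rparent_def)
qed

text \<open>The factors \<open>a\<close> and \<open>b\<close> belong to the node and multiply whole
  subtree results, so a PE applies them to what its children send and the children need not know
  them.\<close>

function tree_sum :: "(nat \<Rightarrow> nat) \<Rightarrow> (nat \<Rightarrow> nat) \<Rightarrow> (nat \<Rightarrow> nat) \<Rightarrow> nat \<Rightarrow> nat \<Rightarrow> nat" where
  "tree_sum x a b lo hi =
     (if hi \<le> lo then 0
      else x ((lo + hi) div 2) + a ((lo + hi) div 2) * tree_sum x a b lo ((lo + hi) div 2)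
        + b ((lo + hi) div 2) * tree_sum x a b (Suc ((lo + hi) div 2)) hi)"
  by pat_completeness auto
termination by (relation "Wellfounded.measure (\<lambda>(_, _, _, lo, hi). hi - lo)") auto

declare tree_sum.simps [simp del]

lemma tree_sum_empty [simp]: "hi \<le> lo \<Longrightarrow> tree_sum x a b lo hi = 0"
  by (simp add: tree_sum.simps)

lemma tree_sum_node:
  assumes "r \<in> {1..p}"
  shows "tree_sum x a b (tree_lo p r) (tree_hi p r) =
    x r + a r * tree_sum x a b (tree_lo p r) r + b r * tree_sum x a b (Suc r) (tree_hi p r)"
  using tree_sum.simps[of x a b "tree_lo p r" "tree_hi p r"] tree_node_of(2)[OF assms]
    tree_bounds[OF assms] by simp

text \<open>Only the \<open>B\<close> low bits of a summand enter a stream; modulo 2 ^ B this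
  truncation is invisible.\<close>

lemma tree_sum_mod:
  "tree_sum (\<lambda>i. x i mod m) a b lo hi mod m = tree_sum x a b lo hi mod m"
proof (induction x a b lo hi rule: tree_sum.induct)
  case (1 x a b lo hi)
  show ?case
  proof (cases "hi \<le> lo")
    case False
    show ?thesis
      using 1 False by (subst (1 2) tree_sum.simps) (auto intro!: mod_add_cong mod_mult_cong)
  qed simp
qed

lemma tree_sum_eq_sum: "tree_sum x (\<lambda>_. 1) (\<lambda>_. 1) lo hi = (\<Sum>i\<in>{lo..<hi}. x i)"
proof (induction "hi - lo" arbitrary: lo hi rule: less_induct)
  case less
  show ?case
  proof (cases "hi \<le> lo")
    case False
    let ?m = "(lo + hi) div 2"
    have "{lo..<hi} = {lo..<?m} \<union> {?m} \<union> {Suc ?m..<hi}" using False by auto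
    moreover have "(\<Sum>i\<in>{lo..<?m} \<union> {?m} \<union> {Suc ?m..<hi}. x i)
      = (\<Sum>i\<in>{lo..<?m}. x i) + x ?m + (\<Sum>i\<in>{Suc ?m..<hi}. x i)"
      by (subst sum.union_disjoint; (subst sum.union_disjoint)?) auto
    ultimately show ?thesis
      using False less[of ?m lo] less[of hi "Suc ?m"] by (subst tree_sum.simps) simp
  qed simp
qed

section \<open>Pipelined tree sums\<close>

lemma mod_mult_div: "(v mod (q * m)) div q = v div q mod m" if "q > 0" for v q m :: nat
  using that by (simp add: mod_mult2_eq)

text \<open>Schoolbook addition in base \<open>m\<close>: \<open>q\<close> is the weight of the
  current digit, and the carry into it is the quotient by \<open>q\<close> of the sum of the parts
  below \<open>q\<close>. Digits and carry add up to \<open>?S div q\<close>, where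
  \<open>?S\<close> is the sum of the parts below \<open>q * m\<close>. The low digit is output, and
  the rest is the next carry in the same closed form.\<close>

lemma chunk_sum:
  fixes X PL PR a b q m :: nat
  assumes q: "q > 0"
  defines "acc \<equiv> X div q mod m + (PL div q mod m) * a + (PR div q mod m) * b +
      (X mod q + a * (PL mod q) + b * (PR mod q)) div q"
  shows "acc mod m = (X + a * PL + b * PR) div q mod m"
    and "acc div m = (X mod (q * m) + a * (PL mod (q * m)) + b * (PR mod (q * m))) div (q * m)"
proof -
  let ?S = "X mod (q * m) + a * (PL mod (q * m)) + b * (PR mod (q * m))"
  have "?S = (X mod q + a * (PL mod q) + b * (PR mod q)) +
      q * (X div q mod m + (PL div q mod m) * a + (PR div q mod m) * b)"
    unfolding mod_mult2_eq by (simp add: algebra_simps)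
  then have S: "?S div q = acc" using q by (simp add: acc_def)
  show "acc div m = ?S div (q * m)" by (simp add: S[symmetric] div_mult2_eq)
  have "?S mod (q * m) = (X + a * PL + b * PR) mod (q * m)"
    by (intro mod_add_cong mod_mult_cong) simp_all
  then show "acc mod m = (X + a * PL + b * PR) div q mod m"
    using mod_mult_div[OF q, of ?S m] mod_mult_div[OF q, of "X + a * PL + b * PR" m] S by simp
qed

text \<open>Three terms below \<open>q\<close> stay below 3 * q, so the carry fits in the two bits
  with which \<open>stream_step\<close> extracts it.\<close>

lemma carry_bound:
  fixes X PL PR a b q :: nat
  assumes "q > 0" "a \<le> 1" "b \<le> 1"
  shows "(X mod q + a * (PL mod q) + b * (PR mod q)) div q < 3"
proof -
  have "a * (PL mod q) < q" "b * (PR mod q) < q" "X mod q < q"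
    using assms by (cases a; cases b; simp)+
  then have "X mod q + a * (PL mod q) + b * (PR mod q) < 3 * q" by linarith
  then show ?thesis using assms(1) by (simp add: div_less_iff_less_mult)
qed

text \<open>For \<open>simp only\<close>: evaluates a block, deciding equality of variable names,
  without rewriting the values in the store.\<close>

lemmas exec_simps = exec_instr.simps cost_instr.simps fun_upd_apply list.inject char.inject simp_thms
  list.distinct if_True if_False words_small

text \<open>One digit of the addition. \<open>rl\<close>, \<open>rr\<close> and \<open>y\<close>
  record the streams of both children and the own stream, because the sums on either side of a PE
  are wanted as well as the total.\<close>

definition stream_step :: lcmd where
  "stream_step = block [
     Extract ''t'' ''X'' ''off'' ''c'',
     Mul ''u'' ''il'' ''ml'',
     Add ''t'' ''t'' ''u'',
     Mul ''u'' ''ir'' ''mr'',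
     Add ''t'' ''t'' ''u'',
     Add ''t'' ''t'' ''carry'',
     Extract ''out'' ''t'' ''zero'' ''c'',
     Extract ''carry'' ''t'' ''c'' ''two'',
     Deposit ''rl'' ''il'' ''off'' ''c'',
     Deposit ''rr'' ''ir'' ''off'' ''c'',
     Deposit ''y'' ''out'' ''off'' ''c'',
     Add ''off'' ''off'' ''c'',
     Sub ''cnt'' ''cnt'' ''one'']"

text \<open>
  The summand is shifted by one chunk for every level below the PE, so that it lines up with the
  delayed streams of the children.
\<close>

definition stream_pre :: lcmd where
  "stream_pre = block [
     Copy ''X'' ''zero'',
     Deposit ''X'' ''x'' ''sh'' ''B'',
     Copy ''off'' ''zero'',
     Copy ''carry'' ''zero'',
     Copy ''il'' ''zero'',
     Copy ''ir'' ''zero'',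
     Copy ''rl'' ''zero'',
     Copy ''rr'' ''zero'',
     Copy ''y'' ''zero'',
     Add ''cnt'' ''D'' ''D'',
     Add ''cnt'' ''cnt'' ''one'']"

definition stream_post :: lcmd where
  "stream_post = block [
     Extract ''zl'' ''rl'' ''sh'' ''B'',
     Extract ''zr'' ''rr'' ''sh'' ''B'',
     Extract ''zy'' ''y'' ''sh'' ''B'']"

text \<open>The first step precedes the loop because nothing has been received yet. With the 2 * D
  rounds this makes 2 * D + 1 steps: D for the largest shift and D + 1 for the payload.\<close>

definition stream :: prog where
  "stream = Seq (Local (LSeq stream_pre stream_step))
     (Seq (While ''cnt'' (Seq (Exchange ''dl'' ''c'' ''out'' ''sl'' ''il'')
                          (Seq (Exchange ''dr'' ''c'' ''out'' ''sr'' ''ir'') (Local stream_step))))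
        (Local stream_post))"

lemma deposit_append:
  fixes r v :: nat
  assumes "r < 2 ^ off" "v < 2 ^ len"
  shows "take_bit off r + push_bit off (take_bit len v) + push_bit (off + len) (drop_bit (off + len) r)
    = r + 2 ^ off * v"
proof -
  have "r < 2 ^ (off + len)" using assms(1) by (rule order_less_le_trans) simp
  then show ?thesis using assms
    by (simp add: take_bit_nat_eq_self push_bit_eq_mult drop_bit_eq_div)
qed

lemma mult_less_power2:
  fixes a b :: nat
  assumes "a < 2 ^ m" "b < 2 ^ n" shows "a * b < 2 ^ (m + n)"
  using assms by (simp add: power_add mult_strict_mono)

text \<open>All operands charged by their size have at most c + 2 * D + 4 bits: sums below 2 ^ (c +
  2), the offset c * r below 2 ^ (c + 2 * D), the counter and the constants. The long registers
  occur only in \<open>Extract\<close> and \<open>Deposit\<close>, which do not charge for their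
  length.\<close>

lemma stream_step_correct:
  fixes s :: store
  assumes w: "wsize E = w" and u: "u = 1 + (s ''c'' + 2 * D + 4) div w"
    and off: "s ''off'' = s ''c'' * r" "r \<le> 2 * D"
    and cnt: "s ''cnt'' \<le> 2 * D + 1"
    and il: "s ''il'' < 2 ^ s ''c''" and ir: "s ''ir'' < 2 ^ s ''c''"
    and ml: "s ''ml'' \<le> 1" and mr: "s ''mr'' \<le> 1"
    and carry: "s ''carry'' < 3"
    and small: "s ''rl'' < 2 ^ s ''off''" "s ''rr'' < 2 ^ s ''off''" "s ''y'' < 2 ^ s ''off''"
    and cs: "s ''zero'' = 0" "s ''one'' = 1" "s ''two'' = 2"
    and acc: "acc = s ''X'' div 2 ^ s ''off'' mod 2 ^ s ''c'' + s ''il'' * s ''ml'' + s ''ir'' * s ''mr''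
                + s ''carry''"
  shows "lwp E stream_step (\<lambda>t s'. t \<le> 40 * u \<and>
      s' ''out'' = acc mod 2 ^ s ''c'' \<and> s' ''carry'' = acc div 2 ^ s ''c'' \<and>
      s' ''rl'' = s ''rl'' + 2 ^ s ''off'' * s ''il'' \<and>
      s' ''rr'' = s ''rr'' + 2 ^ s ''off'' * s ''ir'' \<and>
      s' ''y'' = s ''y'' + 2 ^ s ''off'' * (acc mod 2 ^ s ''c'') \<and>
      s' ''off'' = s ''c'' * Suc r \<and> s' ''cnt'' = s ''cnt'' - 1) s"
proof -
  define c where "c = s ''c''"
  define m where "m = c + 2 * D + 4"
  define t1 where "t1 = s ''X'' div 2 ^ s ''off'' mod 2 ^ c"
  have W: "words w v \<le> u" if "v < 2 ^ m" for v
    using words_le[OF that, of w] by (simp add: u m_def c_def)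
  have mono: "v < 2 ^ m" if "v < 2 ^ j" "j \<le> m" for v j :: nat
    using that by (meson order_less_le_trans power_increasing one_le_numeral)
  have lt_self: "v < 2 ^ v" for v :: nat by (rule less_exp)
  have t1: "t1 < 2 ^ c" by (simp add: t1_def)
  have il': "s ''il'' * s ''ml'' < 2 ^ c" using il ml by (cases "s ''ml''") (auto simp: c_def)
  have ir': "s ''ir'' * s ''mr'' < 2 ^ c" using ir mr by (cases "s ''mr''") (auto simp: c_def)
  \<comment> \<open>Three chunks and a carry of at most 2 stay below 4 * 2 ^ c. Hence the two bits
    extracted above the chunk are the whole quotient.\<close>
  have acc4: "acc < 2 ^ (c + 2)"
    using t1 il' ir' carry unfolding acc c_def[symmetric] t1_def[symmetric] power_add by simp
  have wc: "words w c \<le> u" by (rule W, rule mono[OF lt_self]) (simp add: m_def)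
  have woff: "words w (c * r) \<le> u"
    by (rule W, rule mono[OF mult_less_power2[OF lt_self lt_self]]) (use off in \<open>simp add: m_def\<close>)
  have wil: "words w (s ''il'') \<le> u" and wir: "words w (s ''ir'') \<le> u"
    using il ir by (intro W mono[where j = c]; simp add: m_def c_def)+
  have wml: "words w (s ''ml'') = 1" and wmr: "words w (s ''mr'') = 1"
    using ml mr by (cases "s ''ml''"; cases "s ''mr''"; simp)+
  have wil': "words w (s ''il'' * s ''ml'') \<le> u" and wir': "words w (s ''ir'' * s ''mr'') \<le> u"
    using il' ir' by (intro W mono[where j = c]; simp add: m_def c_def)+
  have wt: "words w t1 \<le> u" "words w (t1 + s ''il'' * s ''ml'') \<le> u"
    "words w (t1 + s ''il'' * s ''ml'' + s ''ir'' * s ''mr'') \<le> u"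
    using t1 acc4 unfolding acc c_def[symmetric] t1_def[symmetric]
    by (intro W mono[where j = "c + 2"]; simp add: m_def)+
  have wcarry: "words w (s ''carry'') \<le> u"
    using carry by (intro W mono[where j = 2]; simp add: m_def)
  have w2: "words w 2 \<le> u" by (intro W mono[where j = 2]; simp add: m_def)
  have wcnt: "words w (s ''cnt'') \<le> u"
    using cnt by (intro W mono[OF lt_self]; simp add: m_def)
  have u1: "1 \<le> u" "c div w < u" "2 div w < u"
    by (auto simp: u c_def less_Suc_eq_le intro!: div_le_mono)
  have div4: "acc div 2 ^ c < 4" using acc4 by (simp add: div_less_iff_less_mult power_add)
  note d = deposit_append[OF small(1) il] deposit_append[OF small(2) ir]
    deposit_append[OF small(3), of "acc mod 2 ^ c" c]
  have X: "take_bit c (drop_bit (c * r) (s ''X'')) = t1"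
    by (simp add: t1_def take_bit_eq_mod drop_bit_eq_div off c_def)
  have a: "t1 + s ''il'' * s ''ml'' + s ''ir'' * s ''mr'' + s ''carry'' = acc"
    by (simp add: acc t1_def c_def)
  have tb: "take_bit c acc = acc mod 2 ^ c" "take_bit 2 (drop_bit c acc) = acc div 2 ^ c"
    using div4 by (simp_all add: take_bit_eq_mod drop_bit_eq_div)
  have offc: "s ''off'' = c * r" by (simp add: off c_def)
  show ?thesis
    apply (unfold stream_step_def block.simps)
    apply (rule lwp_LSeq lwp_Instr)+
    using d wc woff wil wir wil' wir' wt wcarry w2 wcnt u1
    by (simp add: w cs c_def[symmetric] offc X a tb wml wmr)
qed

locale pipeline =
  fixes p D c B w :: nat and \<alpha> \<beta> :: real and E :: "nat \<Rightarrow> pe_env"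
  assumes p: "p \<ge> 1" and D: "D = floor_log p" and B: "B \<le> c * (D + 1)" and \<beta>: "\<beta> \<ge> 0"
    and E: "\<And>i. i \<in> {1..p} \<Longrightarrow> wsize (E i) = w"
begin

text \<open>Measured from the largest possible depth \<open>D\<close> and not from the height of the
  actual subtree, so that parent and child differ by exactly one chunk even if the heights are
  uneven.\<close>

definition shift :: "nat \<Rightarrow> nat" where
  "shift i = c * (D - tree_depth p i)"

definition net :: "nat \<Rightarrow> store \<Rightarrow> bool" where
  "net i s \<longleftrightarrow> s ''dl'' = lparent p i \<and> s ''dr'' = rparent p i \<and> s ''sl'' = lchild p i \<and>
     s ''sr'' = rchild p i \<and> s ''c'' = c \<and> s ''D'' = D \<and> s ''B'' = B \<and> s ''sh'' = shift i \<and>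
     s ''zero'' = 0 \<and> s ''one'' = 1 \<and> s ''two'' = 2"

lemma net_frame:
  assumes "net i s" "\<forall>v. v \<notin> W \<longrightarrow> s' v = s v"
    and "{''dl'', ''dr'', ''sl'', ''sr'', ''c'', ''D'', ''B'', ''sh'', ''zero'', ''one'', ''two''} \<inter> W = {}"
  shows "net i s'"
  using assms unfolding net_def by (simp add: disjoint_iff)

text \<open>\<open>step_words\<close> is paid in each of the O(log p) rounds and must not contain
  \<open>B\<close>. \<open>all_words\<close> also covers registers of \<open>B\<close> bits and is
  never multiplied by the number of rounds.\<close>

definition step_words :: nat where "step_words = 1 + (c + 2 * D + 4) div w"
definition all_words :: nat where "all_words = 1 + (c + 2 * D + 4 + B) div w"

lemma words_all: "v < 2 ^ j \<Longrightarrow> j \<le> c + 2 * D + 4 + B \<Longrightarrow> words w v \<le> all_words"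
  unfolding all_words_def by (rule words_le_mono)

lemma words_step: "v < 2 ^ j \<Longrightarrow> j \<le> c + 2 * D + 4 \<Longrightarrow> words w v \<le> step_words"
  unfolding step_words_def by (rule words_le_mono)

lemma lchild_shift: "i \<in> {1..p} \<Longrightarrow> lchild p i \<noteq> 0 \<Longrightarrow> shift i = c + shift (lchild p i)"
proof -
  assume "i \<in> {1..p}" "lchild p i \<noteq> 0"
  then have "tree_depth p (lchild p i) \<le> D" "tree_depth p (lchild p i) = Suc (tree_depth p i)"
    using tree_bounds(5)[of "lchild p i" p] lchild(1,5)[of i p] D by auto
  then have "D - tree_depth p i = Suc (D - tree_depth p (lchild p i))" by simp
  then show ?thesis by (simp add: shift_def)
qed

lemma rchild_shift: "i \<in> {1..p} \<Longrightarrow> rchild p i \<noteq> 0 \<Longrightarrow> shift i = c + shift (rchild p i)"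
proof -
  assume "i \<in> {1..p}" "rchild p i \<noteq> 0"
  then have "tree_depth p (rchild p i) \<le> D" "tree_depth p (rchild p i) = Suc (tree_depth p i)"
    using tree_bounds(5)[of "rchild p i" p] rchild(1,5)[of i p] D by auto
  then have "D - tree_depth p i = Suc (D - tree_depth p (rchild p i))" by simp
  then show ?thesis by (simp add: shift_def)
qed

context
  fixes x a b :: "nat \<Rightarrow> nat"
  assumes a: "\<And>i. i \<in> {1..p} \<Longrightarrow> a i \<le> 1" and b: "\<And>i. i \<in> {1..p} \<Longrightarrow> b i \<le> 1"
begin

abbreviation "xm \<equiv> \<lambda>i. x i mod 2 ^ B"

text \<open>A stream is identified with the number whose digits in base 2 ^ c are its chunks.
  \<open>left_in\<close> and \<open>right_in\<close> arrive from the children, \<open>total\<close>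
  is sent upwards.\<close>

definition left_in :: "nat \<Rightarrow> nat" where
  "left_in i = 2 ^ shift i * tree_sum xm a b (tree_lo p i) i"
definition right_in :: "nat \<Rightarrow> nat" where
  "right_in i = 2 ^ shift i * tree_sum xm a b (Suc i) (tree_hi p i)"
definition total :: "nat \<Rightarrow> nat" where
  "total i = 2 ^ shift i * xm i + a i * left_in i + b i * right_in i"

lemma total_eq:
  assumes "i \<in> {1..p}"
  shows "total i = 2 ^ shift i * tree_sum xm a b (tree_lo p i) (tree_hi p i)"
  using tree_sum_node[OF assms, of xm a b]
  by (simp add: total_def left_in_def right_in_def algebra_simps)

text \<open>What a child sends in one step is used in the next, which multiplies its stream by 2 ^
  c. This is exactly the difference between the shifts of parent and child.\<close>

lemma left_in_eq:
  assumes "i \<in> {1..p}"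
  shows "left_in i = (if lchild p i = 0 then 0 else 2 ^ c * total (lchild p i))"
proof (cases "lchild p i = 0")
  case True
  then have "i \<le> tree_lo p i" using assms tree_bounds[OF assms] by (auto simp: lchild_def split: if_splits)
  then show ?thesis using True by (simp add: left_in_def)
next
  case False
  then show ?thesis
    using lchild[OF assms False] total_eq[OF lchild(1)[OF assms False]] lchild_shift[OF assms False]
    by (simp add: left_in_def power_add)
qed

lemma right_in_eq:
  assumes "i \<in> {1..p}"
  shows "right_in i = (if rchild p i = 0 then 0 else 2 ^ c * total (rchild p i))"
proof (cases "rchild p i = 0")
  case True
  then have "tree_hi p i \<le> Suc i" using assms tree_bounds[OF assms] by (auto simp: rchild_def split: if_splits)
  then show ?thesis using True by (simp add: right_in_def)
next
  case False
  then show ?thesis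
    using rchild[OF assms False] total_eq[OF rchild(1)[OF assms False]] rchild_shift[OF assms False]
    by (simp add: right_in_def power_add)
qed

definition out_chunk :: "nat \<Rightarrow> nat \<Rightarrow> nat" where
  "out_chunk r i = total i div 2 ^ (c * r) mod 2 ^ c"

text \<open>The state after \<open>r\<close> steps. Delays by one round and shifts by one chunk are the same thing.\<close>

definition stream_inv :: "nat \<Rightarrow> nat \<Rightarrow> store \<Rightarrow> bool" where
  "stream_inv r i s \<longleftrightarrow> net i s \<and> s ''X'' = 2 ^ shift i * xm i \<and> s ''ml'' = a i \<and> s ''mr'' = b i \<and>
     s ''off'' = c * r \<and> s ''cnt'' = 2 * D + 1 - r \<and>
     s ''rl'' = left_in i mod 2 ^ (c * r) \<and> s ''rr'' = right_in i mod 2 ^ (c * r) \<and>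
     s ''y'' = total i mod 2 ^ (c * r) \<and>
     s ''carry'' = (s ''X'' mod 2 ^ (c * r) + a i * (left_in i mod 2 ^ (c * r))
        + b i * (right_in i mod 2 ^ (c * r))) div 2 ^ (c * r)"

text \<open>This is \<open>chunk_sum\<close> with q = 2 ^ (c * r) and m = 2 ^ c. Since the invariant
  gives the carry in closed form, no earlier chunk has to be revisited.\<close>

lemma stream_step_inv:
  assumes i: "i \<in> {1..p}" and r: "r \<le> 2 * D" and s: "stream_inv r i s"
    and il: "s ''il'' = left_in i div 2 ^ (c * r) mod 2 ^ c"
    and ir: "s ''ir'' = right_in i div 2 ^ (c * r) mod 2 ^ c"
  shows "lwp (E i) stream_step (\<lambda>t s'. t \<le> 40 * step_words \<and> stream_inv (Suc r) i s' \<and>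
    s' ''out'' = out_chunk r i \<and> s' ''il'' = s ''il'' \<and> s' ''ir'' = s ''ir'') s"
proof -
  let ?q = "2 ^ (c * r) :: nat" and ?m = "2 ^ c :: nat"
  define acc where "acc = s ''X'' div ?q mod ?m + (left_in i div ?q mod ?m) * a i
    + (right_in i div ?q mod ?m) * b i + s ''carry''"
  note n = s[unfolded stream_inv_def net_def]
  have qm: "(2::nat) ^ (c * Suc r) = ?q * ?m" by (simp add: power_add)
  have acc: "acc mod ?m = total i div ?q mod ?m"
    "acc div ?m = (s ''X'' mod 2 ^ (c * Suc r) + a i * (left_in i mod 2 ^ (c * Suc r))
        + b i * (right_in i mod 2 ^ (c * Suc r))) div 2 ^ (c * Suc r)"
    unfolding qm acc_def
    using chunk_sum[of ?q "s ''X''" ?m "left_in i" "a i" "right_in i" "b i"] n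
    by (simp_all add: total_def)
  have chunk: "v mod ?q + ?q * (v div ?q mod ?m) = v mod 2 ^ (c * Suc r)" for v :: nat
    unfolding qm mod_mult2_eq by simp
  have "lwp (E i) stream_step (\<lambda>t s'. t \<le> 40 * step_words \<and>
      s' ''out'' = acc mod 2 ^ s ''c'' \<and> s' ''carry'' = acc div 2 ^ s ''c'' \<and>
      s' ''rl'' = s ''rl'' + 2 ^ s ''off'' * s ''il'' \<and>
      s' ''rr'' = s ''rr'' + 2 ^ s ''off'' * s ''ir'' \<and>
      s' ''y'' = s ''y'' + 2 ^ s ''off'' * (acc mod 2 ^ s ''c'') \<and>
      s' ''off'' = s ''c'' * Suc r \<and> s' ''cnt'' = s ''cnt'' - 1) s"
    by (rule stream_step_correct[where D = D and w = w])
      (use n r E[OF i] a[OF i] b[OF i] il ir carry_bound[OF _ a[OF i] b[OF i], of ?q]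
       in \<open>simp_all add: step_words_def acc_def\<close>)
  from lwp_frame[OF this] show ?thesis
  proof (rule lwp_mono, elim conjE)
    fix t s'
    assume t: "t \<le> 40 * step_words" and
      v: "s' ''out'' = acc mod 2 ^ s ''c''" "s' ''carry'' = acc div 2 ^ s ''c''"
      "s' ''rl'' = s ''rl'' + 2 ^ s ''off'' * s ''il''"
      "s' ''rr'' = s ''rr'' + 2 ^ s ''off'' * s ''ir''"
      "s' ''y'' = s ''y'' + 2 ^ s ''off'' * (acc mod 2 ^ s ''c'')"
      "s' ''off'' = s ''c'' * Suc r" "s' ''cnt'' = s ''cnt'' - 1"
      and fr: "\<forall>v. v \<notin> lwrites stream_step \<longrightarrow> s' v = s v"
    from fr have f: "s' v = s v" if "v \<notin> {''t'', ''u'', ''out'', ''carry'', ''rl'', ''rr'', ''y'', ''off'', ''cnt''}" for v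
      using that by (simp add: stream_step_def)
    have "net i s'" by (rule net_frame[OF _ fr]) (use s in \<open>simp_all add: stream_inv_def stream_step_def\<close>)
    moreover have "s' ''X'' = s ''X''" "s' ''ml'' = s ''ml''" "s' ''mr'' = s ''mr''"
      "s' ''il'' = s ''il''" "s' ''ir'' = s ''ir''" by (simp_all add: f)
    moreover have "s' ''rl'' = left_in i mod 2 ^ (c * Suc r)" "s' ''rr'' = right_in i mod 2 ^ (c * Suc r)"
      "s' ''y'' = total i mod 2 ^ (c * Suc r)"
      unfolding chunk[symmetric] using v n il ir acc(1) by simp_all
    ultimately show "t \<le> 40 * step_words \<and> stream_inv (Suc r) i s' \<and>
      s' ''out'' = out_chunk r i \<and> s' ''il'' = s ''il'' \<and> s' ''ir'' = s ''ir''"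
      using t v n acc unfolding stream_inv_def out_chunk_def by (simp del: mult_Suc_right)
  qed
qed

lemma stream_start:
  assumes i: "i \<in> {1..p}" and s: "net i s" "s ''x'' = x i" "s ''ml'' = a i" "s ''mr'' = b i"
  shows "lwp (E i) (LSeq stream_pre stream_step) (\<lambda>t s'. t \<le> 60 * all_words \<and> stream_inv 1 i s' \<and>
    s' ''out'' = out_chunk 0 i \<and> (lchild p i = 0 \<longrightarrow> s' ''il'' = 0) \<and> (rchild p i = 0 \<longrightarrow> s' ''ir'' = 0)) s"
proof (rule lwp_LSeq)
  note n = s[unfolded net_def]
  have wsh: "words w (shift i) \<le> all_words"
    unfolding shift_def by (rule words_all[OF mult_less_power2[OF less_exp less_exp]]) simp
  have wd: "words w B \<le> all_words" "words w D \<le> all_words" "words w (2 * D) \<le> all_words"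
    by (rule words_all[OF less_exp], simp)+
  have u1: "1 \<le> all_words" "B div w < all_words" "40 * step_words \<le> 40 * all_words"
    by (auto simp: all_words_def step_words_def less_Suc_eq_le intro!: div_le_mono)
  have "lwp (E i) stream_pre (\<lambda>t s'. t \<le> 20 * all_words \<and> s' ''X'' = 2 ^ shift i * xm i \<and>
     s' ''off'' = 0 \<and> s' ''carry'' = 0 \<and> s' ''il'' = 0 \<and> s' ''ir'' = 0 \<and> s' ''rl'' = 0 \<and>
     s' ''rr'' = 0 \<and> s' ''y'' = 0 \<and> s' ''cnt'' = 2 * D + 1) s"
    apply (unfold stream_pre_def block.simps)
    apply (rule lwp_LSeq lwp_Instr)+
    using n wsh wd u1
    by (simp add: E[OF i] mult_2 take_bit_eq_mod push_bit_eq_mult)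
  from lwp_frame[OF this]
  show "lwp (E i) stream_pre (\<lambda>t1. lwp (E i) stream_step (\<lambda>t2 s'. t1 + t2 \<le> 60 * all_words \<and>
    stream_inv 1 i s' \<and> s' ''out'' = out_chunk 0 i \<and> (lchild p i = 0 \<longrightarrow> s' ''il'' = 0) \<and>
    (rchild p i = 0 \<longrightarrow> s' ''ir'' = 0))) s"
  proof (rule lwp_mono, elim conjE)
    fix t1 s1
    assume t1: "t1 \<le> 20 * all_words" and v: "s1 ''X'' = 2 ^ shift i * xm i"
     "s1 ''off'' = 0" "s1 ''carry'' = 0" "s1 ''il'' = 0" "s1 ''ir'' = 0" "s1 ''rl'' = 0"
     "s1 ''rr'' = 0" "s1 ''y'' = 0" "s1 ''cnt'' = 2 * D + 1"
     and fr: "\<forall>v. v \<notin> lwrites stream_pre \<longrightarrow> s1 v = s v"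
    from fr have f: "s1 v = s v" if "v \<notin> {''X'', ''off'', ''carry'', ''il'', ''ir'', ''rl'', ''rr'', ''y'', ''cnt''}" for v
      using that by (simp add: stream_pre_def)
    have "net i s1" by (rule net_frame[OF _ fr]) (use s in \<open>simp_all add: stream_pre_def\<close>)
    moreover have "s1 ''ml'' = a i" "s1 ''mr'' = b i" using s by (simp_all add: f)
    ultimately have inv: "stream_inv 0 i s1" using v by (simp add: stream_inv_def)
    \<comment> \<open>Incoming streams are multiples of 2 ^ c, so starting with \<open>il\<close>
      and \<open>ir\<close> equal to 0 is right although nothing has been received.\<close>
    have il: "left_in i mod 2 ^ c = 0" "right_in i mod 2 ^ c = 0"
      using left_in_eq[OF i] right_in_eq[OF i] by simp_all
    have "lwp (E i) stream_step (\<lambda>t s'. t \<le> 40 * step_words \<and> stream_inv (Suc 0) i s' \<and>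
      s' ''out'' = out_chunk 0 i \<and> s' ''il'' = s1 ''il'' \<and> s' ''ir'' = s1 ''ir'') s1"
      by (rule stream_step_inv[OF i _ inv]) (simp_all add: v il)
    then show "lwp (E i) stream_step (\<lambda>t2 s'. t1 + t2 \<le> 60 * all_words \<and>
      stream_inv 1 i s' \<and> s' ''out'' = out_chunk 0 i \<and> (lchild p i = 0 \<longrightarrow> s' ''il'' = 0) \<and>
      (rchild p i = 0 \<longrightarrow> s' ''ir'' = 0)) s1"
      by (rule lwp_mono) (use t1 u1 v in auto)
  qed
qed

lemma stream_round:
  assumes r: "1 \<le> r" "r \<le> 2 * D"
  defines "I \<equiv> \<lambda>r i s. stream_inv r i s \<and> s ''out'' = out_chunk (r - 1) i \<and>
    (lchild p i = 0 \<longrightarrow> s ''il'' = 0) \<and> (rchild p i = 0 \<longrightarrow> s ''ir'' = 0)"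
  shows "xtriple p \<alpha> \<beta> E (I r) (Seq (Exchange ''dl'' ''c'' ''out'' ''sl'' ''il'')
    (Seq (Exchange ''dr'' ''c'' ''out'' ''sr'' ''ir'') (Local stream_step)))
    (2 * (\<alpha> + \<beta> * real c) + real (40 * step_words)) (I (Suc r))"
proof -
  \<comment> \<open>The states after the left children have been heard and after both have been
    heard.\<close>
  define J where "J i s \<longleftrightarrow> I r i s \<and> s ''il'' = left_in i div 2 ^ (c * r) mod 2 ^ c" for i s
  define K where "K i s \<longleftrightarrow> J i s \<and> s ''ir'' = right_in i div 2 ^ (c * r) mod 2 ^ c" for i s
  obtain r' where r': "r = Suc r'" using r(1) by (cases r) auto
  \<comment> \<open>Chunk r - 1 of a child's stream is chunk r of the incoming stream.\<close>
  have chunk: "2 ^ c * v div 2 ^ (c * r) mod 2 ^ c = v div 2 ^ (c * (r - 1)) mod 2 ^ c" for v :: nat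
    by (simp add: r' power_add)
  have out: "out_chunk (r - 1) i < 2 ^ c" for i by (simp add: out_chunk_def)
  have 1: "xtriple p \<alpha> \<beta> E (I r) (Exchange ''dl'' ''c'' ''out'' ''sl'' ''il'') (\<alpha> + \<beta> * real c) J"
  proof (rule xtriple_mono[OF xtriple_Exchange[where d = "lparent p" and e = "lchild p"
          and m = "out_chunk (r - 1)" and l = c and P = "I r"]])
    fix i s assume i: "i \<in> {1..p}"
      and "\<exists>s0. I r i s0 \<and> s = (if lchild p i \<noteq> 0 then s0(''il'' := out_chunk (r - 1) (lchild p i)) else s0)"
    then obtain s0 where s0: "I r i s0"
      and s: "s = (if lchild p i \<noteq> 0 then s0(''il'' := out_chunk (r - 1) (lchild p i)) else s0)" by blast
    have "s ''il'' = left_in i div 2 ^ (c * r) mod 2 ^ c"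
      using s0 by (simp add: s left_in_eq[OF i] I_def out_chunk_def chunk)
    moreover have "I r i s" using s0 by (simp add: s I_def stream_inv_def net_def)
    ultimately show "J i s" by (simp add: J_def)
  qed (use p \<beta> out lparent lchild in \<open>auto simp: I_def stream_inv_def net_def\<close>)
  have 2: "xtriple p \<alpha> \<beta> E J (Exchange ''dr'' ''c'' ''out'' ''sr'' ''ir'') (\<alpha> + \<beta> * real c) K"
  proof (rule xtriple_mono[OF xtriple_Exchange[where d = "rparent p" and e = "rchild p"
          and m = "out_chunk (r - 1)" and l = c and P = J]])
    fix i s assume i: "i \<in> {1..p}"
      and "\<exists>s0. J i s0 \<and> s = (if rchild p i \<noteq> 0 then s0(''ir'' := out_chunk (r - 1) (rchild p i)) else s0)"
    then obtain s0 where s0: "J i s0"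
      and s: "s = (if rchild p i \<noteq> 0 then s0(''ir'' := out_chunk (r - 1) (rchild p i)) else s0)" by blast
    have "s ''ir'' = right_in i div 2 ^ (c * r) mod 2 ^ c"
      using s0 by (simp add: s right_in_eq[OF i] J_def I_def out_chunk_def chunk)
    moreover have "J i s" using s0 left_in_eq[OF i] by (simp add: s J_def I_def stream_inv_def net_def)
    ultimately show "K i s" by (simp add: K_def)
  qed (use p \<beta> out rparent rchild in \<open>auto simp: J_def I_def stream_inv_def net_def\<close>)
  have 3: "xtriple p \<alpha> \<beta> E K (Local stream_step) (real (40 * step_words)) (I (Suc r))"
  proof (rule xtriple_Local[OF p])
    fix i s assume i: "i \<in> {1..p}" and K: "K i s"
    have "lwp (E i) stream_step (\<lambda>t s'. t \<le> 40 * step_words \<and> stream_inv (Suc r) i s' \<and>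
        s' ''out'' = out_chunk r i \<and> s' ''il'' = s ''il'' \<and> s' ''ir'' = s ''ir'') s"
      by (rule stream_step_inv[OF i r(2)]) (use K in \<open>simp_all add: K_def J_def I_def\<close>)
    then show "lwp (E i) stream_step (\<lambda>t s'. t \<le> 40 * step_words \<and> I (Suc r) i s') s"
      by (rule lwp_mono) (use K in \<open>auto simp: K_def J_def I_def\<close>)
  qed
  show ?thesis
    by (rule xtriple_mono[OF xtriple_Seq[OF 1 xtriple_Seq[OF 2 3]]]) (auto simp: algebra_simps)
qed

lemma stream_finish:
  assumes i: "i \<in> {1..p}" and s: "stream_inv (2 * D + 1) i s"
  shows "lwp (E i) stream_post (\<lambda>t s'. t \<le> 20 * all_words \<and> net i s' \<and>
    s' ''zl'' = tree_sum x a b (tree_lo p i) i mod 2 ^ B \<and>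
    s' ''zr'' = tree_sum x a b (Suc i) (tree_hi p i) mod 2 ^ B \<and>
    s' ''zy'' = tree_sum x a b (tree_lo p i) (tree_hi p i) mod 2 ^ B) s"
proof -
  note n = s[unfolded stream_inv_def]
  note n' = conjunct1[OF n, unfolded net_def]
  have wsh: "words w (shift i) \<le> all_words"
    unfolding shift_def by (rule words_all[OF mult_less_power2[OF less_exp less_exp]]) simp
  have wd: "words w B \<le> all_words" by (rule words_all[OF less_exp]) simp
  have u1: "B div w < all_words"
    by (auto simp: all_words_def less_Suc_eq_le intro!: div_le_mono)
  have "shift i \<le> c * D" by (simp add: shift_def)
  \<comment> \<open>A shift of at most D chunks and a payload of at most D + 1 chunks: after 2 * D +
    1 steps the payload has arrived completely.\<close>
  then have sB: "shift i + B \<le> c * (2 * D + 1)" using B by (simp add: algebra_simps)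
  have ext: "take_bit B (drop_bit (shift i) (2 ^ shift i * v mod 2 ^ (c * (2 * D + 1)))) = v mod 2 ^ B"
    for v :: nat
  proof -
    obtain l where l: "c * (2 * D + 1) = shift i + (B + l)"
      using sB by (metis le_iff_add add.assoc)
    have "2 ^ shift i * v mod 2 ^ (c * (2 * D + 1)) div 2 ^ shift i = v mod (2 ^ (B + l))"
      unfolding l by (subst power_add, subst mod_mult_div) simp_all
    then show ?thesis
      by (simp add: take_bit_eq_mod drop_bit_eq_div power_add mod_mult2_eq)
  qed
  have "lwp (E i) stream_post (\<lambda>t s'. t \<le> 20 * all_words \<and>
      s' ''zl'' = tree_sum xm a b (tree_lo p i) i mod 2 ^ B \<and>
      s' ''zr'' = tree_sum xm a b (Suc i) (tree_hi p i) mod 2 ^ B \<and>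
      s' ''zy'' = tree_sum xm a b (tree_lo p i) (tree_hi p i) mod 2 ^ B) s"
    apply (unfold stream_post_def block.simps)
    apply (rule lwp_LSeq lwp_Instr)+
    using n n' wsh wd u1 ext
    by (simp add: E[OF i] left_in_def right_in_def total_eq[OF i])
  from lwp_frame[OF this] show ?thesis
  proof (rule lwp_mono, elim conjE)
    fix t s'
    assume t: "t \<le> 20 * all_words" "s' ''zl'' = tree_sum xm a b (tree_lo p i) i mod 2 ^ B"
      "s' ''zr'' = tree_sum xm a b (Suc i) (tree_hi p i) mod 2 ^ B"
      "s' ''zy'' = tree_sum xm a b (tree_lo p i) (tree_hi p i) mod 2 ^ B"
      and fr: "\<forall>v. v \<notin> lwrites stream_post \<longrightarrow> s' v = s v"
    have "net i s'" by (rule net_frame[OF _ fr]) (use n in \<open>simp_all add: stream_post_def\<close>)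
    then show "t \<le> 20 * all_words \<and> net i s' \<and>
      s' ''zl'' = tree_sum x a b (tree_lo p i) i mod 2 ^ B \<and>
      s' ''zr'' = tree_sum x a b (Suc i) (tree_hi p i) mod 2 ^ B \<and>
      s' ''zy'' = tree_sum x a b (tree_lo p i) (tree_hi p i) mod 2 ^ B"
      using t by (simp add: tree_sum_mod)
  qed
qed

lemma stream_correct:
  "xtriple p \<alpha> \<beta> E (\<lambda>i s. net i s \<and> s ''x'' = x i \<and> s ''ml'' = a i \<and> s ''mr'' = b i) stream
     (real (80 * all_words + 1) + real (2 * D) * (2 * (\<alpha> + \<beta> * real c) + real (40 * step_words + 1)))
     (\<lambda>i s. net i s \<and> s ''zl'' = tree_sum x a b (tree_lo p i) i mod 2 ^ B \<and>
        s ''zr'' = tree_sum x a b (Suc i) (tree_hi p i) mod 2 ^ B \<and>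
        s ''zy'' = tree_sum x a b (tree_lo p i) (tree_hi p i) mod 2 ^ B)"
proof -
  define I where "I \<equiv> \<lambda>r i s. stream_inv r i s \<and> s ''out'' = out_chunk (r - 1) i \<and>
    (lchild p i = 0 \<longrightarrow> s ''il'' = 0) \<and> (rchild p i = 0 \<longrightarrow> s ''ir'' = 0)"
  let ?P = "\<lambda>i s. net i s \<and> s ''x'' = x i \<and> s ''ml'' = a i \<and> s ''mr'' = b i"
  let ?body = "Seq (Exchange ''dl'' ''c'' ''out'' ''sl'' ''il'')
    (Seq (Exchange ''dr'' ''c'' ''out'' ''sr'' ''ir'') (Local stream_step))"
  have 1: "xtriple p \<alpha> \<beta> E ?P (Local (LSeq stream_pre stream_step)) (real (60 * all_words)) (I (Suc 0))"
    using stream_start by (intro xtriple_Local[OF p]) (simp add: I_def)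
  have 2: "xtriple p \<alpha> \<beta> E (I (Suc 0)) (While ''cnt'' ?body)
    (real (2 * D) * ((2 * (\<alpha> + \<beta> * real c) + real (40 * step_words)) + 1) + 1) (I (Suc (2 * D)))"
  \<comment> \<open>Shifted by one because a step has been made before the loop.\<close>
  proof (rule xtriple_While[where I = "\<lambda>r. I (Suc r)"])
    fix r assume "r < 2 * D"
    then show "xtriple p \<alpha> \<beta> E (I (Suc r)) ?body (2 * (\<alpha> + \<beta> * real c) + real (40 * step_words)) (I (Suc (Suc r)))"
      unfolding I_def by (intro stream_round) auto
  qed (auto simp: I_def stream_inv_def)
  have 3: "xtriple p \<alpha> \<beta> E (I (Suc (2 * D))) (Local stream_post) (real (20 * all_words))
     (\<lambda>i s. net i s \<and> s ''zl'' = tree_sum x a b (tree_lo p i) i mod 2 ^ B \<and>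
        s ''zr'' = tree_sum x a b (Suc i) (tree_hi p i) mod 2 ^ B \<and>
        s ''zy'' = tree_sum x a b (tree_lo p i) (tree_hi p i) mod 2 ^ B)"
    using stream_finish by (intro xtriple_Local[OF p]) (simp add: I_def)
  show ?thesis unfolding stream_def
    by (rule xtriple_mono[OF xtriple_Seq[OF 1 xtriple_Seq[OF 2 3]]]) (auto simp: algebra_simps)
qed

end

end

section \<open>Broadcasting the verdict of the root\<close>

definition broadcast :: prog where
  "broadcast = While ''cnt'' (Seq (Exchange ''sl'' ''one'' ''verdict'' ''dl'' ''verdict'')
     (Seq (Exchange ''sr'' ''one'' ''verdict'' ''dr'' ''verdict'') (Local (block [Sub ''cnt'' ''cnt'' ''one'']))))"

context pipeline
begin

context
  fixes v :: "nat \<Rightarrow> nat"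
begin

definition down_left :: "(nat \<Rightarrow> nat) \<Rightarrow> nat \<Rightarrow> nat" where
  "down_left f i = (if lparent p i \<noteq> 0 then f (lparent p i) else f i)"
definition down_right :: "(nat \<Rightarrow> nat) \<Rightarrow> nat \<Rightarrow> nat" where
  "down_right f i = (if rparent p i \<noteq> 0 then f (rparent p i) else f i)"

text \<open>PEs that the verdict has not reached yet forward their own value all the same, since
  exchanges have to match; it is overwritten later. Left edges are served before right ones, so a
  value may descend two levels in one round.\<close>

primrec verdict_after :: "nat \<Rightarrow> nat \<Rightarrow> nat" where
  "verdict_after 0 = v"
| "verdict_after (Suc r) = down_right (down_left (verdict_after r))"

text \<open>In round r + 1 a PE of depth at most r + 1 hears from a parent that holds
  \<open>V\<close> after r rounds; a PE that already holds \<open>V\<close> hears only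
  \<open>V\<close>.\<close>

lemma verdict_after_root:
  assumes "\<And>i. i \<in> {1..p} \<Longrightarrow> tree_depth p i = 0 \<Longrightarrow> v i = V"
  shows "i \<in> {1..p} \<Longrightarrow> tree_depth p i \<le> r \<Longrightarrow> verdict_after r i = V"
proof (induction r arbitrary: i)
  case (Suc r)
  have l: "down_left (verdict_after r) j = V"
    if "j \<in> {1..p}" "tree_depth p j \<le> r \<or> (tree_depth p j \<le> Suc r \<and> lparent p j \<noteq> 0)" for j
    using that Suc.IH[of j] Suc.IH[OF lparent(1), of j] lparent(3)[of j p] by (auto simp: down_left_def)
  show ?case
  proof (cases "rparent p i = 0")
    case True
    then have "tree_depth p i \<le> r \<or> (tree_depth p i \<le> Suc r \<and> lparent p i \<noteq> 0)"
      using Suc.prems tree_depth_pos[of i p] by (cases "tree_depth p i = 0") auto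
    then show ?thesis using True l[OF Suc.prems(1)] by (simp add: down_right_def)
  next
    case False
    then show ?thesis using l[OF rparent(1)[OF Suc.prems(1) False]] rparent(3)[OF Suc.prems(1) False] Suc.prems
      by (simp add: down_right_def)
  qed
qed (use assms in simp)

text \<open>Verdicts have to stay below 2 to be sent as messages of one bit.\<close>

lemma verdict_after_le:
  assumes "\<And>i. i \<in> {1..p} \<Longrightarrow> v i \<le> 1"
  shows "i \<in> {1..p} \<Longrightarrow> verdict_after r i \<le> 1"
proof (induction r arbitrary: i)
  case (Suc r)
  have "down_left (verdict_after r) j \<le> 1" if "j \<in> {1..p}" for j
    using that Suc.IH[of j] Suc.IH[OF lparent(1), of j] unfolding down_left_def by presburger
  then show ?case
    using Suc.prems rparent(1)[of i p] unfolding verdict_after.simps down_right_def by presburger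
qed (use assms in simp)

lemma broadcast_correct:
  assumes v: "\<And>i. i \<in> {1..p} \<Longrightarrow> v i \<le> 1"
    and V: "\<And>i. i \<in> {1..p} \<Longrightarrow> tree_depth p i = 0 \<Longrightarrow> v i = V"
  shows "xtriple p \<alpha> \<beta> E (\<lambda>i s. net i s \<and> s ''verdict'' = v i \<and> s ''cnt'' = D) broadcast
    (real D * (2 * (\<alpha> + \<beta>) + real (2 * step_words + 1)) + 1) (\<lambda>i s. s ''verdict'' = V)"
proof -
  define I where "I r i s \<longleftrightarrow> net i s \<and> s ''cnt'' = D - r \<and> s ''verdict'' = verdict_after r i" for r i s
  define J where "J r i s \<longleftrightarrow> net i s \<and> s ''cnt'' = D - r \<and> s ''verdict'' = down_left (verdict_after r) i" for r i s
  define K where "K r i s \<longleftrightarrow> net i s \<and> s ''cnt'' = D - r \<and> s ''verdict'' = verdict_after (Suc r) i" for r i s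
  have le: "verdict_after r i < 2 ^ 1" if "i \<in> {1..p}" for r i
    using verdict_after_le[OF v that, of r] by simp
  have le': "down_left (verdict_after r) i < 2 ^ 1" if "i \<in> {1..p}" for r i
    using le[OF that, of r] le[OF lparent(1)[OF that], of r] by (simp add: down_left_def)
  have 1: "xtriple p \<alpha> \<beta> E (I r) (Exchange ''sl'' ''one'' ''verdict'' ''dl'' ''verdict'') (\<alpha> + \<beta> * real 1) (J r)" for r
  proof (rule xtriple_mono[OF xtriple_Exchange[where d = "lchild p" and e = "lparent p"
          and m = "verdict_after r" and l = 1 and P = "I r"]])
    fix i s assume "\<exists>s0. I r i s0 \<and>
       s = (if lparent p i \<noteq> 0 then s0(''verdict'' := verdict_after r (lparent p i)) else s0)"
    then show "J r i s" by (auto simp: I_def J_def net_def down_left_def)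
  next
    fix i s assume "i \<in> {1..p}" "I r i s"
    then show "s ''sl'' = lchild p i \<and> s ''dl'' = lparent p i \<and> s ''verdict'' = verdict_after r i \<and>
      s ''one'' = 1 \<and> (lchild p i \<noteq> 0 \<longrightarrow> verdict_after r i < 2 ^ 1)"
      using le by (simp add: I_def net_def)
  qed (use p \<beta> lparent lchild in auto)
  have 2: "xtriple p \<alpha> \<beta> E (J r) (Exchange ''sr'' ''one'' ''verdict'' ''dr'' ''verdict'') (\<alpha> + \<beta> * real 1) (K r)" for r
  proof (rule xtriple_mono[OF xtriple_Exchange[where d = "rchild p" and e = "rparent p"
          and m = "down_left (verdict_after r)" and l = 1 and P = "J r"]])
    fix i s assume "\<exists>s0. J r i s0 \<and>
       s = (if rparent p i \<noteq> 0 then s0(''verdict'' := down_left (verdict_after r) (rparent p i)) else s0)"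
    then show "K r i s" by (auto simp: K_def J_def net_def down_right_def)
  next
    fix i s assume "i \<in> {1..p}" "J r i s"
    then show "s ''sr'' = rchild p i \<and> s ''dr'' = rparent p i \<and> s ''verdict'' = down_left (verdict_after r) i \<and>
      s ''one'' = 1 \<and> (rchild p i \<noteq> 0 \<longrightarrow> down_left (verdict_after r) i < 2 ^ 1)"
      using le' by (simp add: J_def net_def)
  qed (use p \<beta> rparent rchild in auto)
  have 3: "xtriple p \<alpha> \<beta> E (K r) (Local (block [Sub ''cnt'' ''cnt'' ''one''])) (real (2 * step_words)) (I (Suc r))" for r
  proof (rule xtriple_Local[OF p])
    fix i s assume i: "i \<in> {1..p}" and K: "K r i s"
    have "D - r < 2 ^ (c + 2 * D + 4)"
      using less_exp[of "D - r"] by (rule order_less_le_trans) (simp add: power_increasing)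
    from words_le[OF this, of w] have "words w (D - r) + 1 \<le> 2 * step_words" by (simp add: step_words_def)
    then show "lwp (E i) (block [Sub ''cnt'' ''cnt'' ''one'']) (\<lambda>t s'. t \<le> 2 * step_words \<and> I (Suc r) i s') s"
      using K E[OF i] unfolding block.simps by (intro lwp_Instr) (simp add: K_def I_def net_def)
  qed
  have "xtriple p \<alpha> \<beta> E (I 0) broadcast
      (real D * ((2 * (\<alpha> + \<beta>) + real (2 * step_words)) + 1) + 1) (I D)"
    unfolding broadcast_def
  proof (rule xtriple_While[where I = I])
    fix r
    show "xtriple p \<alpha> \<beta> E (I r) (Seq (Exchange ''sl'' ''one'' ''verdict'' ''dl'' ''verdict'')
     (Seq (Exchange ''sr'' ''one'' ''verdict'' ''dr'' ''verdict'') (Local (block [Sub ''cnt'' ''cnt'' ''one'']))))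
      (2 * (\<alpha> + \<beta>) + real (2 * step_words)) (I (Suc r))"
      by (rule xtriple_mono[OF xtriple_Seq[OF 1 xtriple_Seq[OF 2 3]]]) auto
  qed (auto simp: I_def)
  then show ?thesis
    by (rule xtriple_mono)
      (use verdict_after_root[OF V] tree_bounds(5) in \<open>auto simp: I_def D algebra_simps\<close>)
qed

end

end

section \<open>Sortedness along the tree\<close>

text \<open>The intervals to the left and to the right of a node may be empty and are then not nodes
  themselves; therefore the rule has a case for empty intervals and concludes for both sides as
  well.\<close>

lemma tree_induct:
  assumes empty: "\<And>lo hi. hi \<le> lo \<Longrightarrow> P lo hi"
    and node: "\<And>i. i \<in> {1..p} \<Longrightarrow> P (tree_lo p i) i \<Longrightarrow> P (Suc i) (tree_hi p i) \<Longrightarrow>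
      P (tree_lo p i) (tree_hi p i)"
  shows "p \<ge> 1 \<Longrightarrow> P 1 (Suc p)" and "i \<in> {1..p} \<Longrightarrow> P (tree_lo p i) i"
    and "i \<in> {1..p} \<Longrightarrow> P (Suc i) (tree_hi p i)"
proof -
  have *: "P lo hi" if "tree_node p lo hi par side dep" for lo hi par side dep
    using that
  proof (induction "hi - lo" arbitrary: lo hi par side dep rule: less_induct)
    case less
    let ?m = "(lo + hi) div 2"
    note bd = tree_node_bounds[OF less.prems]
    note eq = tree_node_eq(1,2)[OF less.prems refl]
    have m: "?m \<in> {1..p}" using bd by auto
    have "P lo ?m"
    proof (cases "lo < ?m")
      case True
      show ?thesis by (rule less.hyps[OF _ tree_node.left[OF less.prems True]]) (use True bd in auto)
    qed (use empty in auto)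
    moreover have "P (Suc ?m) hi"
    proof (cases "Suc ?m < hi")
      case True
      show ?thesis by (rule less.hyps[OF _ tree_node.right[OF less.prems True]]) (use True bd in auto)
    qed (use empty in auto)
    ultimately show ?case using node[OF m] eq by simp
  qed
  show "p \<ge> 1 \<Longrightarrow> P 1 (Suc p)" using *[OF tree_node.root] .
  show "P (tree_lo p i) i" if i: "i \<in> {1..p}"
  proof (cases "tree_lo p i < i")
    case True
    show ?thesis using *[OF tree_node.left[OF tree_node_of(1)[OF i]]] True tree_node_of(2)[OF i] by simp
  qed (use empty in auto)
  show "P (Suc i) (tree_hi p i)" if i: "i \<in> {1..p}"
  proof (cases "Suc i < tree_hi p i")
    case True
    show ?thesis using *[OF tree_node.right[OF tree_node_of(1)[OF i]]] True tree_node_of(2)[OF i] by simp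
  qed (use empty in auto)
qed

text \<open>The default 0 is neutral in tree sums and is also what \<open>ReadAsserted\<close>
  yields out of range.\<close>

definition hd0 :: "nat list \<Rightarrow> nat" where "hd0 xs = (if xs = [] then 0 else hd xs)"
definition last0 :: "nat list \<Rightarrow> nat" where "last0 xs = (if xs = [] then 0 else last xs)"

lemma hd0_append: "hd0 (xs @ ys) = (if xs = [] then hd0 ys else hd0 xs)"
  by (simp add: hd0_def)
lemma last0_append: "last0 (xs @ ys) = (if ys = [] then last0 xs else last0 ys)"
  by (simp add: last0_def)

definition joins :: "(nat \<times> nat) set \<Rightarrow> nat list \<Rightarrow> nat list \<Rightarrow> bool" where
  "joins r xs ys \<longleftrightarrow> xs = [] \<or> ys = [] \<or> (last0 xs, hd0 ys) \<in> r"

abbreviation sorted_by :: "(nat \<times> nat) set \<Rightarrow> nat list \<Rightarrow> bool" where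
  "sorted_by r \<equiv> sorted_wrt (\<lambda>x y. (x, y) \<in> r)"

text \<open>Only the pair at the boundary has to be compared: transitivity leads from
  \<open>xs\<close> through \<open>last xs\<close> and \<open>hd ys\<close> to \<open>ys\<close>,
  and reflexivity covers these two elements themselves.\<close>

lemma sorted_by_append:
  assumes r: "trans r" "refl_on A r" "set xs \<subseteq> A" "set ys \<subseteq> A"
  shows "sorted_by r (xs @ ys) \<longleftrightarrow> sorted_by r xs \<and> sorted_by r ys \<and> joins r xs ys"
proof (cases "xs = [] \<or> ys = []")
  case True
  then show ?thesis by (auto simp: joins_def)
next
  case False
  have l: "(x, last xs) \<in> r" if "sorted_by r xs" "x \<in> set xs" for x
  proof -
    have xs: "butlast xs @ [last xs] = xs" using False by simp
    have "sorted_by r (butlast xs @ [last xs])" using that xs by simp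
    then have "\<forall>x\<in>set (butlast xs). (x, last xs) \<in> r" by (simp add: sorted_wrt_append)
    moreover have "x \<in> set (butlast xs) \<or> x = last xs" using that(2) xs
      by (metis UnE set_append singletonD list.set(1,2))
    moreover have "(last xs, last xs) \<in> r" using r False by (metis last_in_set refl_onD subsetD)
    ultimately show ?thesis by blast
  qed
  have h: "(hd ys, y) \<in> r" if "sorted_by r ys" "y \<in> set ys" for y
    using that False r by (cases ys) (auto simp: refl_on_def)
  have "joins r xs ys \<longleftrightarrow> (last xs, hd ys) \<in> r" using False by (auto simp: joins_def hd0_def last0_def)
  moreover have "(x, y) \<in> r" if "sorted_by r xs" "sorted_by r ys" "(last xs, hd ys) \<in> r" "x \<in> set xs" "y \<in> set ys" for x y
    using l[OF that(1,4)] h[OF that(2,5)] that(3) r(1) by (meson transD)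
  moreover have "last xs \<in> set xs" "hd ys \<in> set ys" using False by auto
  ultimately show ?thesis unfolding sorted_wrt_append by blast
qed

section \<open>Contiguous parts of the distributed sequence\<close>

definition part :: "(nat \<Rightarrow> nat list) \<Rightarrow> nat \<Rightarrow> nat \<Rightarrow> nat list" where
  "part Y lo hi = concat (map Y [lo..<hi])"

lemma part_empty [simp]: "hi \<le> lo \<Longrightarrow> part Y lo hi = []"
  by (simp add: part_def)

lemma part_split: "lo \<le> i \<Longrightarrow> i < hi \<Longrightarrow> part Y lo hi = part Y lo i @ Y i @ part Y (Suc i) hi"
proof -
  assume "lo \<le> i" "i < hi"
  then have "[lo..<hi] = [lo..<i] @ i # [Suc i..<hi]"
    by (metis le_Suc_ex less_imp_le_nat upt_add_eq_append upt_conv_Cons)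
  then show ?thesis by (simp add: part_def)
qed

lemma part_tree: "i \<in> {1..p} \<Longrightarrow> part Y (tree_lo p i) (tree_hi p i) =
    part Y (tree_lo p i) i @ Y i @ part Y (Suc i) (tree_hi p i)"
  using part_split tree_bounds by blast

lemma whole_eq_part: "whole p Y = part Y 1 (Suc p)"
  by (simp add: whole_def part_def)

lemma length_part: "length (part Y lo hi) = (\<Sum>i\<in>{lo..<hi}. length (Y i))"
  by (simp add: part_def length_concat comp_def sum_list_distinct_conv_sum_set)

lemma set_part: "1 \<le> lo \<Longrightarrow> hi \<le> Suc p \<Longrightarrow> set (part Y lo hi) \<subseteq> set (whole p Y)"
  unfolding whole_eq_part part_def set_concat set_map set_upt by (intro Union_mono image_mono) auto

lemma length_part_le: "1 \<le> lo \<Longrightarrow> hi \<le> Suc p \<Longrightarrow> length (part Y lo hi) \<le> length (whole p Y)"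
  unfolding whole_eq_part length_part by (intro sum_mono2) auto

lemma length_le_whole: "i \<in> {1..p} \<Longrightarrow> length (Y i) \<le> length (whole p Y)"
  using length_part_le[of i "Suc i" p Y] by (simp add: part_def)

lemma set_le_whole: "i \<in> {1..p} \<Longrightarrow> set (Y i) \<subseteq> set (whole p Y)"
  using set_part[of i "Suc i" p Y] by (simp add: part_def)

definition left_part :: "nat \<Rightarrow> (nat \<Rightarrow> nat list) \<Rightarrow> nat \<Rightarrow> nat list" where
  "left_part p Y i = part Y (tree_lo p i) i"
definition right_part :: "nat \<Rightarrow> (nat \<Rightarrow> nat list) \<Rightarrow> nat \<Rightarrow> nat list" where
  "right_part p Y i = part Y (Suc i) (tree_hi p i)"

text \<open>At most one of the three terms of a node is nonzero. The factor for the left child can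
  be 1 throughout because an empty left part contributes 0 anyway. The other factors depend only on
  lengths that the PE knows after the first stream.\<close>

lemma tree_sum_hd0:
  fixes Y :: "nat \<Rightarrow> nat list"
  assumes "i \<in> {1..p}"
  defines "f \<equiv> tree_sum (\<lambda>i. hd0 (Y i) * of_bool (left_part p Y i = [])) (\<lambda>i. 1)
      (\<lambda>i. of_bool (left_part p Y i = [] \<and> Y i = []))"
  shows "f (Suc i) (tree_hi p i) = hd0 (right_part p Y i)"
  unfolding right_part_def
proof (rule tree_induct(3)[where P = "\<lambda>lo hi. f lo hi = hd0 (part Y lo hi)", OF _ _ assms(1)])
  fix i assume i: "i \<in> {1..p}" and "f (tree_lo p i) i = hd0 (part Y (tree_lo p i) i)"
    "f (Suc i) (tree_hi p i) = hd0 (part Y (Suc i) (tree_hi p i))"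
  then show "f (tree_lo p i) (tree_hi p i) = hd0 (part Y (tree_lo p i) (tree_hi p i))"
    using tree_sum_node[OF i, of "\<lambda>i. hd0 (Y i) * of_bool (left_part p Y i = [])" "\<lambda>i. 1"
      "\<lambda>i. of_bool (left_part p Y i = [] \<and> Y i = [])"]
    unfolding f_def part_tree[OF i] hd0_append
    by (auto simp: left_part_def) (auto simp: hd0_def)
qed (simp_all add: f_def hd0_def)

lemma tree_sum_last0:
  fixes Y :: "nat \<Rightarrow> nat list"
  assumes "i \<in> {1..p}"
  defines "f \<equiv> tree_sum (\<lambda>i. last0 (Y i) * of_bool (right_part p Y i = []))
      (\<lambda>i. of_bool (right_part p Y i = [] \<and> Y i = [])) (\<lambda>i. 1)"
  shows "f (tree_lo p i) i = last0 (left_part p Y i)"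
  unfolding left_part_def
proof (rule tree_induct(2)[where P = "\<lambda>lo hi. f lo hi = last0 (part Y lo hi)", OF _ _ assms(1)])
  fix i assume i: "i \<in> {1..p}" and "f (tree_lo p i) i = last0 (part Y (tree_lo p i) i)"
    "f (Suc i) (tree_hi p i) = last0 (part Y (Suc i) (tree_hi p i))"
  then show "f (tree_lo p i) (tree_hi p i) = last0 (part Y (tree_lo p i) (tree_hi p i))"
    using tree_sum_node[OF i, of "\<lambda>i. last0 (Y i) * of_bool (right_part p Y i = [])"
      "\<lambda>i. of_bool (right_part p Y i = [] \<and> Y i = [])" "\<lambda>i. 1"]
    unfolding f_def part_tree[OF i] last0_append
    by (auto simp: right_part_def) (auto simp: last0_def)
qed (simp_all add: f_def last0_def)

text \<open>Joining the left part with \<open>Y i @ right_part p Y i\<close> also covers an empty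
  \<open>Y i\<close>, where the left and the right part meet directly.\<close>

definition locally_sorted :: "nat \<Rightarrow> (nat \<times> nat) set \<Rightarrow> (nat \<Rightarrow> nat list) \<Rightarrow> nat \<Rightarrow> bool" where
  "locally_sorted p r Y i \<longleftrightarrow> sorted_by r (Y i) \<and> joins r (left_part p Y i) (Y i @ right_part p Y i) \<and>
     joins r (Y i) (right_part p Y i)"

text \<open>In the induction over subtrees, the condition at a node is precisely what two uses of
  \<open>sorted_by_append\<close> add to the sortedness of both sides.\<close>

lemma sorted_whole_iff:
  assumes "p \<ge> 1" "trans r" "refl_on A r" "set (whole p Y) \<subseteq> A"
  shows "sorted_by r (whole p Y) \<longleftrightarrow> (\<forall>i\<in>{1..p}. locally_sorted p r Y i)"
proof -
  have "sorted_by r (part Y 1 (Suc p)) \<longleftrightarrow> (\<forall>i\<in>{1..<Suc p}. locally_sorted p r Y i)"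
  proof (rule tree_induct(1)[where P = "\<lambda>lo hi. sorted_by r (part Y lo hi) \<longleftrightarrow>
      (\<forall>i\<in>{lo..<hi}. locally_sorted p r Y i)", OF _ _ assms(1)])
    fix i assume i: "i \<in> {1..p}"
      and IH: "sorted_by r (part Y (tree_lo p i) i) \<longleftrightarrow> (\<forall>j\<in>{tree_lo p i..<i}. locally_sorted p r Y j)"
        "sorted_by r (part Y (Suc i) (tree_hi p i)) \<longleftrightarrow> (\<forall>j\<in>{Suc i..<tree_hi p i}. locally_sorted p r Y j)"
    note bd = tree_bounds[OF i]
    have sub: "set (part Y (tree_lo p i) i) \<subseteq> A" "set (part Y (Suc i) (tree_hi p i)) \<subseteq> A" "set (Y i) \<subseteq> A"
      using set_part[of "tree_lo p i" i p Y] set_part[of "Suc i" "tree_hi p i" p Y] set_le_whole[OF i, of Y]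
        bd i assms(4) by auto
    have "{tree_lo p i..<tree_hi p i} = {tree_lo p i..<i} \<union> {i} \<union> {Suc i..<tree_hi p i}" using bd by auto
    then show "sorted_by r (part Y (tree_lo p i) (tree_hi p i)) \<longleftrightarrow>
        (\<forall>j\<in>{tree_lo p i..<tree_hi p i}. locally_sorted p r Y j)"
      unfolding part_tree[OF i] using sub
      by (simp add: sorted_by_append[OF assms(2,3)] IH locally_sorted_def[of p r Y i] left_part_def right_part_def)
        blast
  qed simp_all
  then show ?thesis by (simp add: whole_eq_part atLeastLessThanSuc_atLeastAtMost)
qed

section \<open>Local work\<close>

text \<open>Repeated halving. One halving precedes the loop, so that the number of iterations is the
  rounded-down logarithm, and 0 for the value 0.\<close>

definition flog :: "vname \<Rightarrow> vname \<Rightarrow> lcmd" where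
  "flog d v = LSeq (block [Copy ''t'' v, Div ''t'' ''t'' ''two''])
     (LWhile ''t'' (block [Add d d ''one'', Div ''t'' ''t'' ''two'']))"

lemma words_pos: "1 \<le> words w v"
  by (simp add: words_def)

lemma floor_log_le: "floor_log n \<le> n"
proof (cases "n = 0")
  case False
  then have "2 ^ floor_log n \<le> n" by (intro floor_log_exp2_le) simp
  then show ?thesis by (rule order_trans[OF less_imp_le[OF less_exp]])
qed simp

lemma flog_correct:
  assumes w: "wsize E = w" "w \<ge> 1" and s: "s d = 0" "s ''one'' = 1" "s ''two'' = 2"
    and d: "d \<noteq> ''t''" "d \<noteq> ''one''" "d \<noteq> ''two''"
  shows "lwp E (flog d v) (\<lambda>t s'. t \<le> 9 * (floor_log (s v) + 1) * words w (s v) \<and> s' d = floor_log (s v)) s"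
proof -
  define N where "N = s v"
  define u where "u = words w N"
  \<comment> \<open>The number of iterations left; its sum with the counter \<open>d\<close> is
    invariant and equals the result.\<close>
  define V :: "store \<Rightarrow> nat" where "V s' = (if s' ''t'' = 0 then 0 else floor_log (s' ''t'') + 1)" for s'
  define I where "I s' \<longleftrightarrow> s' d + V s' = floor_log N \<and> s' ''t'' \<le> N \<and> s' ''one'' = 1 \<and> s' ''two'' = 2" for s'
  have w2: "words w 2 \<le> 2" using words_2 w by simp
  have u1: "1 \<le> u" unfolding u_def by (rule words_pos)
  have wu: "words w a \<le> u" if "a \<le> N" for a using words_mono[OF that] by (simp add: u_def)
  have mul: "words w a * words w 2 \<le> 2 * u" if "a \<le> N" for a
    using mult_le_mono[OF wu[OF that] w2] by simp
  have fN: "floor_log N \<le> N" by (rule floor_log_le)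
  have step: "lwp E (block [Add d d ''one'', Div ''t'' ''t'' ''two'']) (\<lambda>t s''. t \<le> 5 * u \<and> I s'' \<and> V s'' < V s') s'"
    if I: "I s'" and nz: "s' ''t'' \<noteq> 0" for s'
  proof -
    have "words w (s' d) \<le> u" using I fN by (intro wu) (simp add: I_def)
    moreover have "words w (s' ''t'') * words w 2 \<le> 2 * u" using I by (intro mul) (simp add: I_def)
    moreover have "floor_log (s' ''t'') = Suc (floor_log (s' ''t'' div 2))" if "s' ''t'' div 2 \<noteq> 0"
      using that by (intro floor_log_rec) auto
    moreover have "floor_log (s' ''t'') = 0" if "s' ''t'' div 2 = 0"
    proof -
      have "s' ''t'' = 1" using that nz by linarith
      then show ?thesis by simp
    qed
    ultimately show ?thesis
      unfolding block.simps
      apply (intro lwp_LSeq lwp_Instr)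
      using I nz d u1 w by (auto simp: I_def V_def simp del: floor_log_half)
  qed
  have "lwp E (block [Copy ''t'' v, Div ''t'' ''t'' ''two'']) (\<lambda>t s'. t \<le> 3 * u \<and> I s' \<and> V s' \<le> floor_log N) s"
  proof -
    have "floor_log N = Suc (floor_log (N div 2))" if "N div 2 \<noteq> 0"
      using that by (intro floor_log_rec) auto
    moreover have "floor_log N = 0" if "N div 2 = 0"
      using that by (cases "N = 0"; cases "N = 1") auto
    ultimately show ?thesis
      unfolding block.simps
      apply (intro lwp_LSeq lwp_Instr)
      using d s wu[of N] mul[of N] w by (auto simp: I_def V_def N_def[symmetric] simp del: floor_log_half)
  qed
  moreover have "lwp E (LWhile ''t'' (block [Add d d ''one'', Div ''t'' ''t'' ''two'']))
      (\<lambda>t s''. t \<le> V s' * (5 * u + u) + u \<and> I s'' \<and> s'' ''t'' = 0) s'" if "I s'" for s'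
    by (rule lwp_LWhile[OF step]) (use that wu w in \<open>auto simp: I_def\<close>)
  ultimately have "lwp E (flog d v) (\<lambda>t s'. t \<le> 3 * u + (floor_log N * (5 * u + u) + u) \<and> I s' \<and> s' ''t'' = 0) s"
    unfolding flog_def
    apply (intro lwp_LSeq)
    apply (erule lwp_mono)
    apply (rule lwp_mono, blast)
    subgoal for t s' t' s''
      apply (elim conjE)
      apply (frule mult_le_mono1[of "V s'" _ "5 * u + u"])
      apply (intro conjI; (assumption | linarith))
      done
    done
  then show ?thesis
    by (rule lwp_mono) (auto simp: I_def V_def N_def u_def algebra_simps)
qed

text \<open>\<open>t\<close> is nonzero iff the middle differs from the rank, and \<open>u\<close>
  tells whether to go left.\<close>

definition locate_test :: "instr list" where
  "locate_test = [Add ''mid'' ''lo'' ''hi'', Div ''mid'' ''mid'' ''two'', Less ''t'' ''mid'' ''rank'',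
     Less ''u'' ''rank'' ''mid'', Add ''t'' ''t'' ''u'']"

definition locate_step :: lcmd where
  "locate_step = LSeq (LIf ''u'' (block [Copy ''hi'' ''mid'', Copy ''side'' ''one''])
       (block [Add ''lo'' ''mid'' ''one'', Copy ''side'' ''two'']))
     (block ([Copy ''par'' ''mid'', Add ''dep'' ''dep'' ''one''] @ locate_test))"

definition locate :: lcmd where
  "locate = LSeq (block ([Copy ''lo'' ''one'', Add ''hi'' ''p'' ''one''] @ locate_test))
     (LWhile ''t'' locate_step)"

text \<open>The current interval is always a tree node containing \<open>i\<close>, so
  \<open>tree_node_eq\<close> identifies the final values. The sums of interval bounds are at most 2
  * p + 2, hence the 4 * p.\<close>

lemma locate_correct:
  fixes s :: store
  assumes w: "wsize E = w" "w \<ge> 1" and i: "i \<in> {1..p}"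
    and s: "s ''one'' = 1" "s ''two'' = 2" "s ''rank'' = i" "s ''p'' = p" "s ''par'' = 0" "s ''side'' = 0"
      "s ''dep'' = 0"
  shows "lwp E locate (\<lambda>t s'. t \<le> 50 * (floor_log p + 1) * words w (4 * p) \<and>
    s' ''lo'' = tree_lo p i \<and> s' ''hi'' = tree_hi p i \<and> s' ''par'' = tree_par p i \<and>
    s' ''side'' = tree_side p i \<and> s' ''dep'' = tree_depth p i) s"
proof -
  define u where "u = words w (4 * p)"
  define I where "I s' \<longleftrightarrow> tree_node p (s' ''lo'') (s' ''hi'') (s' ''par'') (s' ''side'') (s' ''dep'') \<and>
    s' ''lo'' \<le> i \<and> i < s' ''hi'' \<and> s' ''mid'' = (s' ''lo'' + s' ''hi'') div 2 \<and>
    s' ''u'' = of_bool (i < s' ''mid'') \<and> s' ''t'' = of_bool (s' ''mid'' < i) + of_bool (i < s' ''mid'') \<and>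
    s' ''one'' = 1 \<and> s' ''two'' = 2 \<and> s' ''rank'' = i" for s'
  define V :: "store \<Rightarrow> nat" where "V s' = floor_log (s' ''hi'' - s' ''lo'')" for s'
  have w2: "words w 2 \<le> 2" using words_2 w by simp
  have u1: "1 \<le> u" unfolding u_def by (rule words_pos)
  have wu: "words w a \<le> u" if "a \<le> 4 * p" for a using words_mono[OF that] by (simp add: u_def)
  have mul: "words w a * words w 2 \<le> 2 * u" if "a \<le> 4 * p" for a
    using mult_le_mono[OF wu[OF that] w2] by simp
  have p: "p \<ge> 1" using i by simp
  have step: "lwp E locate_step (\<lambda>t s''. t \<le> 30 * u \<and> I s'' \<and> V s'' < V s') s'"
    if I: "I s'" and nz: "s' ''t'' \<noteq> 0" for s'
  proof -
    define lo hi m dep where "lo = s' ''lo''" and "hi = s' ''hi''" and "m = (lo + hi) div 2" and "dep = s' ''dep''"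
    have n: "tree_node p lo hi (s' ''par'') (s' ''side'') dep" and lo: "lo \<le> i" and hi: "i < hi"
      and v: "s' ''lo'' = lo" "s' ''hi'' = hi" "s' ''mid'' = m" "s' ''dep'' = dep"
        "s' ''u'' = of_bool (i < m)" "s' ''one'' = 1" "s' ''two'' = 2" "s' ''rank'' = i"
      using I unfolding I_def lo_def hi_def m_def dep_def by auto
    have ne: "i < m \<or> m < i" using I nz by (auto simp: I_def m_def lo_def hi_def of_bool_def split: if_splits)
    note bd = tree_node_bounds[OF n]
    have dp: "dep \<le> p"
      using bd floor_log_le[of p] by simp
    have mb: "lo \<le> m" "m < hi" "m \<le> p" using bd by (auto simp: m_def)
    show ?thesis
    proof (cases "i < m")
      case True
      have n': "tree_node p lo m m 1 (Suc dep)" using tree_node.left[OF n] True lo by (simp add: m_def)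
      have V: "floor_log (m - lo) < floor_log (hi - lo)"
        using True lo by (intro floor_log_half_interval) (auto simp: m_def)
      define q where "q = (lo + m) div 2"
      have ws: "words w m \<le> u" "words w dep \<le> u" "words w lo \<le> u" "words w i \<le> u" "words w q \<le> u"
        "words w (lo + m) * words w 2 \<le> 2 * u"
        using mb bd i dp unfolding q_def by (intro wu mul; force)+
      show ?thesis
        unfolding locate_step_def locate_test_def append.simps block.simps
        apply (rule lwp_LSeq, rule lwp_LIf)
         apply (rule lwp_LSeq lwp_Instr)+
        using True n' V ws u1 lo mb w2 w
        by (simp_all add: v q_def[symmetric] I_def V_def)
    next
      case False
      then have mi: "m < i" using ne by simp
      have n': "tree_node p (Suc m) hi m 2 (Suc dep)" using tree_node.right[OF n] mi hi by (simp add: m_def)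
      have V: "floor_log (hi - Suc m) < floor_log (hi - lo)"
        using mi hi by (intro floor_log_half_interval) (auto simp: m_def)
      define q where "q = (Suc (m + hi)) div 2"
      have ws: "words w m \<le> u" "words w dep \<le> u" "words w (Suc m) \<le> u" "words w hi \<le> u" "words w i \<le> u" "words w q \<le> u"
        "words w (Suc (m + hi)) * words w 2 \<le> 2 * u"
        using mb bd i dp p unfolding q_def by (intro wu mul; force)+
      show ?thesis
        unfolding locate_step_def locate_test_def append.simps block.simps
        apply (rule lwp_LSeq, rule lwp_LIf)
         prefer 2
         apply (rule lwp_LSeq lwp_Instr)+
        using False mi n' V ws u1 hi mb w2 w
        by (simp_all add: v q_def[symmetric] I_def V_def)
    qed
  qed
  have init: "lwp E (block ([Copy ''lo'' ''one'', Add ''hi'' ''p'' ''one''] @ locate_test))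
    (\<lambda>t s'. t \<le> 15 * u \<and> I s' \<and> V s' = floor_log p) s"
  proof -
    define q where "q = Suc (p div 2)"
    have ws: "words w p \<le> u" "words w (Suc p) \<le> u" "words w i \<le> u" "words w q \<le> u"
        "words w (Suc (Suc p)) * words w 2 \<le> 2 * u"
      using i p unfolding q_def by (intro wu mul; force)+
    show ?thesis
      unfolding locate_test_def append.simps block.simps
      apply (rule lwp_LSeq lwp_Instr)+
      using ws u1 w2 w i tree_node.root[OF p]
      by (simp add: s q_def[symmetric] I_def V_def)
  qed
  have loop: "lwp E (LWhile ''t'' locate_step) (\<lambda>t s''. t \<le> V s' * (30 * u + u) + u \<and> I s'' \<and> s'' ''t'' = 0) s'"
    if "I s'" for s'
  proof (rule lwp_LWhile[OF step _ that])
    fix s'' assume "I s''"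
    then have "s'' ''t'' \<le> 1" by (auto simp: I_def of_bool_def)
    then show "words (wsize E) (s'' ''t'') \<le> u" using wu[of "s'' ''t''"] p w by simp
  qed
  have "lwp E locate (\<lambda>t s'. t \<le> 15 * u + (floor_log p * (31 * u) + u) \<and> I s' \<and> s' ''t'' = 0) s"
    unfolding locate_def
    apply (rule lwp_LSeq)
    apply (rule lwp_mono[OF init])
    subgoal for t s'
      by (rule lwp_mono[OF loop[of s']]) auto
    done
  then show ?thesis
  proof (rule lwp_mono, elim conjE)
    fix t s' assume t: "t \<le> 15 * u + (floor_log p * (31 * u) + u)" and I: "I s'" and "s' ''t'' = 0"
    then have "i = (s' ''lo'' + s' ''hi'') div 2" by (auto simp: I_def of_bool_def split: if_splits)
    moreover have "tree_node p (s' ''lo'') (s' ''hi'') (s' ''par'') (s' ''side'') (s' ''dep'')"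
      using I by (simp add: I_def)
    ultimately have "tree_lo p i = s' ''lo''" "tree_hi p i = s' ''hi''" "tree_par p i = s' ''par''"
      "tree_side p i = s' ''side''" "tree_depth p i = s' ''dep''" by (rule tree_node_eq[rotated])+
    moreover have "t \<le> 50 * (floor_log p + 1) * words w (4 * p)" using t by (simp add: u_def algebra_simps)
    ultimately show "t \<le> 50 * (floor_log p + 1) * words w (4 * p) \<and>
    s' ''lo'' = tree_lo p i \<and> s' ''hi'' = tree_hi p i \<and> s' ''par'' = tree_par p i \<and>
    s' ''side'' = tree_side p i \<and> s' ''dep'' = tree_depth p i" by simp
  qed
qed

text \<open>Absent links become 0 through multiplication by a truth value. The test
  \<open>side < 2\<close> also succeeds at the root, but there \<open>par\<close> is 0.\<close>

definition set_links :: lcmd where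
  "set_links = block [
     Less ''t'' ''lo'' ''rank'', Add ''u'' ''lo'' ''rank'', Div ''u'' ''u'' ''two'', Mul ''sl'' ''t'' ''u'',
     Add ''u'' ''rank'' ''one'', Less ''t'' ''u'' ''hi'', Add ''u'' ''u'' ''hi'', Div ''u'' ''u'' ''two'',
     Mul ''sr'' ''t'' ''u'',
     Less ''t'' ''side'' ''two'', Mul ''dl'' ''t'' ''par'', Less ''t'' ''one'' ''side'', Mul ''dr'' ''t'' ''par'']"

lemma tree_side_cases:
  assumes "i \<in> {1..p}"
  shows "tree_side p i = 0 \<and> tree_par p i = 0 \<or> tree_side p i = 1 \<or> tree_side p i = 2" "tree_par p i \<le> p"
proof -
  show "tree_side p i = 0 \<and> tree_par p i = 0 \<or> tree_side p i = 1 \<or> tree_side p i = 2"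
    using tree_node_of(1)[OF assms] by cases auto
  then show "tree_par p i \<le> p"
    using lparent(1)[OF assms] rparent(1)[OF assms]
    by (cases "tree_par p i = 0") (auto simp: lparent_def rparent_def)
qed

lemma set_links_correct:
  fixes s :: store
  assumes w: "wsize E = w" "w \<ge> 1" and i: "i \<in> {1..p}"
    and s: "s ''one'' = 1" "s ''two'' = 2" "s ''rank'' = i"
      "s ''lo'' = tree_lo p i" "s ''hi'' = tree_hi p i" "s ''par'' = tree_par p i"
      "s ''side'' = tree_side p i"
  shows "lwp E set_links (\<lambda>t s'. t \<le> 40 * words w (4 * p) \<and>
    s' ''sl'' = lchild p i \<and> s' ''sr'' = rchild p i \<and> s' ''dl'' = lparent p i \<and> s' ''dr'' = rparent p i) s"
proof -
  define u where "u = words w (4 * p)"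
  define lo hi par side where "lo = tree_lo p i" and "hi = tree_hi p i" and "par = tree_par p i" and "side = tree_side p i"
  define q1 q2 where "q1 = (lo + i) div 2" and "q2 = Suc (i + hi) div 2"
  have w2: "words w 2 \<le> 2" using words_2 w by simp
  have u1: "1 \<le> u" unfolding u_def by (rule words_pos)
  have wu: "words w a \<le> u" if "a \<le> 4 * p" for a using words_mono[OF that] by (simp add: u_def)
  have mul: "words w a * words w 2 \<le> 2 * u" if "a \<le> 4 * p" for a
    using mult_le_mono[OF wu[OF that] w2] by simp
  have bd: "1 \<le> lo" "lo \<le> i" "i < hi" "hi \<le> Suc p" "1 \<le> i" "i \<le> p" "par \<le> p"
    using tree_bounds[OF i] tree_side_cases[OF i] i by (auto simp: lo_def hi_def par_def)
  have side: "side \<le> 2" "side = 0 \<Longrightarrow> par = 0" using tree_side_cases(1)[OF i] by (auto simp: side_def par_def)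
  have q: "q1 \<le> 4 * p" "lo + i \<le> 4 * p" "q2 \<le> 4 * p" "Suc (i + hi) \<le> 4 * p" "Suc i \<le> 4 * p"
    "lo \<le> 4 * p" "hi \<le> 4 * p" "i \<le> 4 * p" "par \<le> 4 * p" "2 \<le> 4 * p" "side \<le> 4 * p"
    using bd side by (auto simp: q1_def q2_def)
  note ws = q[THEN wu] mul[OF q(2)] mul[OF q(4)]
  have l: "lchild p i = of_bool (lo < i) * q1" "rchild p i = of_bool (Suc i < hi) * q2"
    "lparent p i = of_bool (side < 2) * par" "rparent p i = of_bool (Suc 0 < side) * par"
    using tree_side_cases(1)[OF i]
    by (auto simp: lchild_def rchild_def lparent_def rparent_def q1_def q2_def lo_def hi_def par_def side_def)
  show ?thesis
    unfolding set_links_def block.simps u_def[symmetric] l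
    apply (rule lwp_LSeq lwp_Instr)+
    using ws u1 w2 w
    by (simp add: s lo_def[symmetric] hi_def[symmetric] par_def[symmetric] side_def[symmetric] q1_def[symmetric] q2_def[symmetric])
qed

text \<open>The first two summands hold the sum of \<open>n\<close> hash values, the next
  \<open>floor_log p + 1\<close> bits leave room for up to \<open>p\<close> violations above it, and
  \<open>k * w\<close> bits hold an element. One width serves all four streams.\<close>

definition total_bits :: "nat \<Rightarrow> nat \<Rightarrow> nat \<Rightarrow> nat \<Rightarrow> nat \<Rightarrow> nat" where
  "total_bits p n w k b = b + (floor_log n + 1) + floor_log p + 1 + k * w"

text \<open>Rounding up gives B \<le> c * (D + 1), while c * (D + 1) \<le> B + D + 1 keeps the
  communication volume in O(B).\<close>

definition chunk_bits :: "nat \<Rightarrow> nat \<Rightarrow> nat \<Rightarrow> nat \<Rightarrow> nat \<Rightarrow> nat" where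
  "chunk_bits p n w k b = total_bits p n w k b div (floor_log p + 1) + 1"

definition set_sizes :: lcmd where
  "set_sizes = block [
     Add ''ln'' ''ln'' ''one'', Add ''Q'' ''accuracy'' ''ln'', Mul ''t'' ''k'' ''w'', Add ''B'' ''Q'' ''D'',
     Add ''B'' ''B'' ''one'', Add ''B'' ''B'' ''t'', Add ''u'' ''D'' ''one'', Div ''c'' ''B'' ''u'',
     Add ''c'' ''c'' ''one'', Sub ''t'' ''D'' ''dep'', Mul ''sh'' ''c'' ''t'']"

text \<open>Multiplication and division cost the product of the operand sizes; the product of two
  word counts in the bound comes from computing \<open>c\<close> and \<open>sh\<close>.\<close>

lemma set_sizes_correct:
  fixes s :: store
  assumes w: "wsize E = w" "w \<ge> 1" "k \<ge> 1"
    and s: "s ''one'' = 1" "s ''ln'' = floor_log n" "s ''accuracy'' = b" "s ''k'' = k" "s ''w'' = w"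
      "s ''D'' = floor_log p" and dep: "s ''dep'' \<le> floor_log p"
  shows "lwp E set_sizes (\<lambda>t s'. t \<le> 30 * words w (total_bits p n w k b + 1) * words w (floor_log p + 1) \<and>
    s' ''Q'' = b + (floor_log n + 1) \<and> s' ''B'' = total_bits p n w k b \<and> s' ''c'' = chunk_bits p n w k b \<and>
    s' ''sh'' = chunk_bits p n w k b * (floor_log p - s ''dep'')) s"
proof -
  define B D L c where "B = total_bits p n w k b" and "D = floor_log p" and "L = floor_log n" and "c = B div Suc D"
  define u d where "u = words w (B + 1)" and "d = words w (Suc D)"
  have wu: "words w a \<le> u" if "a \<le> B + 1" for a using words_mono[OF that] by (simp add: u_def)
  have wd: "words w a \<le> d" if "a \<le> Suc D" for a using words_mono[OF that] by (simp add: d_def)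
  have u1: "1 \<le> u" unfolding u_def by (rule words_pos)
  have d1: "1 \<le> d" unfolding d_def by (rule words_pos)
  have ud: "u \<le> u * d" using d1 by simp
  have kw: "k \<le> k * w" "w \<le> k * w" using w by auto
  have B: "B = b + Suc L + D + 1 + k * w" by (simp add: B_def total_bits_def D_def L_def)
  have cB: "c \<le> B" unfolding c_def by (rule div_le_dividend)
  have q: "L \<le> B + 1" "b \<le> B + 1" "Suc L \<le> B + 1" "b + Suc L \<le> B + 1" "k * w \<le> B + 1" "D \<le> B + 1"
    "b + Suc L + D \<le> B + 1" "b + Suc L + D + 1 \<le> B + 1" "c \<le> B + 1" "s ''dep'' \<le> B + 1"
    using cB kw dep by (auto simp: B D_def)
  note ws = q[THEN wu]
  define z where "z = u * d"
  have zz: "30 * words w (Suc B) * d = 30 * z" by (simp add: z_def u_def)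
  have m1: "words w k * words w w \<le> u"
  proof -
    \<comment> \<open>The word size itself fits in one word, so multiplying it by \<open>k\<close>
      costs no more than reading \<open>k\<close>.\<close>
    have "floor_log w < w" using w by (intro order_less_le_trans[OF less_exp] floor_log_exp2_le) simp
    then have "words w w = 1" by (simp add: words_def)
    moreover have "k \<le> B + 1" using kw(1) B by linarith
    ultimately show ?thesis using wu[of k] by simp
  qed
  have m2: "words w B * words w (Suc D) \<le> z" unfolding z_def by (intro mult_le_mono wu) (simp_all add: d_def)
  have m3: "words w (Suc c) * words w (D - s ''dep'') \<le> z"
    unfolding z_def using cB by (intro mult_le_mono wu wd) auto
  have q2: "chunk_bits p n w k b = Suc c" by (simp add: chunk_bits_def c_def B_def D_def)
  have B': "b + Suc L + D + Suc 0 + k * w = B" by (simp add: B)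
  show ?thesis
    unfolding set_sizes_def block.simps q2 B_def[symmetric] D_def[symmetric] L_def[symmetric]
    unfolding Suc_eq_plus1[symmetric] d_def[symmetric] zz
    apply (rule lwp_LSeq lwp_Instr)+
    using ws m1 m2 m3 ud[folded z_def] u1 w
    by (simp add: s D_def[symmetric] L_def[symmetric] B'[simplified] c_def[symmetric])
qed

definition hash_input :: lcmd where
  "hash_input = LSeq (block [Copy ''i'' ''zero'', Less ''t'' ''i'' ''input_length''])
     (LWhile ''t'' (block [ReadInput ''e'' ''i'', Hash ''e'' ''e'', Add ''sa'' ''sa'' ''e'', Add ''i'' ''i'' ''one'',
        Less ''t'' ''i'' ''input_length'']))"

lemma sum_list_hash_le:
  assumes "\<forall>x\<in>set xs. h x < 2 ^ b"
  shows "sum_list (map h xs) \<le> length xs * 2 ^ b"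
  using assms by (induction xs) auto

lemma sum_list_hash_less:
  fixes h :: "'a \<Rightarrow> nat"
  assumes "set xs \<subseteq> X" "\<And>x. x \<in> X \<Longrightarrow> h x < 2 ^ b" "length xs < 2 ^ L"
  shows "sum_list (map h xs) < 2 ^ (b + L)"
proof -
  have "sum_list (map h xs) \<le> length xs * 2 ^ b" using assms by (intro sum_list_hash_le) blast
  also have "\<dots> < 2 ^ L * 2 ^ b" using assms(3) by simp
  finally show ?thesis by (simp add: power_add mult.commute)
qed

text \<open>All partial sums stay below 2 ^ (b + L), which bounds the cost of every addition by the
  same number of words.\<close>

lemma hash_input_correct:
  fixes s :: store
  assumes w: "wsize E = w" "w \<ge> 1" and k: "esize E = k" and b: "hbits E = b"
    and el: "set (input E) \<subseteq> elems w k" and h: "\<And>x. x \<in> elems w k \<Longrightarrow> hash E x < 2 ^ b"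
    and n: "length (input E) < 2 ^ L" and m: "b + L + k * w \<le> m"
    and s: "s ''zero'' = 0" "s ''one'' = 1" "s ''sa'' = 0" "s ''input_length'' = length (input E)"
  shows "lwp E hash_input (\<lambda>t s'. t \<le> (length (input E) + 1) * (15 * (1 + m div w) + 2 * k) \<and>
    s' ''sa'' = sum_list (map (hash E) (input E))) s"
proof -
  define u xs N where "u = 1 + m div w" and "xs = input E" and "N = length xs"
  define body where "body = block [ReadInput ''e'' ''i'', Hash ''e'' ''e'', Add ''sa'' ''sa'' ''e'', Add ''i'' ''i'' ''one'',
        Less ''t'' ''i'' ''input_length'']"
  define I where "I s' \<longleftrightarrow> s' ''i'' \<le> N \<and> s' ''sa'' = sum_list (map (hash E) (take (s' ''i'') xs)) \<and>
    s' ''t'' = of_bool (s' ''i'' < N) \<and> s' ''one'' = 1 \<and> s' ''input_length'' = N" for s'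
  have W: "words w v \<le> u" if "v < 2 ^ j" "j \<le> m" for v j
    unfolding u_def using that by (rule words_le_mono)
  have u1: "1 \<le> u" "b div w < u" using m by (auto simp: u_def less_Suc_eq_le intro!: div_le_mono)
  have wn: "words w a \<le> u" if "a \<le> N" for a
    using n m that by (intro W[of _ L]) (auto simp: N_def xs_def)
  have sums: "words w (sum_list (map (hash E) (take a xs))) \<le> u" for a
  proof (rule W[OF sum_list_hash_less[OF _ h]])
    show "set (take a xs) \<subseteq> elems w k" using el set_take_subset[of a xs] by (simp add: xs_def)
    show "length (take a xs) < 2 ^ L" using n by (simp add: xs_def)
  qed (use m in simp_all)
  have step: "lwp E body (\<lambda>t s''. t \<le> 10 * u + 2 * k \<and> I s'' \<and> N - s'' ''i'' < N - s' ''i'') s'"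
    if I: "I s'" and nz: "s' ''t'' \<noteq> 0" for s'
  proof -
    define a where "a = s' ''i''"
    have a: "a < N" "s' ''i'' = a" using I nz by (auto simp: I_def a_def)
    then have a': "a < length xs" by (simp add: N_def)
    define e where "e = xs ! a"
    have e: "e \<in> elems w k" using el a' by (auto simp: e_def xs_def)
    have tk: "sum_list (map (hash E) (take (Suc a) xs)) = sum_list (map (hash E) (take a xs)) + hash E e"
      using a' by (simp add: take_Suc_conv_app_nth e_def)
    have ws: "words w a \<le> u" "words w (Suc a) \<le> u" "words w N \<le> u" using a by (intro wn; simp)+
    have we: "words w e \<le> u" using e m by (intro W[of _ "k * w"]) (auto simp: elems_def)
    have wh: "words w (hash E e) \<le> u" using h[OF e] m by (intro W[of _ b]) auto
    show ?thesis
      unfolding body_def block.simps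
      apply (rule lwp_LSeq lwp_Instr)+
      using I a ws we wh sums[of a] u1 w k b e
      by (simp add: I_def xs_def[symmetric] N_def[symmetric] e_def[symmetric] tk)
  qed
  have loop: "lwp E (LWhile ''t'' body) (\<lambda>t s''. t \<le> (N - s' ''i'') * ((10 * u + 2 * k) + u) + u \<and> I s'' \<and> s'' ''t'' = 0) s'"
    if "I s'" for s'
  proof (rule lwp_LWhile[OF step _ that])
    fix s'' assume "I s''"
    then show "words (wsize E) (s'' ''t'') \<le> u" using u1 by (simp add: I_def)
  qed
  have init: "lwp E (block [Copy ''i'' ''zero'', Less ''t'' ''i'' ''input_length'']) (\<lambda>t s'. t \<le> 4 * u \<and> I s' \<and> s' ''i'' = 0) s"
    unfolding block.simps
    apply (rule lwp_LSeq lwp_Instr)+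
    using s wn[of N] u1 w by (simp add: I_def xs_def[symmetric] N_def[symmetric])
  have "lwp E hash_input (\<lambda>t s'. t \<le> 4 * u + (N * ((10 * u + 2 * k) + u) + u) \<and> I s' \<and> s' ''t'' = 0) s"
    unfolding hash_input_def body_def[symmetric]
    apply (rule lwp_LSeq)
    apply (rule lwp_mono[OF init])
    subgoal for t s' by (rule lwp_mono[OF loop[of s']]) auto
    done
  then show ?thesis
    unfolding xs_def[symmetric] N_def[symmetric] u_def[symmetric]
    by (rule lwp_mono) (auto simp: I_def N_def algebra_simps)
qed

text \<open>\<open>prev\<close> starts as the first element, so the first comparison is between an
  element and itself. If the part is empty, both boundary reads are out of range and give 0.\<close>

definition hash_asserted :: lcmd where
  "hash_asserted = LSeq (block [Copy ''i'' ''zero'', ReadAsserted ''first'' ''zero'', Sub ''t'' ''asserted_length'' ''one'',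
       ReadAsserted ''last'' ''t'', Copy ''ok'' ''one'', Copy ''prev'' ''first'', Less ''t'' ''i'' ''asserted_length''])
     (LWhile ''t'' (block [ReadAsserted ''e'' ''i'', LeqElem ''u'' ''prev'' ''e'', Mul ''ok'' ''ok'' ''u'', Copy ''prev'' ''e'',
        Hash ''e'' ''e'', Add ''sb'' ''sb'' ''e'', Add ''i'' ''i'' ''one'', Less ''t'' ''i'' ''asserted_length'']))"

lemma hash_asserted_correct:
  fixes s :: store
  assumes w: "wsize E = w" "w \<ge> 1" and k: "esize E = k" and b: "hbits E = b"
    and el: "set (asserted E) \<subseteq> elems w k" and h: "\<And>x. x \<in> elems w k \<Longrightarrow> hash E x < 2 ^ b"
    and r: "trans (ord E)" "refl_on (elems w k) (ord E)"
    and n: "length (asserted E) < 2 ^ L" and m: "b + L + k * w \<le> m"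
    and s: "s ''zero'' = 0" "s ''one'' = 1" "s ''sb'' = 0" "s ''asserted_length'' = length (asserted E)"
  shows "lwp E hash_asserted (\<lambda>t s'. t \<le> (length (asserted E) + 1) * (30 * (1 + m div w) + 5 * k) \<and>
    s' ''sb'' = sum_list (map (hash E) (asserted E)) \<and> s' ''first'' = hd0 (asserted E) \<and>
    s' ''last'' = last0 (asserted E) \<and> s' ''ok'' = of_bool (sorted_by (ord E) (asserted E))) s"
proof -
  define u xs N where "u = 1 + m div w" and "xs = asserted E" and "N = length xs"
  define body where "body = block [ReadAsserted ''e'' ''i'', LeqElem ''u'' ''prev'' ''e'', Mul ''ok'' ''ok'' ''u'', Copy ''prev'' ''e'',
        Hash ''e'' ''e'', Add ''sb'' ''sb'' ''e'', Add ''i'' ''i'' ''one'', Less ''t'' ''i'' ''asserted_length'']"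
  \<comment> \<open>Truncated subtraction makes this the first element for a = 0, in accordance with
    the initial value of the variable.\<close>
  define prev where "prev a = xs ! (a - 1)" for a
  define I where "I s' \<longleftrightarrow> s' ''i'' \<le> N \<and> s' ''sb'' = sum_list (map (hash E) (take (s' ''i'') xs)) \<and>
    s' ''ok'' = of_bool (sorted_by (ord E) (take (s' ''i'') xs)) \<and> (N \<noteq> 0 \<longrightarrow> s' ''prev'' = prev (s' ''i'')) \<and>
    s' ''first'' = hd0 xs \<and> s' ''last'' = last0 xs \<and>
    s' ''t'' = of_bool (s' ''i'' < N) \<and> s' ''one'' = 1 \<and> s' ''asserted_length'' = N" for s'
  have W: "words w v \<le> u" if "v < 2 ^ j" "j \<le> m" for v j
    unfolding u_def using that by (rule words_le_mono)
  have u1: "1 \<le> u" "b div w < u" using m by (auto simp: u_def less_Suc_eq_le intro!: div_le_mono)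
  have wn: "words w a \<le> u" if "a \<le> N" for a
    using n m that by (intro W[of _ L]) (auto simp: N_def xs_def)
  have we: "words w e \<le> u" if "e \<in> elems w k" for e
    using that m by (intro W[of _ "k * w"]) (auto simp: elems_def)
  have sums: "words w (sum_list (map (hash E) (take a xs))) \<le> u" for a
  proof (rule W[OF sum_list_hash_less[OF _ h]])
    show "set (take a xs) \<subseteq> elems w k" using el set_take_subset[of a xs] by (simp add: xs_def)
    show "length (take a xs) < 2 ^ L" using n by (simp add: xs_def)
  qed (use m in simp_all)
  have step: "lwp E body (\<lambda>t s''. t \<le> 20 * u + 5 * k \<and> I s'' \<and> N - s'' ''i'' < N - s' ''i'') s'"
    if I: "I s'" and nz: "s' ''t'' \<noteq> 0" for s'
  proof -
    define a where "a = s' ''i''"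
    have a: "a < N" "s' ''i'' = a" using I nz by (auto simp: I_def a_def)
    then have a': "a < length xs" by (simp add: N_def)
    define e where "e = xs ! a"
    define ok where "ok \<longleftrightarrow> sorted_by (ord E) (take a xs)"
    have e: "e \<in> elems w k" using el a' by (auto simp: e_def xs_def)
    have pe: "prev a \<in> elems w k" using el a' by (auto simp: prev_def xs_def)
    have tk: "sum_list (map (hash E) (take (Suc a) xs)) = sum_list (map (hash E) (take a xs)) + hash E e"
      using a' by (simp add: take_Suc_conv_app_nth e_def)
    have so: "sorted_by (ord E) (take (Suc a) xs) \<longleftrightarrow> ok \<and> (prev a, e) \<in> ord E"
    proof -
      have "set (take a xs) \<subseteq> elems w k" "set [e] \<subseteq> elems w k"
        using el e by (auto simp: xs_def dest: in_set_takeD)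
      then have "sorted_by (ord E) (take a xs @ [e]) \<longleftrightarrow> ok \<and> joins (ord E) (take a xs) [e]"
        using sorted_by_append[OF r, of "take a xs" "[e]"] by (simp add: ok_def)
      moreover have "joins (ord E) (take a xs) [e] \<longleftrightarrow> (prev a, e) \<in> ord E"
      proof (cases "a = 0")
        case True
        then show ?thesis using r(2) e by (simp add: joins_def prev_def e_def refl_on_def)
      next
        case False
        then have ne: "take a xs \<noteq> []" using a' by auto
        then have "last (take a xs) = xs ! (a - 1)" using False a' by (simp add: last_conv_nth min_def)
        then show ?thesis using ne by (simp add: joins_def prev_def hd0_def last0_def)
      qed
      ultimately show ?thesis using a' by (simp add: take_Suc_conv_app_nth e_def)
    qed
    have ws: "words w a \<le> u" "words w (Suc a) \<le> u" "words w N \<le> u" using a by (intro wn; simp)+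
    have wh: "words w (hash E e) \<le> u" using h[OF e] m by (intro W[of _ b]) auto
    have v: "s' ''ok'' = of_bool ok" "s' ''prev'' = prev a" "s' ''asserted_length'' = N" "s' ''one'' = 1"
      "s' ''sb'' = sum_list (map (hash E) (take a xs))" "s' ''first'' = hd0 xs" "s' ''last'' = last0 xs"
      using I a by (auto simp: I_def ok_def)
    have pS: "prev (Suc a) = e" by (simp add: prev_def e_def)
    show ?thesis
      unfolding body_def block.simps
      apply (rule lwp_LSeq lwp_Instr)+
      using a ws we[OF e] we[OF pe] wh sums[of a] u1 w k b e diff_less_mono2[OF lessI a(1)]
      by (simp add: v I_def xs_def[symmetric] N_def[symmetric] e_def[symmetric] tk so pS)
  qed
  have loop: "lwp E (LWhile ''t'' body) (\<lambda>t s''. t \<le> (N - s' ''i'') * ((20 * u + 5 * k) + u) + u \<and> I s'' \<and> s'' ''t'' = 0) s'"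
    if "I s'" for s'
  proof (rule lwp_LWhile[OF step _ that])
    fix s'' assume "I s''"
    then show "words (wsize E) (s'' ''t'') \<le> u" using u1 by (simp add: I_def)
  qed
  have fl: "N \<noteq> 0 \<Longrightarrow> xs ! 0 = hd0 xs" "N \<noteq> 0 \<Longrightarrow> xs ! (N - Suc 0) = last0 xs"
    "N = 0 \<Longrightarrow> hd0 xs = 0" "N = 0 \<Longrightarrow> last0 xs = 0"
    by (auto simp: hd0_def last0_def hd_conv_nth last_conv_nth N_def)
  have wf: "words w (hd0 xs) \<le> u"
  proof (cases "xs = []")
    case False
    then have "hd xs \<in> elems w k" using subsetD[OF el[folded xs_def] hd_in_set] by simp
    then show ?thesis using we False by (simp add: hd0_def)
  qed (use u1 in \<open>simp add: hd0_def\<close>)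
  have p0: "N \<noteq> 0 \<longrightarrow> hd0 xs = prev 0" by (auto simp: prev_def hd0_def hd_conv_nth N_def)
  have init: "lwp E (block [Copy ''i'' ''zero'', ReadAsserted ''first'' ''zero'', Sub ''t'' ''asserted_length'' ''one'',
       ReadAsserted ''last'' ''t'', Copy ''ok'' ''one'', Copy ''prev'' ''first'', Less ''t'' ''i'' ''asserted_length''])
     (\<lambda>t s'. t \<le> 9 * u + 2 * k \<and> I s' \<and> s' ''i'' = 0) s"
    unfolding block.simps
    apply (rule lwp_LSeq lwp_Instr)+
    using s wn[of N] wn[of "N - 1"] u1 w k wf p0 fl
    by (cases "N = 0") (simp_all add: I_def xs_def[symmetric] N_def[symmetric])
  have "lwp E hash_asserted (\<lambda>t s'. t \<le> (9 * u + 2 * k) + (N * ((20 * u + 5 * k) + u) + u) \<and> I s' \<and> s' ''t'' = 0) s"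
    unfolding hash_asserted_def body_def[symmetric]
    apply (rule lwp_LSeq)
    apply (rule lwp_mono[OF init])
    subgoal for t s' by (rule lwp_mono[OF loop[of s']]) auto
    done
  then show ?thesis
    unfolding xs_def[symmetric] N_def[symmetric] u_def[symmetric]
    by (rule lwp_mono) (auto simp: I_def N_def algebra_simps)
qed

section \<open>The checker\<close>

definition prepare :: lcmd where
  "prepare = LSeq (block [Const ''one'' 1, Const ''two'' 2]) (LSeq (flog ''D'' ''p'') (LSeq (flog ''ln'' ''n'')
     (LSeq locate (LSeq set_links (LSeq set_sizes (LSeq hash_input hash_asserted))))))"

definition count_parts :: lcmd where
  "count_parts = block [Copy ''x'' ''asserted_length'', Copy ''ml'' ''one'', Copy ''mr'' ''one'']"

text \<open>
  A subtree's first element comes from the left child if anything is stored there (\<open>cl\<close> is positive),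
  else from the PE itself, else from the right child; reading from an empty part yields 0.
\<close>

definition find_first :: lcmd where
  "find_first = block [Copy ''cl'' ''zl'', Copy ''cr'' ''zr'', Add ''t'' ''cl'' ''asserted_length'', Less ''mr'' ''t'' ''one'',
     Less ''t'' ''cl'' ''one'', Mul ''x'' ''first'' ''t'']"

text \<open>The mirror image of \<open>find_first\<close>. \<open>fr\<close> saves the first element
  of the right part before the next stream overwrites \<open>zr\<close>.\<close>

definition find_last :: lcmd where
  "find_last = block [Copy ''fr'' ''zr'', Copy ''mr'' ''one'', Add ''t'' ''cr'' ''asserted_length'', Less ''ml'' ''t'' ''one'',
     Less ''t'' ''cr'' ''one'', Mul ''x'' ''last'' ''t'']"

text \<open>Adding \<open>fr\<close>, masked by emptiness of the own part, to \<open>first\<close>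
  gives the head of own and right part together, because \<open>first\<close> is 0 for an empty
  part. The comparison and two emptiness tests are added up: a positive sum is the disjunction in
  \<open>joins\<close>.\<close>

definition check_left :: lcmd where
  "check_left = block [Less ''t'' ''asserted_length'' ''one'', Mul ''t'' ''fr'' ''t'', Add ''u'' ''first'' ''t'',
     LeqElem ''u'' ''zl'' ''u'', Less ''t'' ''cl'' ''one'', Add ''u'' ''u'' ''t'', Add ''t'' ''asserted_length'' ''cr'',
     Less ''t'' ''t'' ''one'', Add ''u'' ''u'' ''t'', Less ''u'' ''zero'' ''u'', Mul ''ok'' ''ok'' ''u'']"

definition check_right :: lcmd where
  "check_right = block [LeqElem ''u'' ''last'' ''fr'', Less ''t'' ''asserted_length'' ''one'', Add ''u'' ''u'' ''t'',
     Less ''t'' ''cr'' ''one'', Add ''u'' ''u'' ''t'', Less ''u'' ''zero'' ''u'', Mul ''ok'' ''ok'' ''u'']"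

text \<open>
  Adding \<open>2 ^ B\<close> keeps the difference of the hash sums nonnegative and is invisible modulo \<open>2 ^ B\<close>.
  All differences together are below \<open>2 ^ Q\<close>, so they cannot cancel the \<open>2 ^ Q\<close> of a violation.
\<close>

definition combine :: lcmd where
  "combine = block [Less ''u'' ''ok'' ''one'', Copy ''t'' ''zero'', Deposit ''t'' ''u'' ''Q'' ''one'',
     Copy ''x'' ''zero'', Deposit ''x'' ''one'' ''B'' ''one'', Add ''x'' ''x'' ''sa'', Sub ''x'' ''x'' ''sb'', Add ''x'' ''x'' ''t'',
     Copy ''ml'' ''one'', Copy ''mr'' ''one'']"

text \<open>Every PE judges its own subtree. Only the root's verdict concerns everything, and the
  broadcast overwrites the others.\<close>

definition decide :: lcmd where
  "decide = block [Less ''verdict'' ''zy'' ''one'', Copy ''cnt'' ''D'']"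

definition checker :: prog where
  "checker = Seq (Local prepare) (Seq (Local count_parts) (Seq stream (Seq (Local find_first) (Seq stream
     (Seq (Local find_last) (Seq stream (Seq (Local (LSeq check_left (LSeq check_right combine))) (Seq stream
     (Seq (Local decide) broadcast)))))))))"

lemma lwp_obtain:
  assumes "lwp E c Q s"
  obtains t s' where "lexec E c s t s'" "Q t s'" "\<forall>v. v \<notin> lwrites c \<longrightarrow> s' v = s v"
  using lwp_frame[OF assms] unfolding lwp_def by blast

lemma less_power_Suc_floor_log: "n < 2 ^ (floor_log n + 1)"
  using floor_log_exp2_gt[of n] by simp

text \<open>\<open>l\<close> is any bound on the part lengths: correctness takes the trivial
  \<open>n\<close>, the time bound takes the value that balance provides.\<close>

locale sort_run =
  fixes p n w k b l :: nat and r :: "(nat \<times> nat) set" and A Y :: "nat \<Rightarrow> nat list" and h :: "nat \<Rightarrow> nat"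
    and \<alpha> \<beta> :: real
  assumes inst: "sort_instance p n w k r A Y" and h: "h \<in> hash_funs w k b" and \<beta>0: "\<beta> \<ge> 0"
    and l: "\<And>i. i \<in> {1..p} \<Longrightarrow> length (A i) \<le> l \<and> length (Y i) \<le> l"
begin

abbreviation "DD \<equiv> floor_log p"
abbreviation "BB \<equiv> total_bits p n w k b"
abbreviation "CC \<equiv> chunk_bits p n w k b"
abbreviation "EE \<equiv> sort_env w k b r h A Y"

lemma pos: "p \<ge> 1" "w \<ge> 1" "k \<ge> 1"
  using inst by (auto simp: sort_instance_def)

lemma order: "trans r" "refl_on (elems w k) r"
  using inst by (auto simp: sort_instance_def linear_order_on_def partial_order_on_def preorder_on_def)

lemma env [simp]: "wsize (EE i) = w" "esize (EE i) = k" "hbits (EE i) = b" "ord (EE i) = r" "hash (EE i) = h"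
  "input (EE i) = A i" "asserted (EE i) = Y i"
  by (simp_all add: sort_env_def)

lemma BB_le: "BB \<le> CC * (DD + 1)"
proof -
  have "BB mod (DD + 1) \<le> DD + 1" by (simp add: less_imp_le)
  then show ?thesis
    using div_mult_mod_eq[of BB "DD + 1"] by (simp only: chunk_bits_def distrib_right mult_1)
qed

sublocale pipeline p DD CC BB w \<alpha> \<beta> EE
  by unfold_locales (use pos BB_le \<beta>0 in auto)

lemma hash_less: "x \<in> elems w k \<Longrightarrow> h x < 2 ^ b"
  using h by (auto simp: hash_funs_def PiE_iff)

lemma elems_sub: "i \<in> {1..p} \<Longrightarrow> set (A i) \<subseteq> elems w k" "i \<in> {1..p} \<Longrightarrow> set (Y i) \<subseteq> elems w k"
  using inst set_le_whole[of i p A] set_le_whole[of i p Y] by (auto simp: sort_instance_def)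

lemma lengths: "i \<in> {1..p} \<Longrightarrow> length (A i) < 2 ^ (floor_log n + 1)" "i \<in> {1..p} \<Longrightarrow> length (Y i) < 2 ^ (floor_log n + 1)"
  using inst length_le_whole[of i p A] length_le_whole[of i p Y] less_power_Suc_floor_log[of n]
  by (auto simp: sort_instance_def)

definition sumA :: "nat \<Rightarrow> nat" where "sumA i = sum_list (map h (A i))"
definition sumY :: "nat \<Rightarrow> nat" where "sumY i = sum_list (map h (Y i))"

definition basev :: "nat \<Rightarrow> store \<Rightarrow> bool" where
  "basev i s \<longleftrightarrow> s ''asserted_length'' = length (Y i) \<and> s ''first'' = hd0 (Y i) \<and> s ''last'' = last0 (Y i) \<and>
     s ''sa'' = sumA i \<and> s ''sb'' = sumY i \<and> s ''ok'' = of_bool (sorted_by r (Y i)) \<and> s ''Q'' = b + (floor_log n + 1)"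

definition base :: "nat \<Rightarrow> store \<Rightarrow> bool" where
  "base i s \<longleftrightarrow> net i s \<and> basev i s"

text \<open>100 covers 9 + 50 + 40 from \<open>flog\<close> on \<open>p\<close>,
  \<open>locate\<close> and \<open>set_links\<close>; 45 = 15 + 30 and 7 = 2 + 5 come from the two
  hashing loops.\<close>

definition prepare_time :: nat where
  "prepare_time = 5 + 100 * ((DD + 1) * step_words) + 9 * (floor_log n + 1) * words w n + 30 * (all_words * words w (DD + 1))
     + (l + 1) * (45 * all_words + 7 * k)"

text \<open>The eight commands are followed forward through the stores \<open>s0\<close> to
  \<open>s8\<close>. The variables \<open>zero\<close>, \<open>par\<close>, \<open>side\<close>,
  \<open>dep\<close>, \<open>sa\<close>, \<open>sb\<close>, \<open>D\<close> and \<open>ln\<close>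
  are not set beforehand: they are 0 in the initial store.\<close>

lemma prepare_correct:
  assumes i: "i \<in> {1..p}"
  shows "lwp (EE i) prepare (\<lambda>t s. t \<le> prepare_time \<and> base i s) (init_store p n w k b A Y i)"
proof -
  let ?E = "EE i"
  define s0 where "s0 = init_store p n w k b A Y i"
  note s0 = s0_def[unfolded init_store_def]
  have "lwp ?E (block [Const ''one'' 1, Const ''two'' 2]) (\<lambda>t s. t \<le> 5 \<and> s ''one'' = 1 \<and> s ''two'' = 2) s0"
    unfolding block.simps
    apply (rule lwp_LSeq lwp_Instr)+
    using words_2[of w] pos by simp
  then obtain t1 s1 where e1: "lexec ?E (block [Const ''one'' 1, Const ''two'' 2]) s0 t1 s1"
    and 1: "t1 \<le> 5" "s1 ''one'' = 1" "s1 ''two'' = 2"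
    and f1: "\<forall>v. v \<notin> lwrites (block [Const ''one'' 1, Const ''two'' 2]) \<longrightarrow> s1 v = s0 v"
    by (auto elim: lwp_obtain)
  have f1': "s1 v = s0 v" if "v \<notin> {''one'', ''two''}" for v using f1 that by simp
  note v1 = 1(2,3) f1'[of "''D''"] f1'[of "''p''"] f1'[of "''ln''"] f1'[of "''n''"]
  have "lwp ?E (flog ''D'' ''p'') (\<lambda>t s. t \<le> 9 * (floor_log (s1 ''p'') + 1) * words w (s1 ''p'') \<and> s ''D'' = floor_log (s1 ''p'')) s1"
    by (rule flog_correct) (use v1 pos in \<open>simp_all add: s0\<close>)
  then obtain t2 s2 where e2: "lexec ?E (flog ''D'' ''p'') s1 t2 s2"
    and 2: "t2 \<le> 9 * (floor_log (s1 ''p'') + 1) * words w (s1 ''p'')" "s2 ''D'' = floor_log (s1 ''p'')"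
    and f2: "\<forall>v. v \<notin> lwrites (flog ''D'' ''p'') \<longrightarrow> s2 v = s1 v"
    by (auto elim: lwp_obtain)
  have f2': "s2 v = s0 v" if "v \<notin> {''one'', ''two'', ''t'', ''D''}" for v using f1 f2 that by (simp add: flog_def)
  have p1: "s1 ''p'' = p" using v1 by (simp add: s0)
  have v2: "s2 ''one'' = 1" "s2 ''two'' = 2" using f2 v1 by (simp_all add: flog_def)
  have "lwp ?E (flog ''ln'' ''n'') (\<lambda>t s. t \<le> 9 * (floor_log (s2 ''n'') + 1) * words w (s2 ''n'') \<and> s ''ln'' = floor_log (s2 ''n'')) s2"
    by (rule flog_correct) (use v2 f2' pos in \<open>simp_all add: s0\<close>)
  then obtain t3 s3 where e3: "lexec ?E (flog ''ln'' ''n'') s2 t3 s3"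
    and 3: "t3 \<le> 9 * (floor_log (s2 ''n'') + 1) * words w (s2 ''n'')" "s3 ''ln'' = floor_log (s2 ''n'')"
    and f3: "\<forall>v. v \<notin> lwrites (flog ''ln'' ''n'') \<longrightarrow> s3 v = s2 v"
    by (auto elim: lwp_obtain)
  have f3': "s3 v = s0 v" if "v \<notin> {''one'', ''two'', ''t'', ''D'', ''ln''}" for v
    using f3 f2' that by (simp add: flog_def)
  have n2: "s2 ''n'' = n" using f2' by (simp add: s0)
  have v3: "s3 ''one'' = 1" "s3 ''two'' = 2" "s3 ''D'' = DD" "s3 ''ln'' = floor_log n"
    using f3 v2 2 3 by (simp_all add: flog_def p1 n2)
  have "lwp ?E locate (\<lambda>t s'. t \<le> 50 * (floor_log p + 1) * words w (4 * p) \<and>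
    s' ''lo'' = tree_lo p i \<and> s' ''hi'' = tree_hi p i \<and> s' ''par'' = tree_par p i \<and>
    s' ''side'' = tree_side p i \<and> s' ''dep'' = tree_depth p i) s3"
    by (rule locate_correct) (use v3 f3' pos i in \<open>simp_all add: s0\<close>)
  then obtain t4 s4 where e4: "lexec ?E locate s3 t4 s4"
    and 4: "t4 \<le> 50 * (floor_log p + 1) * words w (4 * p)"
      "s4 ''lo'' = tree_lo p i" "s4 ''hi'' = tree_hi p i" "s4 ''par'' = tree_par p i"
      "s4 ''side'' = tree_side p i" "s4 ''dep'' = tree_depth p i"
    and f4: "\<forall>v. v \<notin> lwrites locate \<longrightarrow> s4 v = s3 v"
    by (auto elim: lwp_obtain)
  have f4': "s4 v = s3 v" if "v \<notin> {''lo'', ''hi'', ''mid'', ''t'', ''u'', ''side'', ''par'', ''dep''}" for v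
    using f4 that by (simp add: locate_def locate_step_def locate_test_def)
  have v4: "s4 ''one'' = 1" "s4 ''two'' = 2" "s4 ''D'' = DD" "s4 ''ln'' = floor_log n" "s4 ''rank'' = i"
    "s4 ''k'' = k" "s4 ''w'' = w" "s4 ''accuracy'' = b" "s4 ''zero'' = 0" "s4 ''sa'' = 0" "s4 ''sb'' = 0"
    "s4 ''input_length'' = length (A i)" "s4 ''asserted_length'' = length (Y i)"
    using v3 by (simp_all add: f4' f3' s0)
  have "lwp ?E set_links (\<lambda>t s'. t \<le> 40 * words w (4 * p) \<and>
    s' ''sl'' = lchild p i \<and> s' ''sr'' = rchild p i \<and> s' ''dl'' = lparent p i \<and> s' ''dr'' = rparent p i) s4"
    by (rule set_links_correct) (use v4 4 pos i in simp_all)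
  then obtain t5 s5 where e5: "lexec ?E set_links s4 t5 s5"
    and 5: "t5 \<le> 40 * words w (4 * p)"
      "s5 ''sl'' = lchild p i" "s5 ''sr'' = rchild p i" "s5 ''dl'' = lparent p i" "s5 ''dr'' = rparent p i"
    and f5: "\<forall>v. v \<notin> lwrites set_links \<longrightarrow> s5 v = s4 v"
    by (auto elim: lwp_obtain)
  have f5': "s5 v = s4 v" if "v \<notin> {''sl'', ''sr'', ''dl'', ''dr'', ''t'', ''u''}" for v
    using f5 that by (simp add: set_links_def)
  have "lwp ?E set_sizes (\<lambda>t s'. t \<le> 30 * words w (BB + 1) * words w (floor_log p + 1) \<and>
    s' ''Q'' = b + (floor_log n + 1) \<and> s' ''B'' = BB \<and> s' ''c'' = CC \<and>
    s' ''sh'' = CC * (floor_log p - s5 ''dep'')) s5"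
    by (rule set_sizes_correct) (use v4 4 pos tree_bounds(5)[OF i] in \<open>simp_all add: f5'\<close>)
  then obtain t6 s6 where e6: "lexec ?E set_sizes s5 t6 s6"
    and 6: "t6 \<le> 30 * words w (BB + 1) * words w (floor_log p + 1)"
      "s6 ''Q'' = b + (floor_log n + 1)" "s6 ''B'' = BB" "s6 ''c'' = CC" "s6 ''sh'' = CC * (floor_log p - s5 ''dep'')"
    and f6: "\<forall>v. v \<notin> lwrites set_sizes \<longrightarrow> s6 v = s5 v"
    by (auto elim: lwp_obtain)
  have f6': "s6 v = s5 v" if "v \<notin> {''ln'', ''Q'', ''B'', ''c'', ''sh'', ''t'', ''u''}" for v
    using f6 that by (simp add: set_sizes_def)
  have v6: "s6 ''one'' = 1" "s6 ''zero'' = 0" "s6 ''sa'' = 0" "s6 ''sb'' = 0"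
    "s6 ''input_length'' = length (A i)" "s6 ''asserted_length'' = length (Y i)"
    using v4 by (simp_all add: f6' f5')
  have m: "b + (floor_log n + 1) + k * w \<le> BB" by (simp add: total_bits_def)
  have "lwp ?E hash_input (\<lambda>t s'. t \<le> (length (input ?E) + 1) * (15 * (1 + BB div w) + 2 * k) \<and>
    s' ''sa'' = sum_list (map (hash ?E) (input ?E))) s6"
    by (rule hash_input_correct[OF _ _ _ _ _ _ _ m]) (use v6 pos elems_sub[OF i] lengths[OF i] hash_less in simp_all)
  then obtain t7 s7 where e7: "lexec ?E hash_input s6 t7 s7"
    and 7: "t7 \<le> (length (A i) + 1) * (15 * (1 + BB div w) + 2 * k)" "s7 ''sa'' = sumA i"
    and f7: "\<forall>v. v \<notin> lwrites hash_input \<longrightarrow> s7 v = s6 v"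
    by (auto elim: lwp_obtain simp: sumA_def)
  have f7': "s7 v = s6 v" if "v \<notin> {''i'', ''t'', ''e'', ''sa''}" for v
    using f7 that by (simp add: hash_input_def)
  have "lwp ?E hash_asserted (\<lambda>t s'. t \<le> (length (asserted ?E) + 1) * (30 * (1 + BB div w) + 5 * k) \<and>
    s' ''sb'' = sum_list (map (hash ?E) (asserted ?E)) \<and> s' ''first'' = hd0 (asserted ?E) \<and>
    s' ''last'' = last0 (asserted ?E) \<and> s' ''ok'' = of_bool (sorted_by (ord ?E) (asserted ?E))) s7"
    by (rule hash_asserted_correct[OF _ _ _ _ _ _ _ _ _ m])
      (use v6 pos elems_sub[OF i] lengths[OF i] hash_less order in \<open>simp_all add: f7'\<close>)
  then obtain t8 s8 where e8: "lexec ?E hash_asserted s7 t8 s8"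
    and 8: "t8 \<le> (length (Y i) + 1) * (30 * (1 + BB div w) + 5 * k)" "s8 ''sb'' = sumY i"
      "s8 ''first'' = hd0 (Y i)" "s8 ''last'' = last0 (Y i)" "s8 ''ok'' = of_bool (sorted_by r (Y i))"
    and f8: "\<forall>v. v \<notin> lwrites hash_asserted \<longrightarrow> s8 v = s7 v"
    by (auto elim: lwp_obtain simp: sumY_def)
  have f8': "s8 v = s7 v" if "v \<notin> {''i'', ''t'', ''u'', ''e'', ''sb'', ''first'', ''last'', ''ok'', ''prev''}" for v
    using f8 that by (simp add: hash_asserted_def)
  have "net i s8" unfolding net_def shift_def
    using 4(6) 5 6 v4 v6 by (simp add: f8' f7' f6' f5')
  then have base: "base i s8" unfolding base_def basev_def
    using 6 7 8 v6 by (simp add: f8' f7')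
  let ?T = "t1 + (t2 + (t3 + (t4 + (t5 + (t6 + (t7 + t8))))))"
  have ex: "lexec ?E prepare s0 ?T s8"
    unfolding prepare_def by (intro lexec.LSeq) (rule e1 e2 e3 e4 e5 e6 e7 e8)+
  have wp: "words w p \<le> step_words" "words w (4 * p) \<le> step_words" "words w (BB + 1) \<le> all_words"
  proof -
    show "words w p \<le> step_words"
      by (rule words_step[OF less_power_Suc_floor_log]) simp
    show "words w (4 * p) \<le> step_words"
      by (rule words_step[of _ "DD + 3"]) (use less_power_Suc_floor_log[of p] in \<open>simp_all add: power_add\<close>)
    show "words w (BB + 1) \<le> all_words" by (rule words_all[OF less_exp]) simp
  qed
  have B1: "1 + BB div w \<le> all_words" by (auto simp: all_words_def intro!: div_le_mono)
  have b2: "t2 \<le> 9 * ((DD + 1) * step_words)"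
    using 2(1) mult_le_mono2[OF wp(1), of "9 * (DD + 1)"] by (simp add: p1 algebra_simps)
  have b4: "t4 \<le> 50 * ((DD + 1) * step_words)"
    using 4(1) mult_le_mono2[OF wp(2), of "50 * (DD + 1)"] by (simp add: algebra_simps)
  have b5: "t5 \<le> 40 * ((DD + 1) * step_words)" using 5(1) wp(2) by (simp add: algebra_simps)
  have b6: "t6 \<le> 30 * (all_words * words w (DD + 1))"
  proof (rule order_trans[OF 6(1)])
    show "30 * words w (BB + 1) * words w (DD + 1) \<le> 30 * (all_words * words w (DD + 1))"
      unfolding mult.assoc using wp(3) by (intro mult_le_mono order_refl)
  qed
  have b7: "t7 \<le> (l + 1) * (15 * all_words + 2 * k)"
    using 7(1) l[OF i] B1 by (elim order_trans) (intro mult_le_mono add_mono; simp)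
  have b8: "t8 \<le> (l + 1) * (30 * all_words + 5 * k)"
    using 8(1) l[OF i] B1 by (elim order_trans) (intro mult_le_mono add_mono; simp)
  have "?T \<le> prepare_time"
    using 1(1) b2 3(1) b4 b5 b6 b7 b8 unfolding prepare_time_def n2 by (simp add: algebra_simps)
  then show ?thesis unfolding lwp_def s0_def[symmetric] using ex base by blast
qed

end

section \<open>The stages between the streams\<close>

context sort_run
begin

abbreviation "LL \<equiv> left_part p Y"
abbreviation "RR \<equiv> right_part p Y"

definition stream_time :: real where
  "stream_time = real (80 * all_words + 1) + real (2 * DD) * (2 * (\<alpha> + \<beta> * real CC) + real (40 * step_words + 1))"

definition stream_vars :: "vname set" where
  "stream_vars = {''X'', ''off'', ''carry'', ''il'', ''ir'', ''rl'', ''rr'', ''y'', ''cnt'', ''t'', ''u'',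
    ''out'', ''zl'', ''zr'', ''zy''}"

lemma writes_stream: "writes stream \<subseteq> stream_vars"
  by (simp add: stream_def stream_pre_def stream_step_def stream_post_def stream_vars_def)

lemma stream_stage:
  assumes a: "\<And>i. i \<in> {1..p} \<Longrightarrow> a i \<le> 1" and a': "\<And>i. i \<in> {1..p} \<Longrightarrow> a' i \<le> 1"
    and R: "\<And>i s s'. R i s \<Longrightarrow> (\<And>v. v \<notin> stream_vars \<Longrightarrow> s' v = s v) \<Longrightarrow> R i s'"
  shows "xtriple p \<alpha> \<beta> EE
    (\<lambda>i s. (net i s \<and> s ''x'' = x i \<and> s ''ml'' = a i \<and> s ''mr'' = a' i) \<and> R i s) stream stream_time
    (\<lambda>i s. (net i s \<and> s ''zl'' = tree_sum x a a' (tree_lo p i) i mod 2 ^ BB \<and>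
        s ''zr'' = tree_sum x a a' (Suc i) (tree_hi p i) mod 2 ^ BB \<and>
        s ''zy'' = tree_sum x a a' (tree_lo p i) (tree_hi p i) mod 2 ^ BB) \<and> R i s)"
  unfolding stream_time_def
proof (rule xtriple_frame[OF stream_correct[OF a a']])
  fix i s s' assume "R i s" and fr: "\<And>v. v \<notin> writes stream \<Longrightarrow> s' v = s v"
  show "R i s'"
  proof (rule R[OF \<open>R i s\<close>])
    fix v assume "v \<notin> stream_vars"
    then have "v \<notin> writes stream" using writes_stream by (rule contra_subsetD[rotated])
    then show "s' v = s v" by (rule fr)
  qed
qed

lemma parts:
  assumes i: "i \<in> {1..p}"
  shows "length (LL i) \<le> n" "length (RR i) \<le> n" "length (Y i) \<le> n"
    "set (LL i) \<subseteq> elems w k" "set (RR i) \<subseteq> elems w k"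
proof -
  have n: "length (whole p Y) = n" "set (whole p Y) \<subseteq> elems w k" using inst by (auto simp: sort_instance_def)
  note bd = tree_bounds[OF i]
  show "length (LL i) \<le> n"
    unfolding left_part_def n(1)[symmetric] by (rule length_part_le) (use bd i in auto)
  show "length (RR i) \<le> n"
    unfolding right_part_def n(1)[symmetric] by (rule length_part_le) (use bd i in auto)
  show "length (Y i) \<le> n" unfolding n(1)[symmetric] by (rule length_le_whole[OF i])
  show "set (LL i) \<subseteq> elems w k"
    unfolding left_part_def by (rule subset_trans[OF set_part n(2)]) (use bd i in auto)
  show "set (RR i) \<subseteq> elems w k"
    unfolding right_part_def by (rule subset_trans[OF set_part n(2)]) (use bd i in auto)
qed

lemma n_less: "n < 2 ^ BB"
  using less_power_Suc_floor_log[of n]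
  by (rule order_less_le_trans, intro power_increasing) (simp_all add: total_bits_def)

lemma hd0_less: "set xs \<subseteq> elems w k \<Longrightarrow> hd0 xs < 2 ^ (k * w)"
  by (cases xs) (auto simp: hd0_def elems_def)

lemma last0_less: "set xs \<subseteq> elems w k \<Longrightarrow> last0 xs < 2 ^ (k * w)"
proof (cases "xs = []")
  case False
  assume "set xs \<subseteq> elems w k"
  from subsetD[OF this last_in_set[OF False]] False show ?thesis by (simp add: last0_def elems_def)
qed (simp add: last0_def)

lemma elem_less: "v < 2 ^ (k * w) \<Longrightarrow> v < 2 ^ BB" for v :: nat
  by (erule order_less_le_trans, intro power_increasing) (simp_all add: total_bits_def)

lemma words_elem: "v < 2 ^ (k * w) \<Longrightarrow> words w v \<le> all_words"
  by (erule words_all) (simp add: total_bits_def)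

lemma words_count: "v \<le> 2 * n \<Longrightarrow> words w v \<le> all_words"
  by (rule words_all[of _ "BB + 1"]) (use n_less in auto)

lemma all_words_pos: "1 \<le> all_words" by (simp add: all_words_def)

lemma stage_count:
  "xtriple p \<alpha> \<beta> EE base (Local count_parts) (real (20 * all_words))
     (\<lambda>i s. (net i s \<and> s ''x'' = length (Y i) \<and> s ''ml'' = 1 \<and> s ''mr'' = 1) \<and> basev i s)"
proof (rule xtriple_Local[OF pos(1)])
  fix i s assume i: "i \<in> {1..p}" and s: "base i s"
  have ws: "words w (length (Y i)) \<le> all_words" using parts[OF i] by (intro words_count) simp
  show "lwp (EE i) count_parts (\<lambda>t s'. t \<le> 20 * all_words \<and>
      (net i s' \<and> s' ''x'' = length (Y i) \<and> s' ''ml'' = 1 \<and> s' ''mr'' = 1) \<and> basev i s') s"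
    unfolding count_parts_def block.simps
    apply (rule lwp_LSeq lwp_Instr)+
    using s ws all_words_pos by (simp add: base_def basev_def net_def)
qed

definition partsv :: "nat \<Rightarrow> store \<Rightarrow> bool" where
  "partsv i s \<longleftrightarrow> basev i s \<and> s ''cl'' = length (LL i) \<and> s ''cr'' = length (RR i)"

text \<open>\<open>find_first\<close> does not set \<open>ml\<close>: the factor 1 from the counting
  stage survives the stream and is carried through as a precondition.\<close>

lemma stage_first:
  "xtriple p \<alpha> \<beta> EE (\<lambda>i s. net i s \<and> s ''zl'' = length (LL i) \<and> s ''zr'' = length (RR i) \<and> s ''ml'' = 1 \<and> basev i s)
     (Local find_first) (real (20 * all_words))
     (\<lambda>i s. (net i s \<and> s ''x'' = hd0 (Y i) * of_bool (LL i = []) \<and> s ''ml'' = 1 \<and>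
        s ''mr'' = of_bool (LL i = [] \<and> Y i = [])) \<and> partsv i s)"
proof (rule xtriple_Local[OF pos(1)])
  fix i s assume i: "i \<in> {1..p}"
    and s: "net i s \<and> s ''zl'' = length (LL i) \<and> s ''zr'' = length (RR i) \<and> s ''ml'' = 1 \<and> basev i s"
  have ws: "words w (length (Y i)) \<le> all_words" "words w (length (LL i)) \<le> all_words"
    "words w (length (RR i)) \<le> all_words" "words w (length (LL i) + length (Y i)) \<le> all_words"
    using parts[OF i] by (intro words_count; simp)+
  have wf: "words w (hd0 (Y i)) \<le> all_words" using hd0_less[OF elems_sub(2)[OF i]] by (rule words_elem)
  show "lwp (EE i) find_first (\<lambda>t s'. t \<le> 20 * all_words \<and>
      (net i s' \<and> s' ''x'' = hd0 (Y i) * of_bool (LL i = []) \<and> s' ''ml'' = 1 \<and>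
        s' ''mr'' = of_bool (LL i = [] \<and> Y i = [])) \<and> partsv i s') s"
    unfolding find_first_def block.simps
    apply (rule lwp_LSeq lwp_Instr)+
    using s ws wf all_words_pos by (simp add: basev_def partsv_def net_def)
qed

definition firstv :: "nat \<Rightarrow> store \<Rightarrow> bool" where
  "firstv i s \<longleftrightarrow> partsv i s \<and> s ''fr'' = hd0 (RR i)"

lemma stage_last:
  "xtriple p \<alpha> \<beta> EE (\<lambda>i s. net i s \<and> s ''zr'' = hd0 (RR i) \<and> partsv i s)
     (Local find_last) (real (20 * all_words))
     (\<lambda>i s. (net i s \<and> s ''x'' = last0 (Y i) * of_bool (RR i = []) \<and>
        s ''ml'' = of_bool (RR i = [] \<and> Y i = []) \<and> s ''mr'' = 1) \<and> firstv i s)"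
proof (rule xtriple_Local[OF pos(1)])
  fix i s assume i: "i \<in> {1..p}"
    and s: "net i s \<and> s ''zr'' = hd0 (RR i) \<and> partsv i s"
  have ws: "words w (length (Y i)) \<le> all_words"
    "words w (length (RR i)) \<le> all_words" "words w (length (RR i) + length (Y i)) \<le> all_words"
    using parts[OF i] by (intro words_count; simp)+
  have wf: "words w (last0 (Y i)) \<le> all_words" "words w (hd0 (RR i)) \<le> all_words"
    using last0_less[OF elems_sub(2)[OF i]] hd0_less[OF parts(5)[OF i]] by (auto intro: words_elem)
  show "lwp (EE i) find_last (\<lambda>t s'. t \<le> 20 * all_words \<and>
      (net i s' \<and> s' ''x'' = last0 (Y i) * of_bool (RR i = []) \<and>
        s' ''ml'' = of_bool (RR i = [] \<and> Y i = []) \<and> s' ''mr'' = 1) \<and> firstv i s') s"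
    unfolding find_last_def block.simps
    apply (rule lwp_LSeq lwp_Instr)+
    using s ws wf all_words_pos by (simp add: basev_def partsv_def firstv_def net_def)
qed

lemma words_le_3: "v \<le> 3 \<Longrightarrow> words w v \<le> all_words"
  by (rule words_all[of _ 2]) simp_all

lemma check_left_correct:
  assumes i: "i \<in> {1..p}" and s: "net i s" "firstv i s" "s ''zl'' = last0 (LL i)"
  shows "lwp (EE i) check_left (\<lambda>t s'. t \<le> 40 * all_words + 2 * k \<and>
    s' ''ok'' = of_bool (sorted_by r (Y i) \<and> joins r (LL i) (Y i @ RR i))) s"
proof -
  have wl: "words w (length (Y i)) \<le> all_words" "words w (length (LL i)) \<le> all_words"
    "words w (length (RR i)) \<le> all_words" "words w (length (Y i) + length (RR i)) \<le> all_words"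
    using parts[OF i] by (intro words_count; simp)+
  define nx e3 where "nx = hd0 (Y i @ RR i)" and "e3 = (of_bool (Y i = []) :: nat)"
  have nx: "hd0 (Y i) + hd0 (RR i) * e3 = nx" by (auto simp: nx_def hd0_def e3_def)
  have YR: "set (Y i @ RR i) \<subseteq> elems w k" using elems_sub(2)[OF i] parts(5)[OF i] by simp
  have wv: "words w (last0 (LL i)) \<le> all_words" "words w (hd0 (RR i)) \<le> all_words"
    "words w (hd0 (Y i)) \<le> all_words" "words w nx \<le> all_words"
    unfolding nx_def
    by (rule words_elem[OF last0_less[OF parts(4)[OF i]]]
      words_elem[OF hd0_less[OF parts(5)[OF i]]] words_elem[OF hd0_less[OF elems_sub(2)[OF i]]]
      words_elem[OF hd0_less[OF YR]])+
  have wv': "words w (hd0 (RR i) * e3) \<le> all_words" using wv(2) all_words_pos by (simp add: e3_def)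
  define j1 e1 e2 where "j1 = (of_bool ((last0 (LL i), nx) \<in> r) :: nat)"
    and "e1 = (of_bool (LL i = []) :: nat)" and "e2 = (of_bool (Y i = [] \<and> RR i = []) :: nat)"
  have le: "j1 \<le> 1" "e1 \<le> 1" "e2 \<le> 1" "e3 \<le> 1" by (simp_all add: j1_def e1_def e2_def e3_def)
  have w1: "words w j1 \<le> all_words" "words w e1 \<le> all_words" "words w e2 \<le> all_words"
    "words w e3 \<le> all_words" "words w (j1 + e1) \<le> all_words" "words w (j1 + e1 + e2) \<le> all_words"
    using le by (intro words_le_3; simp)+
  have we3: "words w e3 = 1" by (simp add: e3_def)
  have J: "0 < j1 + e1 + e2 \<longleftrightarrow> joins r (LL i) (Y i @ RR i)"
    by (auto simp: j1_def e1_def e2_def joins_def nx_def)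
  have s': "s ''asserted_length'' = length (Y i)" "s ''first'' = hd0 (Y i)"
    "s ''ok'' = of_bool (sorted_by r (Y i))" "s ''cl'' = length (LL i)" "s ''cr'' = length (RR i)" "s ''fr'' = hd0 (RR i)"
    "s ''zl'' = last0 (LL i)" "s ''zero'' = 0" "s ''one'' = 1"
    using s by (simp_all add: firstv_def partsv_def basev_def net_def)
  have ob: "of_bool (length (Y i) < 1) = e3" "of_bool (length (LL i) < 1) = e1"
    "of_bool (length (Y i) + length (RR i) < 1) = e2" "of_bool ((last0 (LL i), nx) \<in> r) = j1"
    by (simp_all add: e3_def e1_def e2_def j1_def)
  show ?thesis
    unfolding check_left_def block.simps J[symmetric]
    apply (rule lwp_LSeq lwp_Instr)+
    apply (simp only: exec_simps env s' ob nx we3)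
    using wl wv wv' w1 all_words_pos
    by (simp add: of_bool_conj)
qed

lemma check_right_correct:
  assumes i: "i \<in> {1..p}" and s: "net i s" "s ''asserted_length'' = length (Y i)" "s ''last'' = last0 (Y i)"
    "s ''fr'' = hd0 (RR i)" "s ''cr'' = length (RR i)" "s ''ok'' = of_bool P"
  shows "lwp (EE i) check_right (\<lambda>t s'. t \<le> 20 * all_words + 2 * k \<and>
    s' ''ok'' = of_bool (P \<and> joins r (Y i) (RR i))) s"
proof -
  have wl: "words w (length (Y i)) \<le> all_words" "words w (length (RR i)) \<le> all_words"
    using parts[OF i] by (intro words_count; simp)+
  have wv: "words w (last0 (Y i)) \<le> all_words" "words w (hd0 (RR i)) \<le> all_words"
    by (rule words_elem[OF last0_less[OF elems_sub(2)[OF i]]] words_elem[OF hd0_less[OF parts(5)[OF i]]])+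
  define j2 e3 e4 where "j2 = (of_bool ((last0 (Y i), hd0 (RR i)) \<in> r) :: nat)"
    and "e3 = (of_bool (Y i = []) :: nat)" and "e4 = (of_bool (RR i = []) :: nat)"
  have le: "j2 \<le> 1" "e3 \<le> 1" "e4 \<le> 1" by (simp_all add: j2_def e3_def e4_def)
  have w1: "words w j2 \<le> all_words" "words w e3 \<le> all_words" "words w e4 \<le> all_words"
    "words w (j2 + e3) \<le> all_words" "words w (j2 + e3 + e4) \<le> all_words"
    using le by (intro words_le_3; simp)+
  have J: "0 < j2 + e3 + e4 \<longleftrightarrow> joins r (Y i) (RR i)"
    by (auto simp: j2_def e3_def e4_def joins_def)
  have s': "s ''zero'' = 0" "s ''one'' = 1" using s by (simp_all add: net_def)
  have ob: "of_bool (length (Y i) < 1) = e3" "of_bool (length (RR i) < 1) = e4"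
    "of_bool ((last0 (Y i), hd0 (RR i)) \<in> r) = j2"
    by (simp_all add: e3_def e4_def j2_def)
  show ?thesis
    unfolding check_right_def block.simps J[symmetric]
    apply (rule lwp_LSeq lwp_Instr)+
    apply (simp only: exec_simps env s' s ob)
    using wl wv w1 all_words_pos
    by (simp add: of_bool_conj)
qed

section \<open>Hash differences and violations in one sum\<close>

abbreviation "QQ \<equiv> b + (floor_log n + 1)"

lemma sums_less: "i \<in> {1..p} \<Longrightarrow> sumA i < 2 ^ QQ" "i \<in> {1..p} \<Longrightarrow> sumY i < 2 ^ QQ"
  unfolding sumA_def sumY_def by (rule sum_list_hash_less[OF _ hash_less lengths(1)[of i]] sum_list_hash_less[OF _ hash_less lengths(2)[of i]];
    simp add: elems_sub)+

lemma QQ_le: "QQ \<le> BB" "QQ + DD + 1 \<le> BB"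
  by (simp_all add: total_bits_def)

definition balance :: "nat \<Rightarrow> nat" where
  "balance i = 2 ^ BB + sumA i - sumY i + 2 ^ QQ * of_bool (\<not> locally_sorted p r Y i)"

lemma combine_correct:
  assumes i: "i \<in> {1..p}" and s: "net i s" "s ''sa'' = sumA i" "s ''sb'' = sumY i" "s ''Q'' = QQ"
    "s ''ok'' = of_bool (locally_sorted p r Y i)"
  shows "lwp (EE i) combine (\<lambda>t s'. t \<le> 40 * all_words \<and>
    s' ''x'' = balance i \<and> s' ''ml'' = 1 \<and> s' ''mr'' = 1) s"
proof -
  define P where "P = locally_sorted p r Y i"
  define e where "e = (2 ^ QQ * of_bool (\<not> P) :: nat)"
  have "(2::nat) ^ QQ \<le> 2 ^ BB" by (rule power_increasing) (use QQ_le in auto)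
  then have lt: "sumA i < 2 ^ BB" "sumY i < 2 ^ BB" "e \<le> 2 ^ BB" using sums_less[OF i] by (auto simp: e_def)
  have W: "words w v \<le> all_words" if "v \<le> 3 * 2 ^ BB" for v
    by (rule words_all[of _ "BB + 2"]) (use that in \<open>simp_all add: power_add le_less_trans[OF that]\<close>)
  have ws: "words w (2 ^ BB) \<le> all_words" "words w (sumA i) \<le> all_words" "words w (sumY i) \<le> all_words"
    "words w e \<le> all_words" "words w (2 ^ BB + sumA i) \<le> all_words" "words w (2 ^ BB + sumA i - sumY i) \<le> all_words"
    using lt by (intro W; simp)+
  have w1: "words w QQ \<le> all_words" "words w BB \<le> all_words"
    by (rule words_all[OF less_exp], use QQ_le in simp)+
  have d1: "1 div w \<le> all_words" by (rule order_trans[OF div_le_dividend all_words_pos])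
  have s': "s ''zero'' = 0" "s ''one'' = 1" "s ''B'' = BB" using s by (simp_all add: net_def)
  have ob: "of_bool (of_bool P < (1::nat)) = (of_bool (\<not> P) :: nat)" by (cases P) auto
  have dt: "take_bit QQ 0 + push_bit QQ (take_bit 1 (of_bool (\<not> P))) + push_bit (QQ + 1) (drop_bit (QQ + 1) 0) = e"
    by (cases P) (simp_all add: e_def push_bit_eq_mult)
  have dx: "take_bit BB 0 + push_bit BB (take_bit 1 1) + push_bit (BB + 1) (drop_bit (BB + 1) 0) = (2 ^ BB :: nat)"
    by (simp add: push_bit_eq_mult)
  show ?thesis
    unfolding combine_def block.simps balance_def P_def[symmetric] e_def[symmetric]
    apply (rule lwp_LSeq lwp_Instr)+
    apply (simp only: exec_simps env s' s P_def[symmetric] ob dt dx)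
    using ws w1 d1 all_words_pos by simp
qed

lemma stage_combine:
  "xtriple p \<alpha> \<beta> EE (\<lambda>i s. net i s \<and> s ''zl'' = last0 (LL i) \<and> firstv i s)
     (Local (LSeq check_left (LSeq check_right combine))) (real (100 * all_words + 4 * k))
     (\<lambda>i s. (net i s \<and> s ''x'' = balance i \<and> s ''ml'' = 1 \<and> s ''mr'' = 1) \<and> True)"
proof (rule xtriple_Local[OF pos(1)])
  fix i s assume i: "i \<in> {1..p}" and "net i s \<and> s ''zl'' = last0 (LL i) \<and> firstv i s"
  then have s: "net i s" "firstv i s" "s ''zl'' = last0 (LL i)" by simp_all
  from check_left_correct[OF i s] obtain t1 s1 where e1: "lexec (EE i) check_left s t1 s1"
    and 1: "t1 \<le> 40 * all_words + 2 * k" "s1 ''ok'' = of_bool (sorted_by r (Y i) \<and> joins r (LL i) (Y i @ RR i))"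
    and f1: "\<forall>v. v \<notin> lwrites check_left \<longrightarrow> s1 v = s v"
    by (rule lwp_obtain) blast
  have n1: "net i s1" by (rule net_frame[OF s(1) f1]) (simp add: check_left_def)
  have v1: "s1 ''asserted_length'' = length (Y i)" "s1 ''last'' = last0 (Y i)" "s1 ''fr'' = hd0 (RR i)" "s1 ''cr'' = length (RR i)"
    "s1 ''sa'' = sumA i" "s1 ''sb'' = sumY i" "s1 ''Q'' = QQ"
    using f1 s(2) by (simp_all add: check_left_def firstv_def partsv_def basev_def)
  from check_right_correct[OF i n1 v1(1-4) 1(2)] obtain t2 s2 where e2: "lexec (EE i) check_right s1 t2 s2"
    and 2: "t2 \<le> 20 * all_words + 2 * k" "s2 ''ok'' = of_bool ((sorted_by r (Y i) \<and> joins r (LL i) (Y i @ RR i)) \<and> joins r (Y i) (RR i))"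
    and f2: "\<forall>v. v \<notin> lwrites check_right \<longrightarrow> s2 v = s1 v"
    by (rule lwp_obtain) blast
  have n2: "net i s2" by (rule net_frame[OF n1 f2]) (simp add: check_right_def)
  have v2: "s2 ''sa'' = sumA i" "s2 ''sb'' = sumY i" "s2 ''Q'' = QQ" "s2 ''ok'' = of_bool (locally_sorted p r Y i)"
    using f2 v1 2(2) by (simp_all add: check_right_def locally_sorted_def)
  from combine_correct[OF i n2 v2] obtain t3 s3 where e3: "lexec (EE i) combine s2 t3 s3"
    and 3: "t3 \<le> 40 * all_words \<and> s3 ''x'' = balance i \<and> s3 ''ml'' = 1 \<and> s3 ''mr'' = 1"
    and f3: "\<forall>v. v \<notin> lwrites combine \<longrightarrow> s3 v = s2 v"
    by (rule lwp_obtain) blast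
  have n3: "net i s3" by (rule net_frame[OF n2 f3]) (simp add: combine_def)
  show "lwp (EE i) (LSeq check_left (LSeq check_right combine)) (\<lambda>t s'. t \<le> 100 * all_words + 4 * k \<and>
     (net i s' \<and> s' ''x'' = balance i \<and> s' ''ml'' = 1 \<and> s' ''mr'' = 1) \<and> True) s"
    unfolding lwp_def using lexec.LSeq[OF e1 lexec.LSeq[OF e2 e3]] 1(1) 2(1) 3 n3
    by (intro exI[of _ "t1 + (t2 + t3)"] exI[of _ s3]) simp
qed

lemma stage_decide:
  assumes v: "\<And>i. i \<in> {1..p} \<Longrightarrow> v i < 2 ^ BB"
  shows "xtriple p \<alpha> \<beta> EE (\<lambda>i s. net i s \<and> s ''zy'' = v i) (Local decide) (real (4 * all_words))
     (\<lambda>i s. net i s \<and> s ''verdict'' = of_bool (v i = 0) \<and> s ''cnt'' = DD)"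
proof (rule xtriple_Local[OF pos(1)])
  fix i s assume i: "i \<in> {1..p}" and s: "net i s \<and> s ''zy'' = v i"
  have ws: "words w (v i) \<le> all_words" by (rule words_all[OF v[OF i]]) simp
  have wd: "words w DD \<le> all_words" by (rule words_all[OF less_exp]) simp
  show "lwp (EE i) decide (\<lambda>t s'. t \<le> 4 * all_words \<and> net i s' \<and> s' ''verdict'' = of_bool (v i = 0) \<and> s' ''cnt'' = DD) s"
    unfolding decide_def block.simps
    apply (rule lwp_LSeq lwp_Instr)+
    using s ws wd all_words_pos by (simp add: net_def)
qed

definition accepts :: bool where
  "accepts \<longleftrightarrow> (\<forall>i\<in>{1..p}. locally_sorted p r Y i) \<and> (\<Sum>i\<in>{1..p}. sumA i) = (\<Sum>i\<in>{1..p}. sumY i)"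

text \<open>The total is p * 2 ^ BB + d with |d| < 2 ^ BB, so it vanishes modulo 2 ^ BB only if d =
  0, and |SA - SY| < 2 ^ QQ then forces \<open>bad\<close> to be 0. The bounds are assumed for the
  global sums because adding up the bounds for single PEs would lose a factor
  \<open>p\<close>.\<close>

lemma balance_sum:
  assumes tot: "(\<Sum>i\<in>{1..p}. sumA i) < 2 ^ QQ" "(\<Sum>i\<in>{1..p}. sumY i) < 2 ^ QQ"
  shows "(\<Sum>i\<in>{1..<Suc p}. balance i) mod 2 ^ BB = 0 \<longleftrightarrow> accepts"
proof -
  define SA SY bad where "SA = (\<Sum>i\<in>{1..p}. int (sumA i))" and "SY = (\<Sum>i\<in>{1..p}. int (sumY i))"
    and "bad = (\<Sum>i\<in>{1..p}. of_bool (\<not> locally_sorted p r Y i) :: int)"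
  define d where "d = SA - SY + 2 ^ QQ * bad"
  have QB: "(2::nat) ^ QQ \<le> 2 ^ BB" by (rule power_increasing) (use QQ_le in auto)
  have v: "int (balance i) = 2 ^ BB + int (sumA i) - int (sumY i) + 2 ^ QQ * of_bool (\<not> locally_sorted p r Y i)"
    if "i \<in> {1..p}" for i
  proof -
    have "sumY i \<le> 2 ^ BB + sumA i" using sums_less(2)[OF that] QB by linarith
    then show ?thesis unfolding balance_def by (simp add: of_nat_diff)
  qed
  have "int (\<Sum>i\<in>{1..<Suc p}. balance i) = (\<Sum>i\<in>{1..p}. int (balance i))"
    by (simp only: atLeastLessThanSuc_atLeastAtMost of_nat_sum)
  also have "\<dots> = (\<Sum>i\<in>{1..p}. 2 ^ BB + int (sumA i) - int (sumY i) + 2 ^ QQ * of_bool (\<not> locally_sorted p r Y i))"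
    by (rule sum.cong[OF refl v])
  also have "\<dots> = int p * 2 ^ BB + d"
    by (simp add: sum.distrib sum_subtractf sum_distrib_left d_def SA_def SY_def bad_def)
  finally have tot_eq: "int (\<Sum>i\<in>{1..<Suc p}. balance i) = int p * 2 ^ BB + d" .
  have bad: "0 \<le> bad" "bad \<le> int p"
    using sum_bounded_above[of "{1..p}" "\<lambda>i. of_bool (\<not> locally_sorted p r Y i) :: int" 1]
    by (simp_all add: bad_def sum_nonneg)
  have "int (\<Sum>i\<in>{1..p}. sumA i) < int (2 ^ QQ)" "int (\<Sum>i\<in>{1..p}. sumY i) < int (2 ^ QQ)"
    using tot by (simp_all only: of_nat_less_iff)
  then have S: "0 \<le> SA" "SA < 2 ^ QQ" "0 \<le> SY" "SY < 2 ^ QQ"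
    by (simp_all add: SA_def SY_def sum_nonneg)
  \<comment> \<open>At most \<open>p\<close> violations of weight 2 ^ QQ and a difference below 2 ^
    QQ: this is why \<open>total_bits\<close> has \<open>floor_log p + 1\<close> bits beyond
    \<open>QQ\<close>.\<close>
  have d_lt: "\<bar>d\<bar> < 2 ^ BB"
  proof -
    have "int p < 2 ^ (DD + 1)" using less_power_Suc_floor_log[of p] by (metis of_nat_less_iff of_nat_numeral of_nat_power)
    then have "2 ^ QQ * (int p + 1) \<le> 2 ^ QQ * 2 ^ (DD + 1)" by (intro mult_left_mono) simp_all
    also have "\<dots> = 2 ^ (QQ + (DD + 1))" by (simp add: power_add)
    also have "\<dots> \<le> 2 ^ BB" by (rule power_increasing) (use QQ_le(2) in auto)
    finally have 1: "2 ^ QQ * (int p + 1) \<le> 2 ^ BB" .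
    have "2 ^ QQ * bad \<le> 2 ^ QQ * int p" "0 \<le> 2 ^ QQ * bad" using bad by (simp_all add: mult_left_mono)
    moreover have "2 ^ QQ * (int p + 1) = 2 ^ QQ * int p + 2 ^ QQ" by (simp add: algebra_simps)
    moreover have "0 \<le> 2 ^ QQ * int p" by simp
    ultimately show ?thesis using 1 S unfolding d_def by linarith
  qed
  have "(\<Sum>i\<in>{1..<Suc p}. balance i) mod 2 ^ BB = 0 \<longleftrightarrow> int ((\<Sum>i\<in>{1..<Suc p}. balance i) mod 2 ^ BB) = 0"
    by (rule of_nat_eq_0_iff[symmetric])
  also have "\<dots> \<longleftrightarrow> (int p * 2 ^ BB + d) mod 2 ^ BB = 0"
    by (simp only: zmod_int tot_eq of_nat_power of_nat_numeral)
  also have "\<dots> \<longleftrightarrow> 2 ^ BB dvd d" by (simp add: dvd_eq_mod_eq_0 mod_add_left_eq[symmetric])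
  also have "\<dots> \<longleftrightarrow> d = 0" using d_lt dvd_imp_le_int[of d "2 ^ BB"] by auto
  also have "\<dots> \<longleftrightarrow> bad = 0 \<and> SA = SY"
  proof
    assume d: "d = 0"
    have "bad = 0"
    proof (rule ccontr)
      assume "bad \<noteq> 0"
      then have "2 ^ QQ * 1 \<le> 2 ^ QQ * bad" using bad by (intro mult_left_mono) auto
      then show False using d S unfolding d_def by linarith
    qed
    then show "bad = 0 \<and> SA = SY" using d by (simp add: d_def)
  qed (simp add: d_def)
  also have "\<dots> \<longleftrightarrow> accepts"
  proof -
    have "bad = 0 \<longleftrightarrow> (\<forall>i\<in>{1..p}. locally_sorted p r Y i)"
      unfolding bad_def by (subst sum_nonneg_eq_0_iff) auto
    moreover have "SA = SY \<longleftrightarrow> (\<Sum>i\<in>{1..p}. sumA i) = (\<Sum>i\<in>{1..p}. sumY i)"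
      unfolding SA_def SY_def of_nat_sum[symmetric] by (rule of_nat_eq_iff)
    ultimately show ?thesis by (simp add: accepts_def)
  qed
  finally show ?thesis .
qed

end

lemma sum_part: "(\<Sum>i\<in>{1..p}. sum_list (map h (A i))) = sum_list (map h (whole p A))" for h :: "nat \<Rightarrow> nat"
  by (induction p) (simp_all add: whole_def)

context sort_run
begin

lemma sum_less:
  assumes "length xs = n" "set xs \<subseteq> elems w k"
  shows "sum_list (map h xs) < 2 ^ QQ"
  by (rule sum_list_hash_less[OF assms(2) hash_less]) (simp_all only: assms(1) less_power_Suc_floor_log)

lemma accepts_iff:
  "accepts \<longleftrightarrow> sorted_by r (whole p Y) \<and> sum_list (map h (whole p A)) = sum_list (map h (whole p Y))"
proof -
  have "set (whole p Y) \<subseteq> elems w k" using inst by (simp add: sort_instance_def)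
  from sorted_whole_iff[OF pos(1) order this] show ?thesis
    unfolding accepts_def sumA_def sumY_def sum_part by simp
qed

text \<open>164 = 20 + 20 + 20 + 100 + 4 collects the local stages between the four streams.\<close>

definition run_time :: real where
  "run_time = real prepare_time + 4 * stream_time + real (164 * all_words + 4 * k)
     + (real DD * (2 * (\<alpha> + \<beta>) + real (2 * step_words + 1)) + 1)"

lemma checker_correct:
  "xtriple p \<alpha> \<beta> EE (\<lambda>i s. s = init_store p n w k b A Y i) checker run_time
     (\<lambda>i s. s ''verdict'' = of_bool accepts)"
proof -
  have prepare: "xtriple p \<alpha> \<beta> EE (\<lambda>i s. s = init_store p n w k b A Y i) (Local prepare) (real prepare_time) base"
    by (rule xtriple_Local[OF pos(1)]) (use prepare_correct in blast)
  have fr: "basev i s'" if "basev i s" "\<And>v. v \<notin> stream_vars \<Longrightarrow> s' v = s v" for i s s'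
    using that by (simp add: basev_def stream_vars_def)
  have fr2: "partsv i s'" if "partsv i s" "\<And>v. v \<notin> stream_vars \<Longrightarrow> s' v = s v" for i s s'
    using that by (simp add: basev_def partsv_def stream_vars_def)
  have fr3: "firstv i s'" if "firstv i s" "\<And>v. v \<notin> stream_vars \<Longrightarrow> s' v = s v" for i s s'
    using that by (simp add: basev_def partsv_def firstv_def stream_vars_def)
  have m: "v mod 2 ^ BB = v" if "v < 2 ^ BB" for v :: nat using that by simp
  have len: "length (LL i) < 2 ^ BB" "length (RR i) < 2 ^ BB" if "i \<in> {1..p}" for i
    using parts(1,2)[OF that] n_less by auto
  have el: "hd0 (RR i) < 2 ^ BB" "last0 (LL i) < 2 ^ BB" if "i \<in> {1..p}" for i
    using hd0_less[OF parts(5)[OF that]] last0_less[OF parts(4)[OF that]] elem_less by auto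
  have counts: "tree_sum (\<lambda>i. length (Y i)) (\<lambda>_. 1) (\<lambda>_. 1) (tree_lo p i) i = length (LL i)"
    "tree_sum (\<lambda>i. length (Y i)) (\<lambda>_. 1) (\<lambda>_. 1) (Suc i) (tree_hi p i) = length (RR i)" for i
    by (simp_all only: tree_sum_eq_sum length_part left_part_def right_part_def)
  have s1: "xtriple p \<alpha> \<beta> EE
      (\<lambda>i s. (net i s \<and> s ''x'' = length (Y i) \<and> s ''ml'' = 1 \<and> s ''mr'' = 1) \<and> basev i s) stream stream_time
      (\<lambda>i s. net i s \<and> s ''zl'' = length (LL i) \<and> s ''zr'' = length (RR i) \<and> s ''ml'' = 1 \<and> basev i s)"
  proof (rule xtriple_mono[OF stream_stage[where x = "\<lambda>i. length (Y i)" and a = "\<lambda>_. 1" and a' = "\<lambda>_. 1"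
          and R = "\<lambda>i s. basev i s \<and> s ''ml'' = 1"]])
    show "basev i s' \<and> s' ''ml'' = 1"
      if "basev i s \<and> s ''ml'' = 1" "\<And>v. v \<notin> stream_vars \<Longrightarrow> s' v = s v" for i s s'
      using that fr[of i s s'] by (simp add: stream_vars_def)
  qed (use len in \<open>auto simp only: counts m order_refl\<close>)
  have s2: "xtriple p \<alpha> \<beta> EE
      (\<lambda>i s. (net i s \<and> s ''x'' = hd0 (Y i) * of_bool (LL i = []) \<and> s ''ml'' = 1 \<and>
        s ''mr'' = of_bool (LL i = [] \<and> Y i = [])) \<and> partsv i s) stream stream_time
      (\<lambda>i s. net i s \<and> s ''zr'' = hd0 (RR i) \<and> partsv i s)"
    by (rule xtriple_mono[OF stream_stage[where x = "\<lambda>i. hd0 (Y i) * of_bool (LL i = [])" and a = "\<lambda>_. 1"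
          and a' = "\<lambda>i. of_bool (LL i = [] \<and> Y i = [])" and R = partsv]])
      (use fr2 el in \<open>auto simp only: tree_sum_hd0 m of_bool_less_eq_one order_refl\<close>)
  have s3: "xtriple p \<alpha> \<beta> EE
      (\<lambda>i s. (net i s \<and> s ''x'' = last0 (Y i) * of_bool (RR i = []) \<and>
        s ''ml'' = of_bool (RR i = [] \<and> Y i = []) \<and> s ''mr'' = 1) \<and> firstv i s) stream stream_time
      (\<lambda>i s. net i s \<and> s ''zl'' = last0 (LL i) \<and> firstv i s)"
    by (rule xtriple_mono[OF stream_stage[where x = "\<lambda>i. last0 (Y i) * of_bool (RR i = [])"
          and a = "\<lambda>i. of_bool (RR i = [] \<and> Y i = [])" and a' = "\<lambda>_. 1" and R = firstv]])
      (use fr3 el in \<open>auto simp only: tree_sum_last0 m of_bool_less_eq_one order_refl\<close>)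
  define v where "v i = (\<Sum>j\<in>{tree_lo p i..<tree_hi p i}. balance j) mod 2 ^ BB" for i
  have s4: "xtriple p \<alpha> \<beta> EE
      (\<lambda>i s. (net i s \<and> s ''x'' = balance i \<and> s ''ml'' = 1 \<and> s ''mr'' = 1) \<and> True) stream stream_time
      (\<lambda>i s. net i s \<and> s ''zy'' = v i)"
    by (rule xtriple_mono[OF stream_stage[where x = balance and a = "\<lambda>_. 1" and a' = "\<lambda>_. 1" and R = "\<lambda>_ _. True"]])
      (auto simp only: tree_sum_eq_sum v_def order_refl)
  \<comment> \<open>Only at depth 0 does the interval contain all ranks, so only there is
    \<open>v\<close> the balance of the whole instance.\<close>
  have root: "v i = 0 \<longleftrightarrow> accepts" if "i \<in> {1..p}" "tree_depth p i = 0" for i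
  proof -
    have W: "length (whole p A) = n" "set (whole p A) \<subseteq> elems w k" "length (whole p Y) = n" "set (whole p Y) \<subseteq> elems w k"
      using inst by (auto simp: sort_instance_def)
    have "(\<Sum>i\<in>{1..p}. sumA i) < 2 ^ QQ" "(\<Sum>i\<in>{1..p}. sumY i) < 2 ^ QQ"
      unfolding sumA_def sumY_def sum_part using sum_less W by blast+
    then show ?thesis unfolding v_def tree_depth_0(1,2)[OF that] by (rule balance_sum)
  qed
  have bc: "xtriple p \<alpha> \<beta> EE (\<lambda>i s. net i s \<and> s ''verdict'' = of_bool (v i = 0) \<and> s ''cnt'' = DD) broadcast
    (real DD * (2 * (\<alpha> + \<beta>) + real (2 * step_words + 1)) + 1) (\<lambda>i s. s ''verdict'' = of_bool accepts)"
    by (rule broadcast_correct) (simp_all only: root of_bool_less_eq_one)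
  have v: "v i < 2 ^ BB" for i by (simp add: v_def)
  show ?thesis
    unfolding checker_def
    by (rule xtriple_mono[OF xtriple_Seq[OF prepare xtriple_Seq[OF stage_count xtriple_Seq[OF s1 xtriple_Seq[OF stage_first
          xtriple_Seq[OF s2 xtriple_Seq[OF stage_last xtriple_Seq[OF s3 xtriple_Seq[OF stage_combine
          xtriple_Seq[OF s4 xtriple_Seq[OF stage_decide[OF v] bc]]]]]]]]]]])
      (simp_all add: run_time_def)
qed

lemma checker_run:
  "\<exists>T S. exec p \<alpha> \<beta> EE checker (init_store p n w k b A Y) T S \<and> T \<le> run_time \<and>
     (\<forall>i\<in>{1..p}. S i ''verdict'' = of_bool accepts)"
  using checker_correct unfolding xtriple_def by blast

end

section \<open>Failure probability\<close>

lemma finite_hash_funs: "finite (hash_funs w k b)"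
  unfolding hash_funs_def elems_def by (intro finite_PiE) auto

lemma hash_funs_nonempty: "hash_funs w k b \<noteq> {}"
  unfolding hash_funs_def by (simp add: PiE_eq_empty_iff lessThan_empty_iff)

text \<open>Overwriting the value at \<open>x0\<close> maps a bad function and one of 2 ^ b values
  injectively to a hash function: the result shows \<open>v\<close> and all values off
  \<open>x0\<close>, and \<open>h x0\<close> is the only solution of the equation between the sums.
  Counting pairs in this way replaces conditioning on the values off \<open>x0\<close>.\<close>

lemma hash_collisions:
  assumes xs: "set xs \<subseteq> elems w k" and ys: "set ys \<subseteq> elems w k" and ne: "mset xs \<noteq> mset ys"
  shows "card {h \<in> hash_funs w k b. sum_list (map h xs) = sum_list (map h ys)} * 2 ^ b \<le> card (hash_funs w k b)"
proof -
  let ?X = "elems w k"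
  let ?bad = "{h \<in> hash_funs w k b. sum_list (map h xs) = sum_list (map h ys)}"
  have fin: "finite ?X" by (simp add: elems_def)
  obtain x0 where x0: "count_list xs x0 \<noteq> count_list ys x0"
    using ne by (metis count_mset multiset_eqI)
  have x0X: "x0 \<in> ?X"
  proof (rule ccontr)
    assume "x0 \<notin> ?X"
    then have "x0 \<notin> set xs" "x0 \<notin> set ys" using xs ys by auto
    then show False using x0 by (simp add: count_notin)
  qed
  define rest where "rest zs h = (\<Sum>x\<in>?X - {x0}. count_list zs x * h x)" for zs and h :: "nat \<Rightarrow> nat"
  have split: "sum_list (map h zs) = count_list zs x0 * h x0 + rest zs h" if "set zs \<subseteq> ?X" for h :: "nat \<Rightarrow> nat" and zs
    unfolding rest_def sum_list_map_eq_sum_count2[OF that fin] using fin x0X by (rule sum.remove)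
  have inj: "inj_on (\<lambda>(h, v). h(x0 := v)) (?bad \<times> {..<2 ^ b})"
  proof (rule inj_onI, clarify)
    fix h :: "nat \<Rightarrow> nat" and v and h' :: "nat \<Rightarrow> nat" and v'
    assume eq: "sum_list (map h xs) = sum_list (map h ys)" "sum_list (map h' xs) = sum_list (map h' ys)"
      and upd: "h(x0 := v) = h'(x0 := v')"
    have off: "h x = h' x" if "x \<noteq> x0" for x using fun_cong[OF upd, of x] that by simp
    have r: "rest zs h = rest zs h'" for zs unfolding rest_def by (intro sum.cong refl) (simp add: off)
    let ?cx = "int (count_list xs x0)" and ?cy = "int (count_list ys x0)"
    have "?cx * int (h x0) + int (rest xs h') = ?cy * int (h x0) + int (rest ys h')"
      using eq(1) unfolding split[OF xs] split[OF ys] r by (metis of_nat_add of_nat_mult)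
    moreover have "?cx * int (h' x0) + int (rest xs h') = ?cy * int (h' x0) + int (rest ys h')"
      using eq(2) unfolding split[OF xs] split[OF ys] by (metis of_nat_add of_nat_mult)
    \<comment> \<open>Both functions equalize the sums and agree off \<open>x0\<close>; subtracting
      the equations leaves a product whose first factor is nonzero by the choice of
      \<open>x0\<close>.\<close>
    ultimately have "(?cx - ?cy) * (int (h x0) - int (h' x0)) = 0" by (simp add: algebra_simps)
    then have "h x0 = h' x0" using x0 by simp
    then have "h = h'" using off by (metis ext)
    moreover have "v = v'" using fun_cong[OF upd, of x0] by simp
    ultimately show "h = h' \<and> v = v'" by simp
  qed
  have "(\<lambda>(h, v). h(x0 := v)) ` (?bad \<times> {..<2 ^ b}) \<subseteq> hash_funs w k b"
    using x0X by (auto simp: hash_funs_def PiE_iff extensional_def)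
  from card_inj_on_le[OF inj this finite_hash_funs] show ?thesis
    by (simp add: card_cartesian_product)
qed

lemma accuracy_bound:
  assumes "0 < \<delta>" "\<delta> < 1"
  shows "1 / 2 ^ accuracy \<delta> \<le> \<delta>" "real (accuracy \<delta>) \<le> log 2 (1 / \<delta>) + 1"
proof -
  have L: "0 < log 2 (1 / \<delta>)" using assms by simp
  then have "log 2 (1 / \<delta>) \<le> real (accuracy \<delta>)" unfolding accuracy_def by linarith
  then have "1 / \<delta> \<le> 2 powr real (accuracy \<delta>)" using assms by (simp add: log_le_iff)
  then have "1 / \<delta> \<le> 2 ^ accuracy \<delta>" by (simp add: powr_realpow)
  then show "1 / 2 ^ accuracy \<delta> \<le> \<delta>" using assms by (simp add: field_simps)
  show "real (accuracy \<delta>) \<le> log 2 (1 / \<delta>) + 1" using L unfolding accuracy_def by linarith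
qed

lemma run_exists:
  assumes inst: "sort_instance p n w k r A B" and h: "h \<in> hash_funs w k (accuracy \<delta>)"
  shows "\<exists>T S. run checker p n w k r A B \<delta> \<alpha> \<beta> h T S \<and>
    (\<forall>i\<in>{1..p}. S i ''verdict'' = of_bool (sorted_by r (whole p B) \<and>
       sum_list (map h (whole p A)) = sum_list (map h (whole p B))))"
proof -
  \<comment> \<open>Any admissible network will do here; \<open>exec_change_network\<close> restores
    the given one below.\<close>
  interpret sort_run p n w k "accuracy \<delta>" n r A B h 1 1
  proof
    fix i assume "i \<in> {1..p}"
    then show "length (A i) \<le> n \<and> length (B i) \<le> n"
      using length_le_whole[of i p A] length_le_whole[of i p B] inst by (simp add: sort_instance_def)
  qed (use assms in auto)
  from checker_run obtain T S where "exec p 1 1 EE checker (init_store p n w k (accuracy \<delta>) A B) T S"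
    and S: "\<forall>i\<in>{1..p}. S i ''verdict'' = of_bool accepts" by blast
  from exec_change_network[OF this(1)] S show ?thesis
    unfolding run_def accepts_iff by blast
qed

lemma sort_checker:
  assumes inst: "sort_instance p n w k r A B" and \<delta>: "0 < \<delta>" "\<delta> < 1"
  shows "sort_checker_on checker p n w k r A B \<delta> \<alpha> \<beta>"
proof -
  let ?H = "hash_funs w k (accuracy \<delta>)"
  let ?ok = "\<lambda>h. sorted_by r (whole p B) \<and> sum_list (map h (whole p A)) = sum_list (map h (whole p B))"
  let ?rej = "{h. \<exists>T S. run checker p n w k r A B \<delta> \<alpha> \<beta> h T S \<and> rejecting p S}"
  have acc: "\<exists>T S. run checker p n w k r A B \<delta> \<alpha> \<beta> h T S \<and> accepting p S" if "h \<in> ?H" "?ok h" for h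
    using run_exists[OF inst that(1), of \<alpha> \<beta>] that(2) unfolding accepting_def by auto
  have rej: "\<exists>T S. run checker p n w k r A B \<delta> \<alpha> \<beta> h T S \<and> rejecting p S" if "h \<in> ?H" "\<not> ?ok h" for h
    using run_exists[OF inst that(1), of \<alpha> \<beta>] that(2) unfolding rejecting_def by auto
  have el: "set (whole p A) \<subseteq> elems w k" "set (whole p B) \<subseteq> elems w k"
    using inst by (auto simp: sort_instance_def)
  have prob: "measure_pmf.prob (pmf_of_set ?H) ?rej \<ge> 1 - \<delta>" if ns: "\<not> is_sorted_version r (whole p A) (whole p B)"
  proof -
    define bad where "bad = {h \<in> ?H. ?ok h}"
    have fin: "finite ?H" "?H \<noteq> {}" by (rule finite_hash_funs hash_funs_nonempty)+
    have "card bad * 2 ^ accuracy \<delta> \<le> card ?H"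
    \<comment> \<open>Only the comparison of multisets is randomized: an unsorted sequence is
      rejected for every hash function.\<close>
    proof (cases "sorted_by r (whole p B)")
      case True
      then have "mset (whole p A) \<noteq> mset (whole p B)" using ns by (auto simp: is_sorted_version_def)
      from hash_collisions[OF el this, of "accuracy \<delta>"] show ?thesis using True by (simp add: bad_def)
    qed (simp add: bad_def)
    then have "real (card bad) * 2 ^ accuracy \<delta> \<le> real (card ?H)"
      by (metis of_nat_le_iff of_nat_mult of_nat_numeral of_nat_power)
    moreover have cH: "0 < real (card ?H)" using fin by (simp add: card_gt_0_iff)
    ultimately have "real (card bad) / real (card ?H) \<le> 1 / 2 ^ accuracy \<delta>" by (simp add: field_simps)
    also have "\<dots> \<le> \<delta>" by (rule accuracy_bound[OF \<delta>])
    finally have 1: "real (card bad) / real (card ?H) \<le> \<delta>" .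
    have "?H - bad \<subseteq> ?H \<inter> ?rej" using rej by (auto simp: bad_def)
    then have "card (?H - bad) \<le> card (?H \<inter> ?rej)" using fin by (intro card_mono) auto
    moreover have "card (?H - bad) = card ?H - card bad" "card bad \<le> card ?H"
      using fin by (auto simp: bad_def intro!: card_Diff_subset card_mono)
    ultimately have "real (card ?H) - real (card bad) \<le> real (card (?H \<inter> ?rej))" by simp
    then have "(real (card ?H) - real (card bad)) / real (card ?H) \<le> real (card (?H \<inter> ?rej)) / real (card ?H)"
      using cH by (intro divide_right_mono) auto
    then have "1 - real (card bad) / real (card ?H) \<le> real (card (?H \<inter> ?rej)) / real (card ?H)"
      using cH by (simp add: diff_divide_distrib)
    also have "\<dots> = measure_pmf.prob (pmf_of_set ?H) ?rej"
      using fin by (subst measure_pmf_of_set) (auto simp: Int_commute)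
    finally show ?thesis using 1 by linarith
  qed
  have sums: "?ok h" if "is_sorted_version r (whole p A) (whole p B)" for h :: "nat \<Rightarrow> nat"
  proof -
    have "mset (map h (whole p B)) = mset (map h (whole p A))" using that by (simp add: is_sorted_version_def)
    then have "sum_list (map h (whole p A)) = sum_list (map h (whole p B))" by (metis sum_mset_sum_list)
    then show ?thesis using that by (simp add: is_sorted_version_def)
  qed
  show ?thesis
    unfolding sort_checker_on_def using acc rej sums prob by blast
qed

section \<open>Running time\<close>

text \<open>Used for log (n / p), which is thereby charged to the local work n / p.\<close>

lemma log2_le_double: "log 2 y \<le> 2 * y" if "y > 0" for y :: real
proof -
  have "1 / 2 \<le> ln (2::real)" using exp_half_le2 by (subst ln_ge_iff) simp_all
  then have "y * 1 \<le> y * (2 * ln 2)" using that by (intro mult_left_mono) auto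
  moreover have "ln y \<le> y - 1" using that by (rule ln_le_minus_one)
  ultimately have "ln y \<le> 2 * y * ln 2" by simp
  then show ?thesis by (simp add: log_def divide_le_eq)
qed

lemma floor_log_le_log: "n \<ge> 1 \<Longrightarrow> real (floor_log n) \<le> log 2 (real n)"
  by (simp add: floor_log_altdef)

context
  fixes k :: nat and a \<gamma> :: real
begin

text \<open>With M = max (log (1 / \<delta>)) w, these satisfy log p \<le>
  \<open>depth_const\<close> * w, B \<le> \<open>bits_const\<close> * M and \<open>all_words\<close>
  \<le> \<open>words_const\<close> * M / w. The next three are the coefficients of n / (p w) * M, of
  \<beta> * M and of \<alpha> log p.\<close>

definition depth_const :: real where "depth_const = log 2 a + \<gamma>"
definition bits_const :: real where "bits_const = 5 + \<gamma> + depth_const + real k"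
definition words_const :: real where "words_const = 6 + 2 * bits_const + 2 * depth_const"
definition local_const :: real where
  "local_const = 10 * a + 422 * ((bits_const + 3 * depth_const + 6) * a) + 9 * ((1 + \<gamma>) * (2 + a))
     + 30 * (words_const * a * (2 + depth_const)) + 2 * a * (45 * words_const + 7 * real k)
     + 484 * (words_const * a) + 4 * real k * a"
definition volume_const :: real where
  "volume_const = 16 * (bits_const + depth_const + 1) + 2 * depth_const"
definition latency_const :: real where
  "latency_const = 422 * (2 * depth_const + 5) + 9 * (1 + \<gamma>) + 27"
definition time_const :: real where
  "time_const = local_const + volume_const + latency_const"

end

context sort_run
begin

text \<open>Every contribution is charged to the local term \<open>U\<close>, the volume term
  \<open>V\<close> or the latency term \<open>Z\<close>. The ratio \<mu> = M / w is the number of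
  words that the relevant numbers occupy up to constants.\<close>

lemma run_time_bound:
  fixes a \<gamma> L :: real
  assumes a: "1 \<le> a" and \<gamma>: "0 \<le> \<gamma>" and n: "n \<ge> 1" and \<alpha>: "1 \<le> \<alpha>" and pn: "real p \<le> a * real n"
    and logn: "log 2 (real n) \<le> \<gamma> * real w" and len: "real l \<le> a * (real n / real p)"
    and bL: "real b \<le> L + 1" and L: "0 < L"
  shows "run_time \<le> time_const k a \<gamma> *
    ((real n / (real p * real w) + \<beta>) * max L (real w) + \<alpha> * log 2 (real p))"
proof -
  define g KB KA where "g = depth_const a \<gamma>" and "KB = bits_const k a \<gamma>" and "KA = words_const k a \<gamma>"
  define M x lp W where "M = max L (real w)" and "x = real n / real p" and "lp = log 2 (real p)" and "W = real w"
  define \<mu> where "\<mu> = M / W"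
  define U V Z where "U = x * \<mu>" and "V = \<beta> * M" and "Z = \<alpha> * lp"
  note p = pos(1) and w = pos(2) and k1 = pos(3)
  have W1: "1 \<le> W" using w by (simp add: W_def)
  have MW: "W \<le> M" by (simp add: M_def W_def)
  have M1: "1 \<le> M" using MW W1 by simp
  have mu1: "1 \<le> \<mu>" using MW W1 by (simp add: \<mu>_def)
  have x0: "0 < x" using n p by (simp add: x_def)
  have ax: "1 \<le> a * x" using pn p by (simp add: x_def field_simps)
  have g0: "0 \<le> g" using a \<gamma> by (simp add: g_def depth_const_def)
  have lp0: "0 \<le> lp" using p by (simp add: lp_def)
  have V0: "0 \<le> V" using \<beta>0 M1 by (simp add: V_def)
  have Z: "lp \<le> Z" using lp0 \<alpha> mult_right_mono[of 1 \<alpha> lp] by (simp add: Z_def)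
  have U0: "0 \<le> U" using x0 mu1 by (simp add: U_def)
  have xU: "x \<le> U" using x0 mu1 mult_left_mono[of 1 \<mu> x] by (simp add: U_def)
  \<comment> \<open>There is at least a fraction 1 / a of an element per PE on average, so costs of
    order \<mu> that do not depend on n are absorbed by the local term.\<close>
  have muU: "\<mu> \<le> a * U"
    using mult_right_mono[OF ax, of \<mu>] mu1 by (simp add: U_def mult.assoc)
  have aU: "1 \<le> a * U" using muU mu1 by linarith
  have D: "real DD \<le> lp" using floor_log_le_log[OF p] by (simp add: lp_def)
  have ln0: "0 \<le> log 2 (real n)" using n by simp
  have gW: "lp \<le> g * W"
  proof -
    have "lp \<le> log 2 (a * real n)" unfolding lp_def using p pn by (intro log_mono) auto
    also have "\<dots> = log 2 a + log 2 (real n)" using a n by (simp add: log_mult)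
    also have "\<dots> \<le> log 2 a * W + \<gamma> * W"
      using logn a W1 mult_left_mono[of 1 W "log 2 a"] by (simp add: W_def)
    finally show ?thesis by (simp add: g_def depth_const_def algebra_simps)
  qed
  have DW: "real DD \<le> g * W" using D gW by simp
  have gWM: "g * W \<le> g * M" using g0 MW by (rule mult_left_mono[rotated])
  have DM: "real DD \<le> g * M" using DW gWM by simp
  have Fn: "real (floor_log n) \<le> log 2 (real n)" by (rule floor_log_le_log[OF n])
  have \<gamma>M: "\<gamma> * W \<le> \<gamma> * M" using \<gamma> MW by (rule mult_left_mono[rotated])
  have B: "real BB \<le> KB * M"
  proof -
    have "real BB = real b + real (floor_log n) + 1 + real DD + 1 + real k * W"
      by (simp add: total_bits_def W_def)
    moreover have "real k * W \<le> real k * M" using MW by (simp add: mult_left_mono)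
    moreover have "L \<le> M" by (simp add: M_def)
    ultimately have "real BB \<le> (M + 1) + \<gamma> * M + 1 + g * M + 1 + real k * M"
      using bL Fn logn \<gamma>M DM by (simp add: W_def)
    also have "\<dots> \<le> (5 + \<gamma> + g + real k) * M" using M1 by (simp add: algebra_simps)
    finally show ?thesis by (simp add: KB_def bits_const_def g_def)
  qed
  have KB0: "0 \<le> KB" using \<gamma> g0 by (simp add: KB_def bits_const_def g_def)
  have KA0: "0 \<le> KA" using KB0 g0 by (simp add: KA_def words_const_def KB_def g_def)
  \<comment> \<open>The gain from pipelining: rounds times chunk length is O(M), without a factor
    log p.\<close>
  have cD: "real CC * (real DD + 1) \<le> (KB + g + 1) * M"
  proof -
    have "(BB div (DD + 1)) * (DD + 1) \<le> BB" by (rule div_times_less_eq_dividend)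
    from of_nat_mono[OF this, where 'a = real] have "real (BB div (DD + 1)) * (real DD + 1) \<le> real BB"
      by (simp only: of_nat_mult of_nat_add of_nat_1)
    then have "real CC * (real DD + 1) \<le> real BB + real DD + 1"
      by (simp add: chunk_bits_def algebra_simps)
    also have "\<dots> \<le> KB * M + g * M + 1 * M" using B DM M1 by simp
    finally show ?thesis by (simp add: algebra_simps)
  qed
  have c: "real CC \<le> (KB + 1) * M"
  proof -
    have "BB div (DD + 1) \<le> BB" by (rule div_le_dividend)
    then have "real CC \<le> real BB + 1" by (simp add: chunk_bits_def)
    then show ?thesis using B M1 by (simp add: algebra_simps)
  qed
  have divr: "real (v div w) \<le> real v / W" for v by (simp add: W_def of_nat_div_le_of_nat)
  have dDW: "(2 * real DD + 4) / W \<le> 2 * g + 4"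
  proof -
    have "2 * real DD + 4 \<le> (2 * g + 4) * W" using DW W1 by (simp add: algebra_simps)
    then show ?thesis using W1 by (simp add: divide_le_eq)
  qed
  have all: "real all_words \<le> KA * \<mu>"
  proof -
    have "real all_words \<le> 1 + (real CC + (2 * real DD + 4) + real BB) / W"
      using divr[of "CC + 2 * DD + 4 + BB"] by (simp add: all_words_def add.assoc)
    also have "\<dots> = 1 + (2 * real DD + 4) / W + (real CC + real BB) / W" by (simp add: add_divide_distrib)
    also have "(real CC + real BB) / W \<le> ((KB + 1) * M + KB * M) / W"
      using B c W1 by (intro divide_right_mono) auto
    also have "((KB + 1) * M + KB * M) / W = (2 * KB + 1) * \<mu>" by (simp add: \<mu>_def algebra_simps add_divide_distrib)
    finally have "real all_words \<le> 1 + (2 * g + 4) + (2 * KB + 1) * \<mu>" using dDW by simp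
    also have "\<dots> \<le> (5 + 2 * g) * \<mu> + (2 * KB + 1) * \<mu>"
      using mult_left_mono[OF mu1, of "5 + 2 * g"] g0 by simp
    finally show ?thesis by (simp add: KA_def words_const_def KB_def[symmetric] g_def[symmetric] algebra_simps)
  qed
  have allU: "real all_words \<le> KA * a * U"
    using all mult_left_mono[OF muU KA0] by (simp add: mult.assoc)
  define s where "s = (real DD + 1) * real step_words"
  \<comment> \<open>The chunks contribute c * (D + 1) / w = O(\<mu>) by \<open>cD\<close>; the
    remaining O(D + 1) is split between latency and \<mu> \<ge> 1.\<close>
  have s: "s \<le> (2 * g + 5) * Z + (KB + 3 * g + 6) * a * U"
  proof -
    have "real step_words \<le> 1 + (2 * real DD + 4) / W + real CC / W"
      using divr[of "CC + 2 * DD + 4"] by (simp add: step_words_def add_divide_distrib)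
    also have "\<dots> \<le> (2 * g + 5) + real CC / W" using dDW by simp
    finally have "s \<le> (real DD + 1) * ((2 * g + 5) + real CC / W)"
      unfolding s_def by (intro mult_left_mono) auto
    also have "\<dots> = (2 * g + 5) * real DD + (2 * g + 5) + real CC * (real DD + 1) / W"
      by (simp add: algebra_simps)
    also have "real CC * (real DD + 1) / W \<le> (KB + g + 1) * M / W"
      using cD W1 by (intro divide_right_mono) auto
    also have "(KB + g + 1) * M / W = (KB + g + 1) * \<mu>" by (simp add: \<mu>_def)
    finally have "s \<le> (2 * g + 5) * real DD + (2 * g + 5) + (KB + g + 1) * \<mu>" by simp
    moreover have "(2 * g + 5) * real DD \<le> (2 * g + 5) * Z" using g0 D Z by (intro mult_left_mono) auto
    moreover have "(2 * g + 5) \<le> (2 * g + 5) * \<mu>" using mult_left_mono[OF mu1, of "2 * g + 5"] g0 by simp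
    ultimately have "s \<le> (2 * g + 5) * Z + (KB + 3 * g + 6) * \<mu>" by (simp add: algebra_simps)
    also have "(KB + 3 * g + 6) * \<mu> \<le> (KB + 3 * g + 6) * (a * U)" using muU KB0 g0 by (intro mult_left_mono) auto
    finally show ?thesis by (simp add: mult.assoc)
  qed
  define F where "F = (real (floor_log n) + 1) * real (words w n)"
  have F: "F \<le> (1 + \<gamma>) * (2 + a) * U + (1 + \<gamma>) * Z"
  proof -
    have wn: "real (words w n) \<le> 1 + \<gamma>"
    proof -
      have "real (floor_log n) / W \<le> \<gamma>" using Fn logn W1 by (simp add: divide_le_eq W_def)
      then show ?thesis using divr[of "floor_log n"] by (simp add: words_def)
    qed
    \<comment> \<open>log n need not be bounded by the local work n / p alone; the split leaves log
      p to the latency term.\<close>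
    have "log 2 (real n) = log 2 x + lp" using n p by (simp add: x_def lp_def log_divide)
    then have "real (floor_log n) + 1 \<le> 2 * x + lp + 1" using Fn log2_le_double[OF x0] by simp
    also have "\<dots> \<le> 2 * U + Z + a * U" using xU Z aU by simp
    finally have "F \<le> (2 * U + Z + a * U) * (1 + \<gamma>)" unfolding F_def using wn by (intro mult_mono) auto
    then show ?thesis by (simp add: algebra_simps)
  qed
  define G where "G = real all_words * real (words w (DD + 1))"
  have G: "G \<le> KA * a * (2 + g) * U"
  proof -
    have "words w (DD + 1) \<le> 1 + (DD + 1) div w" by (rule words_le[OF less_exp])
    then have "real (words w (DD + 1)) \<le> 1 + real (DD + 1) / W" using divr[of "DD + 1"] by linarith
    also have "real (DD + 1) / W \<le> g + 1"
    proof -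
      have "real (DD + 1) \<le> (g + 1) * W" using DW W1 by (simp add: algebra_simps)
      then show ?thesis using W1 by (simp add: divide_le_eq)
    qed
    finally have "G \<le> (KA * a * U) * (2 + g)" unfolding G_def using allU U0 KA0 a g0 by (intro mult_mono) auto
    then show ?thesis by (simp add: algebra_simps)
  qed
  define H where "H = (real l + 1) * (45 * real all_words + 7 * real k)"
  have H: "H \<le> 2 * a * (45 * KA + 7 * real k) * U"
  proof -
    have "real l + 1 \<le> 2 * (a * x)" using len ax by (simp add: x_def)
    moreover have "45 * real all_words + 7 * real k \<le> (45 * KA + 7 * real k) * \<mu>"
      using all mult_left_mono[OF mu1, of "7 * real k"] by (simp add: algebra_simps)
    ultimately have "H \<le> (2 * (a * x)) * ((45 * KA + 7 * real k) * \<mu>)"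
      unfolding H_def using ax by (intro mult_mono) auto
    then show ?thesis by (simp add: U_def algebra_simps)
  qed
  have D\<alpha>: "real DD * \<alpha> \<le> Z" using D \<alpha> by (simp add: Z_def mult.commute mult_right_mono)
  have D\<beta>: "real DD * \<beta> \<le> g * V" using mult_right_mono[OF DM \<beta>0] by (simp add: V_def algebra_simps)
  have D\<beta>c: "real DD * (\<beta> * real CC) \<le> (KB + g + 1) * V"
  proof -
    have "real DD * real CC \<le> (KB + g + 1) * M" using cD by (simp add: algebra_simps)
    from mult_right_mono[OF this \<beta>0] show ?thesis by (simp add: V_def algebra_simps)
  qed
  have DZ: "real DD \<le> Z" using D Z by simp
  have Ds: "real DD * real step_words \<le> s" by (simp add: s_def algebra_simps)
  have ka: "real k \<le> real k * a * U" using mult_left_mono[OF aU, of "real k"] by (simp add: mult.assoc)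
  \<comment> \<open>Stated for variables so that linear arithmetic does not see the nonlinear terms
    that are substituted afterwards.\<close>
  have weighted: "10 + 100 * s + 322 * ds + 9 * F + 30 * G + H + 484 * al + 4 * kk + 18 * d1 + 16 * d2 + 2 * d3 + 9 * d4
      \<le> 10 * u + 422 * sR + 9 * FR + 30 * GR + HR + 484 * aR + 4 * kR + 18 * Z + 16 * vR + 2 * gR + 9 * Z"
    if "1 \<le> u" "s \<le> sR" "ds \<le> s" "F \<le> FR" "G \<le> GR" "H \<le> HR" "al \<le> aR" "kk \<le> kR" "d1 \<le> Z" "d2 \<le> vR"
      "d3 \<le> gR" "d4 \<le> Z" for u sR ds FR GR HR al aR kk kR d1 d2 vR d3 gR d4 :: real
    using that by linarith
  \<comment> \<open>The four streams give 16 * D * \<alpha>, 16 * D * \<beta> * c, 320 * D *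
    \<open>step_words\<close>, 8 * D and 320 * \<open>all_words\<close>; the broadcast adds 2, 2 and
    1 to the coefficients of D * \<alpha>, D * \<open>step_words\<close> and D, and contributes 2 *
    D * \<beta>. The constant is 5 + 4 + 1.\<close>
  have "run_time = 10 + 100 * s + 322 * (real DD * real step_words) + 9 * F + 30 * G + H + 484 * real all_words + 4 * real k
      + 18 * (real DD * \<alpha>) + 16 * (real DD * (\<beta> * real CC)) + 2 * (real DD * \<beta>) + 9 * real DD"
    unfolding run_time_def prepare_time_def stream_time_def s_def F_def G_def H_def
    by (simp add: algebra_simps)
  also have "\<dots> \<le> 10 * (a * U) + 422 * ((2 * g + 5) * Z + (KB + 3 * g + 6) * a * U)
      + 9 * ((1 + \<gamma>) * (2 + a) * U + (1 + \<gamma>) * Z) + 30 * (KA * a * (2 + g) * U)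
      + 2 * a * (45 * KA + 7 * real k) * U + 484 * (KA * a * U) + 4 * (real k * a * U)
      + 18 * Z + 16 * ((KB + g + 1) * V) + 2 * (g * V) + 9 * Z"
    by (rule weighted[OF aU s Ds F G H allU ka D\<alpha> D\<beta>c D\<beta> DZ])
  also have "\<dots> = local_const k a \<gamma> * U + volume_const k a \<gamma> * V + latency_const a \<gamma> * Z"
    unfolding local_const_def volume_const_def latency_const_def g_def[symmetric] KB_def[symmetric] KA_def[symmetric]
    by (simp add: algebra_simps)
  also have "\<dots> \<le> time_const k a \<gamma> * U + time_const k a \<gamma> * V + time_const k a \<gamma> * Z"
  proof -
    have 0: "0 \<le> local_const k a \<gamma>" "0 \<le> volume_const k a \<gamma>" "0 \<le> latency_const a \<gamma>"
      using a \<gamma> g0 KB0 KA0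
      by (simp_all add: local_const_def volume_const_def latency_const_def g_def[symmetric] KB_def[symmetric] KA_def[symmetric])
    then show ?thesis using U0 V0 order_trans[OF lp0 Z] unfolding time_const_def
      by (intro add_mono mult_right_mono) auto
  qed
  also have "\<dots> = time_const k a \<gamma> * ((x / W + \<beta>) * M + \<alpha> * lp)"
    by (simp add: U_def V_def Z_def \<mu>_def algebra_simps)
  finally show ?thesis by (simp add: x_def W_def M_def lp_def)
qed

end

lemma time_const_pos:
  assumes "1 \<le> a" "0 \<le> \<gamma>"
  shows "0 < time_const k a \<gamma>"
proof -
  have g: "0 \<le> depth_const a \<gamma>" using assms by (simp add: depth_const_def)
  then have KB: "0 \<le> bits_const k a \<gamma>" using assms by (simp add: bits_const_def)
  with g have KA: "0 \<le> words_const k a \<gamma>" by (simp add: words_const_def)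
  have "0 \<le> local_const k a \<gamma>" "0 \<le> volume_const k a \<gamma>"
    using assms g KB KA by (simp_all add: local_const_def volume_const_def)
  moreover have "0 < latency_const a \<gamma>"
    using assms g by (simp add: latency_const_def add_nonneg_pos)
  ultimately show ?thesis by (simp add: time_const_def)
qed

text \<open>\<open>a\<close> and \<gamma> are arbitrary reals here, while the estimate wants 1 \<le>
  a and 0 \<le> \<gamma>; hence the maxima.\<close>

lemma checker_time:
  fixes a \<gamma> :: real
  assumes inst: "sort_instance p n w k r A B" and n: "n \<ge> 1"
    and bal: "balanced a p n A" "balanced a p n B"
    and \<delta>: "0 < \<delta>" "\<delta> < 1" and net: "1 \<le> \<alpha>" "0 \<le> \<beta>"
    and logn: "log 2 (real n) \<le> \<gamma> * real w" and h: "h \<in> hash_funs w k (accuracy \<delta>)"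
  shows "\<exists>T S. run checker p n w k r A B \<delta> \<alpha> \<beta> h T S \<and>
    T \<le> time_const k (max 1 a) (max 0 \<gamma>) *
      ((real n / (real p * real w) + \<beta>) * max (log 2 (1 / \<delta>)) (real w) + \<alpha> * log 2 (real p))"
proof -
  define x l where "x = real n / real p" and "l = nat \<lfloor>max 1 a * x\<rfloor>"
  have p: "p \<ge> 1" and w: "w \<ge> 1" and W: "length (whole p A) = n" using inst by (auto simp: sort_instance_def)
  have x0: "0 \<le> x" by (simp add: x_def)
  have ax: "a * x \<le> max 1 a * x" using x0 by (intro mult_right_mono) auto
  have len: "length (A i) \<le> l \<and> length (B i) \<le> l" if "i \<in> {1..p}" for i
  proof -
    have "real (length (A i)) \<le> max 1 a * x" "real (length (B i)) \<le> max 1 a * x"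
      using bal that ax unfolding balanced_def x_def by force+
    then show ?thesis unfolding l_def by (simp add: le_nat_floor)
  qed
  \<comment> \<open>A nonempty part together with balance yields 1 \<le> a * n / p. This bounds p by
    a * n, and with it the tree depth by O(w).\<close>
  have "\<exists>i\<in>{1..p}. A i \<noteq> []"
  proof (rule ccontr)
    assume "\<not> ?thesis"
    then have "whole p A = []" by (auto simp: whole_def)
    then show False using W n by simp
  qed
  then obtain i where i: "i \<in> {1..p}" "A i \<noteq> []" by blast
  then have "1 \<le> real (length (A i))" by (cases "A i") auto
  also have "\<dots> \<le> a * x" using bal(1) i(1) by (simp add: balanced_def x_def)
  finally have "1 \<le> max 1 a * x" using ax by linarith
  then have pn: "real p \<le> max 1 a * real n" using p by (simp add: x_def field_simps)
  interpret sort_run p n w k "accuracy \<delta>" l r A B h \<alpha> \<beta>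
    by unfold_locales (use inst h net len in auto)
  have logn': "log 2 (real n) \<le> max 0 \<gamma> * real w"
    using logn mult_right_mono[of \<gamma> "max 0 \<gamma>" "real w"] by simp
  have l: "real l \<le> max 1 a * (real n / real p)"
    unfolding l_def x_def[symmetric] using x0 by (intro of_nat_floor) simp
  have L: "0 < log 2 (1 / \<delta>)" using \<delta> by simp
  have "run_time \<le> time_const k (max 1 a) (max 0 \<gamma>) *
      ((real n / (real p * real w) + \<beta>) * max (log 2 (1 / \<delta>)) (real w) + \<alpha> * log 2 (real p))"
    by (rule run_time_bound[OF _ _ n net(1) pn logn' l accuracy_bound(2)[OF \<delta>] L]) simp_all
  then show ?thesis using checker_run unfolding run_def by (meson order_trans)
qed

theorem theorem3:
  shows "\<exists>c::prog.
    (\<forall>p n w k r A B \<delta> \<alpha> \<beta>.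
       sort_instance p n w k r A B \<and> 0 < \<delta> \<and> \<delta> < 1 \<longrightarrow>
       sort_checker_on c p n w k r A B \<delta> \<alpha> \<beta>) \<and>
    (\<forall>(k::nat) (a::real) (\<gamma>::real). \<exists>C>0.
       \<forall>p n w r A B \<delta> \<alpha> \<beta>.
         sort_instance p n w k r A B \<and> n \<ge> 1 \<and> balanced a p n A \<and> balanced a p n B \<and>
         0 < \<delta> \<and> \<delta> < 1 \<and> \<alpha> \<ge> 1 \<and> \<beta> \<ge> 0 \<and> log 2 (real n) \<le> \<gamma> * real w \<longrightarrow>
         (\<forall>h\<in>hash_funs w k (accuracy \<delta>). \<exists>T S. run c p n w k r A B \<delta> \<alpha> \<beta> h T S \<and>
            (real w \<le> \<gamma> * log 2 (1 / \<delta>) \<longrightarrow>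
               T \<le> C * ((real n / (real p * real w) + \<beta>) * log 2 (1 / \<delta>) + \<alpha> * log 2 (real p))) \<and>
            T \<le> C * ((real n / (real p * real w) + \<beta>) * max (log 2 (1 / \<delta>)) (real w)
                      + \<alpha> * log 2 (real p))))"
proof (intro exI[of _ checker] conjI allI impI)
  fix p n w k r A B and \<delta> \<alpha> \<beta> :: real
  assume "sort_instance p n w k r A B \<and> 0 < \<delta> \<and> \<delta> < 1"
  then show "sort_checker_on checker p n w k r A B \<delta> \<alpha> \<beta>" by (intro sort_checker) auto
next
  fix k :: nat and a \<gamma> :: real
  define C0 where "C0 = time_const k (max 1 a) (max 0 \<gamma>)"
  have C0: "0 < C0" unfolding C0_def by (rule time_const_pos) auto
  show "\<exists>C>0. \<forall>p n w r A B \<delta> \<alpha> \<beta>.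
         sort_instance p n w k r A B \<and> n \<ge> 1 \<and> balanced a p n A \<and> balanced a p n B \<and>
         0 < \<delta> \<and> \<delta> < 1 \<and> \<alpha> \<ge> 1 \<and> \<beta> \<ge> 0 \<and> log 2 (real n) \<le> \<gamma> * real w \<longrightarrow>
         (\<forall>h\<in>hash_funs w k (accuracy \<delta>). \<exists>T S. run checker p n w k r A B \<delta> \<alpha> \<beta> h T S \<and>
            (real w \<le> \<gamma> * log 2 (1 / \<delta>) \<longrightarrow>
               T \<le> C * ((real n / (real p * real w) + \<beta>) * log 2 (1 / \<delta>) + \<alpha> * log 2 (real p))) \<and>
            T \<le> C * ((real n / (real p * real w) + \<beta>) * max (log 2 (1 / \<delta>)) (real w)
                      + \<alpha> * log 2 (real p)))"
  \<comment> \<open>The factor max 1 \<gamma> pays for replacing max (log (1 / \<delta>)) w by log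
    (1 / \<delta>) when w \<le> \<gamma> log (1 / \<delta>).\<close>
  proof (rule exI[of _ "C0 * max 1 \<gamma>"], intro conjI allI impI ballI)
    show "0 < C0 * max 1 \<gamma>" using C0 by (intro mult_pos_pos) auto
  next
    fix p n w r A B and \<delta> \<alpha> \<beta> :: real and h
    assume asm: "sort_instance p n w k r A B \<and> n \<ge> 1 \<and> balanced a p n A \<and> balanced a p n B \<and>
         0 < \<delta> \<and> \<delta> < 1 \<and> \<alpha> \<ge> 1 \<and> \<beta> \<ge> 0 \<and> log 2 (real n) \<le> \<gamma> * real w"
      and h: "h \<in> hash_funs w k (accuracy \<delta>)"
    define L q z where "L = log 2 (1 / \<delta>)" and "q = real n / (real p * real w) + \<beta>" and "z = \<alpha> * log 2 (real p)"
    have "p \<ge> 1" using asm by (simp add: sort_instance_def)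
    then have 0: "0 \<le> q" "0 \<le> z" using asm by (simp_all add: q_def z_def)
    have L0: "0 < L" using asm by (simp add: L_def)
    from asm h obtain T S where run: "run checker p n w k r A B \<delta> \<alpha> \<beta> h T S"
      and T: "T \<le> C0 * (q * max L (real w) + z)"
      using checker_time[of p n w k r A B a \<delta> \<alpha> \<beta> \<gamma> h] unfolding C0_def L_def q_def z_def by blast
    have max_bound: "T \<le> C0 * max 1 \<gamma> * (q * max L (real w) + z)"
    proof -
      have "C0 * 1 * (q * max L (real w) + z) \<le> C0 * max 1 \<gamma> * (q * max L (real w) + z)"
        using C0 0 L0 by (intro mult_right_mono mult_left_mono add_nonneg_nonneg mult_nonneg_nonneg) auto
      with T show ?thesis by simp
    qed
    have log_bound: "T \<le> C0 * max 1 \<gamma> * (q * L + z)" if "real w \<le> \<gamma> * L"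
    proof -
      have "1 * L \<le> max 1 \<gamma> * L" "\<gamma> * L \<le> max 1 \<gamma> * L" using L0 by (intro mult_right_mono; simp)+
      then have "max L (real w) \<le> max 1 \<gamma> * L" using that by simp
      then have "q * max L (real w) \<le> q * (max 1 \<gamma> * L)" using 0 by (intro mult_left_mono)
      moreover have "1 * z \<le> max 1 \<gamma> * z" using 0 by (intro mult_right_mono) auto
      ultimately have "q * max L (real w) + z \<le> max 1 \<gamma> * (q * L + z)" by (simp add: algebra_simps)
      then have "C0 * (q * max L (real w) + z) \<le> C0 * (max 1 \<gamma> * (q * L + z))"
        using C0 by (intro mult_left_mono) auto
      from order_trans[OF T this] show ?thesis by (simp only: mult.assoc)
    qed
    show "\<exists>T S. run checker p n w k r A B \<delta> \<alpha> \<beta> h T S \<and>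
            (real w \<le> \<gamma> * log 2 (1 / \<delta>) \<longrightarrow>
               T \<le> C0 * max 1 \<gamma> * ((real n / (real p * real w) + \<beta>) * log 2 (1 / \<delta>) + \<alpha> * log 2 (real p))) \<and>
            T \<le> C0 * max 1 \<gamma> * ((real n / (real p * real w) + \<beta>) * max (log 2 (1 / \<delta>)) (real w)
                      + \<alpha> * log 2 (real p))"
      using run max_bound log_bound unfolding L_def q_def z_def by blast
  qed
qed

end
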